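(* Let $\mathbf A(\omega)$ be a measurable (random) skew symmetric transformation on $H$, and assume that $\mathbf A(\omega)$ transforms $\mathbb D_{p,1}(H)$ into $\mathbb D_{p,1}(H)$. Let $\{e_i\}_{i\ge1}$ be a smooth orthonormal basis of $H$ such that $B(\omega)=\sum_{i=1}^\infty\delta(\mathbf A(\omega)e_i)\,e_i$ converges in $L^1(\mu;W)$. Assume that $T_t\omega$, $t\in\mathbb R$, solves $$\frac{dT_t\omega}{dt}=B(T_t\omega),\qquad T_0\omega=\omega,$$ and that $T_t\omega$, $t\in\mathbb R$, is a stationary process. Let $f_0$ be a smooth functional on $W$ for which $f_0(T_t\omega)\in\mathbb D_{p,2}$. Then $f(t,\omega):=f_0(T_t\omega)$ solves the equation $$\frac{df(t,\omega)}{dt}=\delta\left(\mathbf A(\omega)\nabla f(t,\omega)\right),\qquad f(0,\omega)=f_0(\omega).$$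
   Context: $(W,H,\mu)$ is an infinite dimensional abstract Wiener space: $W$ is a separable Banach space, $H$ a Hilbert space densely and continuously embedded in $W$, and $\mu$ the Gaussian measure on $W$ under which each $l\in W^*$ is an $N(0,|l|_H^2)$ random variable; $W^*\subset H\subset W$ through the canonical embeddings. $\{\delta h,\ h\in H\}$ is the zero-mean Gaussian field with $E[\delta h\,\delta k]=(h,k)_H$. An orthonormal basis $\{e_i\}$ of $H$ is smooth if $e_i\in W^*$ for all $i$. $\mathbb D_{p,k}$ and $\mathbb D_{p,k}(H)$ are the classical (Malliavin calculus) Sobolev spaces of real valued and $H$-valued random variables, with $\nabla:\mathbb D_{p,k}\to\mathbb D_{p,k-1}(H)$ the gradient and $\delta:\mathbb D_{p,k}(H)\to\mathbb D_{p,k-1}$ the divergence (characterized by $E(v,\nabla\Phi)_H=E[\Phi\,\delta v]$). Smooth functionals are those of the form $\varphi(\delta l_1,\ldots,\delta l_n)$ with $n\in\mathbb N$, $l_i\in W^*$, $\varphi\in C_b^\infty(\mathbb R^n)$. Stationary process: measure preserving transformations $T_t$, $t\in\mathbb R$, of $(W,\mu)$ with $T_0\omega=\omega$ form a stationary process if for any $n$, any $t_1,\ldots,t_n$, any smooth $\varphi_1,\ldots,\varphi_n$ and any $\tau$, the random vectors $(\varphi_1(T_{t_1}\omega),\ldots,\varphi_n(T_{t_n}\omega))$ and $(\varphi_1(T_{t_1+\tau}\omega),\ldots,\varphi_n(T_{t_n+\tau}\omega))$ have the same law. *)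

theory Defs
  imports "HOL-Probability.Probability"
begin

section \<open>Abstract Wiener space\<close>

text \<open>
  The inclusion of H in W is an explicit injective bounded linear map \<open>\<iota>\<close>.
  The canonical image in H of a functional \<open>l\<close> on W is its Riesz representer along \<open>\<iota>\<close>;
  it exists and is unique because H is complete.
\<close>

definition dual_embed ::
    "('h::{real_inner, banach} \<Rightarrow>\<^sub>L 'w::banach) \<Rightarrow> ('w \<Rightarrow>\<^sub>L real) \<Rightarrow> 'h" where
  "dual_embed \<iota> l = (THE h. \<forall>k. h \<bullet> k = l (\<iota> k))"

definition gaussian_law :: "real \<Rightarrow> real measure" where
  "gaussian_law s = (if s = 0 then return borel 0 else density lborel (normal_density 0 s))"
  \<comment> \<open>standard deviation \<open>s\<close>; \<^const>\<open>normal_density\<close> is not a density for \<open>s = 0\<close>\<close>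

text \<open>
  Separability of W is the class \<^class>\<open>second_countable_topology\<close>. Imposing it on H as well
  (for Bochner integrals) loses nothing: the Cameron-Martin space of a separable W is separable.
\<close>

definition abstract_wiener_space ::
    "'w measure \<Rightarrow> ('h::{real_inner, banach, second_countable_topology} \<Rightarrow>\<^sub>L
       'w::{banach, second_countable_topology}) \<Rightarrow> bool" where
  "abstract_wiener_space \<mu> \<iota> \<longleftrightarrow>
     prob_space \<mu> \<and> sets \<mu> = sets borel \<and>
     inj (blinfun_apply \<iota>) \<and> closure (range (blinfun_apply \<iota>)) = UNIV \<and>
     (\<forall>S::'h set. finite S \<longrightarrow> span S \<noteq> UNIV) \<and>
     (\<forall>l::'w \<Rightarrow>\<^sub>L real. distr \<mu> borel (blinfun_apply l) = gaussian_law (norm (dual_embed \<iota> l)))"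

definition smooth_onb ::
    "('h::{real_inner, banach} \<Rightarrow>\<^sub>L 'w::banach) \<Rightarrow> (nat \<Rightarrow> 'h) \<Rightarrow> bool" where
  "smooth_onb \<iota> e \<longleftrightarrow>
     (\<forall>i j. e i \<bullet> e j = (if i = j then 1 else 0)) \<and> closure (span (range e)) = UNIV \<and>
     (\<forall>i. e i \<in> range (dual_embed \<iota>))"


section \<open>Smooth functionals\<close>

text \<open>
  As the dimension \<open>n\<close> varies, a function on \<open>n\<close>-dimensional space is represented by a function
  of sequences that depends on the first \<open>n\<close> coordinates only. It is smooth with all derivatives
  bounded iff all its iterated partial derivatives exist, are continuous and are bounded.
\<close>

definition pd :: "nat \<Rightarrow> ((nat \<Rightarrow> real) \<Rightarrow> real) \<Rightarrow> (nat \<Rightarrow> real) \<Rightarrow> real" where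
  "pd i \<phi> x = deriv (\<lambda>s. \<phi> (x(i := s))) (x i)"

definition Cb_infinity :: "nat \<Rightarrow> ((nat \<Rightarrow> real) \<Rightarrow> real) \<Rightarrow> bool" where
  "Cb_infinity n \<phi> \<longleftrightarrow>
     (\<forall>x y. (\<forall>i<n. x i = y i) \<longrightarrow> \<phi> x = \<phi> y) \<and>
     (\<forall>is. set is \<subseteq> {..<n} \<longrightarrow>
        continuous_on UNIV (foldr pd is \<phi>) \<and> bounded (range (foldr pd is \<phi>)) \<and>
        (\<forall>i<n. \<forall>x. (\<lambda>s. foldr pd is \<phi> (x(i := s))) differentiable (at (x i))))"

text \<open>
  For a functional \<open>l\<close> on W, the Gaussian variable \<open>\<delta> l\<close> is \<open>\<omega> \<mapsto> l \<omega>\<close>.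
\<close>

definition cylinder ::
    "(nat \<Rightarrow> 'w::real_normed_vector \<Rightarrow>\<^sub>L real) \<Rightarrow> ((nat \<Rightarrow> real) \<Rightarrow> real) \<Rightarrow> 'w \<Rightarrow> real" where
  "cylinder l \<phi> \<omega> = \<phi> (\<lambda>j. l j \<omega>)"

definition smooth_functional :: "('w::real_normed_vector \<Rightarrow> real) \<Rightarrow> bool" where
  "smooth_functional F \<longleftrightarrow> (\<exists>n l \<phi>. Cb_infinity n \<phi> \<and> F = cylinder l \<phi>)"

definition smooth_grad ::
    "('h::{real_inner, banach} \<Rightarrow>\<^sub>L 'w::banach) \<Rightarrow> ('w \<Rightarrow> real) \<Rightarrow> ('w \<Rightarrow> 'h) \<Rightarrow> bool" where
  "smooth_grad \<iota> F G \<longleftrightarrow>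
     (\<exists>n l \<phi>. Cb_infinity n \<phi> \<and> F = cylinder l \<phi> \<and>
        G = (\<lambda>\<omega>. \<Sum>j<n. cylinder l (pd j \<phi>) \<omega> *\<^sub>R dual_embed \<iota> (l j)))"

text \<open>
  Smooth H-valued variables \<open>\<Sum>\<^sub>j F\<^sub>j h\<^sub>j\<close> with gradient \<open>\<Sum>\<^sub>j \<nabla>F\<^sub>j \<otimes> h\<^sub>j\<close>, an element of the tensor square of H
  being read as a Hilbert-Schmidt operator: \<open>g \<otimes> h\<close> is \<open>x \<mapsto> (g \<bullet> x) h\<close>.
\<close>

definition smooth_grad_H ::
    "('h::{real_inner, banach} \<Rightarrow>\<^sub>L 'w::banach) \<Rightarrow> ('w \<Rightarrow> 'h) \<Rightarrow> ('w \<Rightarrow> 'h \<Rightarrow>\<^sub>L 'h) \<Rightarrow> bool" where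
  "smooth_grad_H \<iota> u K \<longleftrightarrow>
     (\<exists>m F G h. (\<forall>j<m::nat. smooth_grad \<iota> (F j) (G j)) \<and>
        u = (\<lambda>\<omega>. \<Sum>j<m. F j \<omega> *\<^sub>R h j) \<and>
        K = (\<lambda>\<omega>. \<Sum>j<m. blinfun_scaleR_left (h j) o\<^sub>L blinfun_inner_right (G j \<omega>)))"


section \<open>Sobolev spaces\<close>

text \<open>
  The squared Hilbert-Schmidt norm, the sum of \<open>(norm (K b))\<^sup>2\<close> over an orthonormal basis, is by
  Bessel's inequality the supremum of the sums over finite orthonormal sets.
\<close>

definition hs_partial_sums :: "('h::{real_inner, banach} \<Rightarrow>\<^sub>L 'h) \<Rightarrow> real set" where
  "hs_partial_sums K =
     (\<lambda>S. \<Sum>x\<in>S. (norm (K x))\<^sup>2) ` {S. finite S \<and> pairwise orthogonal S \<and> (\<forall>x\<in>S. norm x = 1)}"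

definition hilbert_schmidt :: "('h::{real_inner, banach} \<Rightarrow>\<^sub>L 'h) \<Rightarrow> bool" where
  "hilbert_schmidt K \<longleftrightarrow> bdd_above (hs_partial_sums K)"

definition hs_norm :: "('h::{real_inner, banach} \<Rightarrow>\<^sub>L 'h) \<Rightarrow> real" where
  "hs_norm K = sqrt (Sup (hs_partial_sums K))"

definition Lp_null :: "'w measure \<Rightarrow> real \<Rightarrow> (nat \<Rightarrow> 'w \<Rightarrow> real) \<Rightarrow> bool" where
  "Lp_null \<mu> p X \<longleftrightarrow> (\<lambda>n. \<integral>\<^sup>+\<omega>. ennreal (\<bar>X n \<omega>\<bar> powr p) \<partial>\<mu>) \<longlonglongrightarrow> 0"

definition Lp_conv ::
    "'w measure \<Rightarrow> real \<Rightarrow> (nat \<Rightarrow> 'w \<Rightarrow> 'b::real_normed_vector) \<Rightarrow> ('w \<Rightarrow> 'b) \<Rightarrow> bool" where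
  "Lp_conv \<mu> p X Y \<longleftrightarrow> Lp_null \<mu> p (\<lambda>n \<omega>. norm (X n \<omega> - Y \<omega>))"

definition Lp_conv_HS ::
    "'w measure \<Rightarrow> real \<Rightarrow> (nat \<Rightarrow> 'w \<Rightarrow> 'h::{real_inner, banach} \<Rightarrow>\<^sub>L 'h) \<Rightarrow>
       ('w \<Rightarrow> 'h \<Rightarrow>\<^sub>L 'h) \<Rightarrow> bool" where
  "Lp_conv_HS \<mu> p X Y \<longleftrightarrow>
     (\<forall>\<omega>. hilbert_schmidt (Y \<omega>)) \<and> (\<forall>x. (\<lambda>\<omega>. Y \<omega> x) \<in> borel_measurable \<mu>) \<and>
     Lp_null \<mu> p (\<lambda>n \<omega>. hs_norm (X n \<omega> - Y \<omega>))"

text \<open>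
  The spaces are the closures of the smooth variables under the Sobolev norms. Random variables
  are not identified when equal almost surely, so a gradient is a relation: \<open>malliavin_grad \<mu> \<iota> p F G\<close>
  says that \<open>F\<close> is in \<open>D\<^sub>p\<^sub>,\<^sub>1\<close> and \<open>G\<close> is a version of \<open>\<nabla>F\<close>.
\<close>

definition malliavin_grad ::
    "'w measure \<Rightarrow> ('h::{real_inner, banach, second_countable_topology} \<Rightarrow>\<^sub>L
       'w::{banach, second_countable_topology}) \<Rightarrow> real \<Rightarrow> ('w \<Rightarrow> real) \<Rightarrow> ('w \<Rightarrow> 'h) \<Rightarrow> bool" where
  "malliavin_grad \<mu> \<iota> p F G \<longleftrightarrow>
     F \<in> borel_measurable \<mu> \<and> G \<in> borel_measurable \<mu> \<and>
     (\<exists>F' G'. (\<forall>n. smooth_grad \<iota> (F' n) (G' n)) \<and> Lp_conv \<mu> p F' F \<and> Lp_conv \<mu> p G' G)"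

definition sobolev_H_1 ::
    "'w measure \<Rightarrow> ('h::{real_inner, banach, second_countable_topology} \<Rightarrow>\<^sub>L
       'w::{banach, second_countable_topology}) \<Rightarrow> real \<Rightarrow> ('w \<Rightarrow> 'h) set" where
  "sobolev_H_1 \<mu> \<iota> p =
     {u \<in> borel_measurable \<mu>. \<exists>K u' K'.
        (\<forall>n. smooth_grad_H \<iota> (u' n) (K' n)) \<and> Lp_conv \<mu> p u' u \<and> Lp_conv_HS \<mu> p K' K}"

definition sobolev_2 ::
    "'w measure \<Rightarrow> ('h::{real_inner, banach, second_countable_topology} \<Rightarrow>\<^sub>L
       'w::{banach, second_countable_topology}) \<Rightarrow> real \<Rightarrow> ('w \<Rightarrow> real) set" where
  "sobolev_2 \<mu> \<iota> p =
     {F \<in> borel_measurable \<mu>. \<exists>G K F' G' K'. G \<in> borel_measurable \<mu> \<and>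
        (\<forall>n. smooth_grad \<iota> (F' n) (G' n) \<and> smooth_grad_H \<iota> (G' n) (K' n)) \<and>
        Lp_conv \<mu> p F' F \<and> Lp_conv \<mu> p G' G \<and> Lp_conv_HS \<mu> p K' K}"

text \<open>
  \<open>has_divergence \<mu> \<iota> v d\<close>: \<open>d\<close> is a version of \<open>\<delta> v\<close>. Smooth functionals and their gradients are
  bounded, so the duality makes sense for integrable \<open>v\<close> and \<open>d\<close> and determines \<open>d\<close> almost surely;
  for \<open>v\<close> in \<open>D\<^sub>p\<^sub>,\<^sub>1(H)\<close>, \<open>p > 1\<close>, it is the usual divergence.
\<close>

definition has_divergence ::
    "'w measure \<Rightarrow> ('h::{real_inner, banach, second_countable_topology} \<Rightarrow>\<^sub>L
       'w::{banach, second_countable_topology}) \<Rightarrow> ('w \<Rightarrow> 'h) \<Rightarrow> ('w \<Rightarrow> real) \<Rightarrow> bool" where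
  "has_divergence \<mu> \<iota> v d \<longleftrightarrow>
     integrable \<mu> v \<and> integrable \<mu> d \<and>
     (\<forall>\<Phi> G. smooth_grad \<iota> \<Phi> G \<longrightarrow> (\<integral>\<omega>. v \<omega> \<bullet> G \<omega> \<partial>\<mu>) = (\<integral>\<omega>. \<Phi> \<omega> * d \<omega> \<partial>\<mu>))"


section \<open>Random transformations\<close>

definition skew_symmetric :: "('h::real_inner \<Rightarrow>\<^sub>L 'h) \<Rightarrow> bool" where
  "skew_symmetric L \<longleftrightarrow> (\<forall>h k. L h \<bullet> k = - (h \<bullet> L k))"

definition stationary_process ::
    "'w::real_normed_vector measure \<Rightarrow> (real \<Rightarrow> 'w \<Rightarrow> 'w) \<Rightarrow> bool" where
  "stationary_process \<mu> T \<longleftrightarrow>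
     (\<forall>t. T t \<in> measurable \<mu> \<mu> \<and> distr \<mu> \<mu> (T t) = \<mu>) \<and> (\<forall>\<omega>. T 0 \<omega> = \<omega>) \<and>
     (\<forall>n::nat. \<forall>t \<phi> \<tau>. (\<forall>i<n. smooth_functional (\<phi> i)) \<longrightarrow>
        distr \<mu> (Pi\<^sub>M {..<n} (\<lambda>_. borel)) (\<lambda>\<omega>. \<lambda>i\<in>{..<n}. \<phi> i (T (t i) \<omega>)) =
        distr \<mu> (Pi\<^sub>M {..<n} (\<lambda>_. borel)) (\<lambda>\<omega>. \<lambda>i\<in>{..<n}. \<phi> i (T (t i + \<tau>) \<omega>)))"

end

theory Submission
  imports Defs "HOL-Real_Asymp.Real_Asymp"
begin

text \<open>
  Why the equation holds. Let \<open>f\<^sub>0 = \<phi>(l\<^sub>0, \<dots>)\<close> be smooth. By the chain rule along the flow,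
  \<open>f(t, \<omega>) = f\<^sub>0 (T\<^sub>t \<omega>)\<close> has the time derivative \<open>D(t) = r\<^sub>0 \<circ> T\<^sub>t\<close> with
  \<open>r\<^sub>0 = \<Sum>\<^sub>j \<partial>\<^sub>j\<phi> \<cdot> l\<^sub>j(B)\<close>. What has to be shown is that \<open>D(t)\<close> is the divergence of \<open>A \<nabla>f(t)\<close>,
  that is \<open>E (A \<nabla>f(t), \<nabla>\<Phi>) = E \<Phi> D(t)\<close> for smooth \<open>\<Phi>\<close>.

  Stationarity moves the time derivative from one factor to the other:
  \<open>E \<Phi> f(t + \<epsilon>) = E \<Phi>(T\<^sub>-\<^sub>\<epsilon>) f(t)\<close>, and hence \<open>E \<Phi> D(t) = - E f(t) r\<close>, where \<open>r\<close> is the rate of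
  change of \<open>\<Phi>\<close> along the flow (\<open>flow_antisymmetry\<close>). The difference quotients converge in L1
  because they are averages of identically distributed integrable derivatives, hence uniformly
  integrable (\<open>difference_quotient_L1\<close>).

  It remains to compute \<open>E f(t) r\<close>. Inserting \<open>B = \<Sum>\<^sub>i \<delta>(A e\<^sub>i) e\<^sub>i\<close> and the duality that defines
  \<open>\<delta>(A e\<^sub>i)\<close>, applied to the products \<open>f(t) \<partial>\<^sub>j\<Phi>\<close>, gives
  \<open>- E (A \<nabla>f(t), \<nabla>\<Phi>)\<close> plus a second order term \<open>\<Sum>\<^sub>j\<^sub>k \<partial>\<^sub>j\<partial>\<^sub>k\<Phi> (A l\<^sub>j, l\<^sub>k)\<close>. The latter vanishes, since
  the Hessian is symmetric and \<open>A\<close> is skew (\<open>drift_pairing\<close>).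

  The delicate point is that \<open>f(t)\<close> is not smooth, only an element of \<open>D\<^sub>p\<^sub>,\<^sub>2\<close>. For \<open>p < 2\<close> the
  product \<open>(A e\<^sub>i, \<nabla>F)\<close> of two \<open>L\<^sup>p\<close> variables is not controlled by their norms, so the duality does not
  pass to the limit directly. Two facts help. The variable \<open>f(t)\<close> is bounded, so that the
  approximations can be truncated by \<open>R sin(F/R)\<close> (\<open>truncated_duality\<close>, \<open>bounded_duality\<close>).
  And \<open>(A e\<^sub>i, u) = - (e\<^sub>i, A u)\<close> is integrable for every \<open>u\<close> in \<open>D\<^sub>p\<^sub>,\<^sub>1(H)\<close>, as \<open>A\<close> preserves this space;
  by a uniform boundedness argument the pairing with \<open>A e\<^sub>i\<close> is then continuous from \<open>D\<^sub>p\<^sub>,\<^sub>1(H)\<close> to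
  \<open>L\<^sup>1\<close> (\<open>weak_pairing_LIMSEQ\<close>).

  Finally, gradients are only relations, and the version of \<open>\<nabla>f(t)\<close> in the statement need not be the
  one approximated in \<open>D\<^sub>p\<^sub>,\<^sub>1(H)\<close>. They agree almost surely (\<open>gradient_unique\<close>), by Gaussian
  integration by parts (\<open>integration_by_parts\<close>) and because smooth functionals separate integrable
  variables (\<open>smooth_functionals_separate\<close>). Both rest on the fact that a finite measure on a separable
  Banach space is determined by its characteristic functional (\<open>finite_measure_eqI_char\<close>), whose
  proof needs a norming functional for every vector (\<open>norming_functional\<close>).
\<close>

section \<open>Functionals and characteristic functionals on a separable Banach space\<close>

text \<open>
  The Hahn-Banach theorem is needed only for extending a functional that is norming at a given point.
  The short route avoids partial functionals: linear functionals are the minimal elements among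
  the sublinear functions below the norm.
\<close>

definition norm_sublinear :: "('a::real_normed_vector \<Rightarrow> real) \<Rightarrow> bool" where
  "norm_sublinear q \<longleftrightarrow> (\<forall>x y. q (x + y) \<le> q x + q y) \<and>
     (\<forall>t x. 0 < t \<longrightarrow> q (t *\<^sub>R x) \<le> t * q x) \<and> (\<forall>x. q x \<le> norm x)"

text \<open>
  Lowers \<open>q\<close> so that it becomes linear in the direction of \<open>y\<close>. Hence a sublinear \<open>q\<close> that cannot be
  lowered in this way satisfies \<open>q (- y) = - q y\<close>.
\<close>

definition tilt :: "('a::real_normed_vector \<Rightarrow> real) \<Rightarrow> 'a \<Rightarrow> 'a \<Rightarrow> real" where
  "tilt q y x = (INF t\<in>{0..}. q (x + t *\<^sub>R y) - t * q y)"

lemma norm_sublinear_zero: "norm_sublinear q \<Longrightarrow> q 0 = 0"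
  unfolding norm_sublinear_def by (metis add.right_neutral add_0 add_le_cancel_left norm_zero order_antisym)

lemma norm_sublinear_lower: "norm_sublinear q \<Longrightarrow> - norm x \<le> q x"
  using norm_sublinear_zero[of q] unfolding norm_sublinear_def
  by (smt (verit, ccfv_SIG) add.right_inverse norm_minus_cancel)

lemma norm_sublinear_scale: "norm_sublinear q \<Longrightarrow> 0 \<le> t \<Longrightarrow> q (t *\<^sub>R x) = t * q x"
proof (cases "t = 0")
  case False
  assume q: "norm_sublinear q" and t: "0 \<le> t"
  with False have t0: "t > 0" by simp
  have 1: "q (t *\<^sub>R x) \<le> t * q x" using q t0 unfolding norm_sublinear_def by blast
  have "q (inverse t *\<^sub>R (t *\<^sub>R x)) \<le> inverse t * q (t *\<^sub>R x)"
    using q t0 unfolding norm_sublinear_def by (meson positive_imp_inverse_positive)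
  then have "t * q x \<le> q (t *\<^sub>R x)" using t0 by (simp add: field_simps)
  with 1 show ?thesis by simp
qed (use norm_sublinear_zero in auto)

lemma tilt_bdd:
  assumes "norm_sublinear q"
  shows "bdd_below ((\<lambda>t. q (x + t *\<^sub>R y) - t * q y) ` {0..})"
proof (rule bdd_belowI2)
  fix t :: real assume "t \<in> {0..}"
  then have "t * q y = q ((x + t *\<^sub>R y) + (- x))" using norm_sublinear_scale[OF assms] by simp
  also have "\<dots> \<le> q (x + t *\<^sub>R y) + q (- x)" using assms unfolding norm_sublinear_def by blast
  finally show "- q (- x) \<le> q (x + t *\<^sub>R y) - t * q y" by simp
qed

lemma tilt_le: "norm_sublinear q \<Longrightarrow> 0 \<le> t \<Longrightarrow> tilt q y x \<le> q (x + t *\<^sub>R y) - t * q y"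
  unfolding tilt_def by (rule cINF_lower[OF tilt_bdd]) auto

lemma tilt_ge: "(\<And>t. 0 \<le> t \<Longrightarrow> c \<le> q (x + t *\<^sub>R y) - t * q y) \<Longrightarrow> c \<le> tilt q y x"
  unfolding tilt_def by (rule cINF_greatest) auto

lemma tilt_le_self: "norm_sublinear q \<Longrightarrow> tilt q y x \<le> q x"
  using tilt_le[of q 0 y x] by simp

lemma tilt_uminus: "norm_sublinear q \<Longrightarrow> tilt q y (- y) \<le> - q y"
  using tilt_le[of q 1 y "-y"] norm_sublinear_zero[of q] by simp

lemma norm_sublinear_tilt:
  assumes q: "norm_sublinear q"
  shows "norm_sublinear (tilt q y)"
  unfolding norm_sublinear_def
proof (intro conjI allI impI)
  have sub: "q (u + v) \<le> q u + q v" for u v using q unfolding norm_sublinear_def by blast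
  fix x1 x2
  have *: "tilt q y (x1 + x2) \<le> (q (x1 + t1 *\<^sub>R y) - t1 * q y) + (q (x2 + t2 *\<^sub>R y) - t2 * q y)"
    if "0 \<le> t1" "0 \<le> t2" for t1 t2
    using tilt_le[OF q, of "t1 + t2" y "x1 + x2"] that sub[of "x1 + t1 *\<^sub>R y" "x2 + t2 *\<^sub>R y"]
    by (simp add: algebra_simps)
  have "tilt q y (x1 + x2) - (q (x1 + t1 *\<^sub>R y) - t1 * q y) \<le> tilt q y x2" if "0 \<le> t1" for t1
    by (rule tilt_ge) (use *[OF that] in force)
  then have "tilt q y (x1 + x2) - tilt q y x2 \<le> tilt q y x1"
    by (intro tilt_ge) force
  then show "tilt q y (x1 + x2) \<le> tilt q y x1 + tilt q y x2" by simp
next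
  fix s :: real and x assume s: "0 < s"
  have "inverse s * tilt q y (s *\<^sub>R x) \<le> tilt q y x"
  proof (rule tilt_ge)
    fix t :: real assume t: "0 \<le> t"
    have "tilt q y (s *\<^sub>R x) \<le> q (s *\<^sub>R (x + t *\<^sub>R y)) - (s * t) * q y"
      using tilt_le[OF q, of "s * t" y "s *\<^sub>R x"] s t by (simp add: algebra_simps)
    also have "\<dots> = s * (q (x + t *\<^sub>R y) - t * q y)"
      using norm_sublinear_scale[OF q, of s "x + t *\<^sub>R y"] s by (simp add: algebra_simps)
    finally show "inverse s * tilt q y (s *\<^sub>R x) \<le> q (x + t *\<^sub>R y) - t * q y"
      using s by (simp add: field_simps)
  qed
  then show "tilt q y (s *\<^sub>R x) \<le> s * tilt q y x" using s by (simp add: field_simps)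
next
  fix x show "tilt q y x \<le> norm x"
    using tilt_le_self[OF q] q unfolding norm_sublinear_def by (meson order_trans)
qed

lemma norm_sublinear_norm: "norm_sublinear norm"
  unfolding norm_sublinear_def by (auto intro: norm_triangle_ineq)

text \<open>
  Zorn's lemma: a chain has its pointwise infimum as a lower bound, which is finite since all
  members are bounded below by \<open>- norm\<close>.
\<close>

lemma norm_sublinear_minimal:
  fixes q0 :: "'a::real_normed_vector \<Rightarrow> real"
  assumes q0: "norm_sublinear q0"
  obtains m where "norm_sublinear m" "m \<le> q0" "\<And>q. norm_sublinear q \<Longrightarrow> q \<le> m \<Longrightarrow> q = m"
proof -
  define A where "A = {q. norm_sublinear q \<and> q \<le> q0}"
  define P where "P = (\<lambda>a b::'a \<Rightarrow> real. b \<le> a)"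
  have po: "partial_order_on A (relation_of P A)"
    by (rule partial_order_on_relation_ofI) (auto simp: P_def)
  have ch: "\<exists>u\<in>A. \<forall>a\<in>C. P a u" if C: "C \<in> Chains (relation_of P A)" for C
  proof (cases "C = {}")
    case True then show ?thesis using q0 by (auto simp: A_def)
  next
    case False
    have CA: "C \<subseteq> A" using Chains_relation_of[OF C] .
    have lin: "a \<le> b \<or> b \<le> a" if "a \<in> C" "b \<in> C" for a b
      using C that unfolding Chains_def relation_of_def P_def by auto
    define u where "u x = (INF q\<in>C. q x)" for x
    have bdd: "bdd_below ((\<lambda>q. q x) ` C)" for x
      by (rule bdd_belowI2[of _ "- norm x"]) (use CA norm_sublinear_lower A_def in blast)
    have le: "u x \<le> q x" if "q \<in> C" for q x
      unfolding u_def by (rule cINF_lower[OF bdd that])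
    have ge: "c \<le> u x" if "\<And>q. q \<in> C \<Longrightarrow> c \<le> q x" for c x
      unfolding u_def using False that by (rule cINF_greatest)
    have pair: "u (x + y) \<le> q1 x + q2 y" if q12: "q1 \<in> C" "q2 \<in> C" for q1 q2 x y
    proof -
      obtain q where q: "q \<in> C" "q \<le> q1" "q \<le> q2" using lin[OF q12] q12 by (meson order_refl)
      have "u (x + y) \<le> q (x + y)" using le q by blast
      also have "\<dots> \<le> q x + q y" using q CA unfolding A_def norm_sublinear_def by blast
      also have "\<dots> \<le> q1 x + q2 y" using q by (intro add_mono) (auto simp: le_fun_def)
      finally show ?thesis .
    qed
    have "norm_sublinear u" unfolding norm_sublinear_def
    proof (intro conjI allI impI)
      fix x y
      have "u (x + y) - q1 x \<le> u y" if q1: "q1 \<in> C" for q1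
      proof (rule ge)
        fix q assume "q \<in> C"
        from pair[OF q1 this, of x y] show "u (x + y) - q1 x \<le> q y" by simp
      qed
      then have "u (x + y) - u y \<le> u x" by (intro ge) force
      then show "u (x + y) \<le> u x + u y" by simp
    next
      fix t :: real and x assume t: "0 < t"
      have "inverse t * u (t *\<^sub>R x) \<le> u x"
      proof (rule ge)
        fix q assume q: "q \<in> C"
        have "u (t *\<^sub>R x) \<le> t * q x"
          using le[OF q, of "t *\<^sub>R x"] q CA t norm_sublinear_scale[of q t x] unfolding A_def by force
        then show "inverse t * u (t *\<^sub>R x) \<le> q x" using t by (simp add: field_simps)
      qed
      then show "u (t *\<^sub>R x) \<le> t * u x" using t by (simp add: field_simps)
    next
      fix x
      obtain q where "q \<in> C" using False by blast
      then show "u x \<le> norm x" using le[of q x] CA unfolding A_def norm_sublinear_def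
        by (smt (verit, best) mem_Collect_eq subsetD)
    qed
    moreover have "u \<le> q0"
    proof -
      obtain q where "q \<in> C" using False by blast
      then show ?thesis using le[of q] CA unfolding A_def le_fun_def by (blast intro: order_trans)
    qed
    ultimately show ?thesis using le unfolding A_def P_def le_fun_def by blast
  qed
  obtain m where "m \<in> A" "\<forall>a\<in>A. P m a \<longrightarrow> a = m" using predicate_Zorn[OF po ch] by blast
  then show ?thesis using that[of m] unfolding A_def P_def by (auto intro: order_trans)
qed

text \<open>
  A minimal sublinear function is unchanged by every tilt, hence odd and therefore linear. Starting
  below the norm tilted towards \<open>x0\<close> forces its value at \<open>- x0\<close> down to \<open>- norm x0\<close>.
\<close>

lemma norming_functional:
  fixes x0 :: "'a::real_normed_vector"
  obtains l :: "'a \<Rightarrow>\<^sub>L real" where "\<And>x. l x \<le> norm x" "l x0 = norm x0"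
proof -
  obtain m where m: "norm_sublinear m" "m \<le> tilt norm x0"
    and min: "\<And>q. norm_sublinear q \<Longrightarrow> q \<le> m \<Longrightarrow> q = m"
    using norm_sublinear_minimal[OF norm_sublinear_tilt[OF norm_sublinear_norm, of x0]] by blast
  have t: "tilt m y = m" for y
    using min[OF norm_sublinear_tilt[OF m(1)]] tilt_le_self[OF m(1)] unfolding le_fun_def by blast
  have sub: "m (u + v) \<le> m u + m v" for u v using m(1) unfolding norm_sublinear_def by blast
  have neg: "m (- y) = - m y" for y
    using tilt_uminus[OF m(1), of y] sub[of y "- y"] norm_sublinear_zero[OF m(1)] by (simp add: t)
  have add: "m (x + y) = m x + m y" for x y
    using sub[of x y] sub[of "x + y" "- y"] neg[of y] by simp
  have sc: "m (r *\<^sub>R x) = r * m x" for r x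
  proof (cases "r \<ge> 0")
    case False
    then have "m ((- r) *\<^sub>R x) = (- r) * m x" by (intro norm_sublinear_scale[OF m(1)]) simp
    then show ?thesis using neg[of "r *\<^sub>R x"] by simp
  qed (use norm_sublinear_scale[OF m(1)] in auto)
  have le: "m x \<le> norm x" for x using m(1) unfolding norm_sublinear_def by blast
  have "bounded_linear m"
    by (rule bounded_linear_intro[of m 1])
      (use add sc le norm_sublinear_lower[OF m(1)] in \<open>auto simp: abs_le_iff minus_le_iff\<close>)
  then have bl: "blinfun_apply (Blinfun m) = m" by (rule bounded_linear_Blinfun_apply)
  have "m (- x0) \<le> - norm x0"
    using m(2) tilt_uminus[OF norm_sublinear_norm, of x0] unfolding le_fun_def by (meson order_trans)
  then have "m x0 = norm x0" using neg[of x0] le[of x0] by simp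
  then show ?thesis using that[of "Blinfun m"] le bl by simp
qed

lemma borel_measurable_blinfun_apply [measurable]:
  "blinfun_apply l \<in> borel_measurable borel"
  by (intro borel_measurable_continuous_onI continuous_intros)

text \<open>
  A nonnegative integrable weight of positive mass turns a random variable into a real distribution. The
  phase \<open>- pi/2\<close> makes a cosine out of the sine in the imaginary part of the characteristic function.
\<close>

lemma weighted_law:
  fixes L :: "'c measure" and u Z :: "'c \<Rightarrow> real"
  assumes u_int: "integrable L u" and Z[measurable]: "Z \<in> borel_measurable L" and u: "\<And>x. 0 \<le> u x"
    and m: "m = (\<integral>x. u x \<partial>L)" and mpos: "m > 0"
  defines "D \<equiv> distr (density L (\<lambda>x. ennreal (u x / m))) borel Z"
  shows "real_distribution D"
    and "char D s = complex_of_real ((\<integral>x. u x * cos (s * Z x + 0) \<partial>L) / m)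
           + \<i> * complex_of_real ((\<integral>x. u x * cos (s * Z x + (- (pi/2))) \<partial>L) / m)"
    and "measure D {..a} = (\<integral>x. u x * indicator {..a} (Z x) \<partial>L) / m"
proof -
  have [measurable]: "u \<in> borel_measurable L" using u_int by auto
  have int: "integrable L (\<lambda>x. u x * g (Z x))"
    if [measurable]: "g \<in> borel_measurable borel" and "\<And>z. \<bar>g z\<bar> \<le> 1" for g :: "real \<Rightarrow> real"
    by (rule Bochner_Integration.integrable_bound[OF u_int])
      (use u that in \<open>auto simp: abs_mult mult_left_le\<close>)
  have "emeasure (density L (\<lambda>x. ennreal (u x / m))) (space L) = (\<integral>\<^sup>+x. ennreal (u x / m) \<partial>L)"
    by (simp add: emeasure_density cong: nn_integral_cong)
  also have "\<dots> = ennreal (\<integral>x. u x / m \<partial>L)"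
    by (rule nn_integral_eq_integral) (use u_int u mpos in auto)
  also have "\<dots> = 1" using m mpos by simp
  finally have "prob_space (density L (\<lambda>x. ennreal (u x / m)))" by (intro prob_spaceI) simp
  then interpret P: prob_space "density L (\<lambda>x. ennreal (u x / m))" .
  show rd: "real_distribution D"
    unfolding D_def by (rule P.real_distribution_distr) simp
  have D: "(\<integral>x. g x \<partial>D) = (\<integral>x. u x * g (Z x) \<partial>L) / m"
    if [measurable]: "g \<in> borel_measurable borel" for g :: "real \<Rightarrow> real"
    unfolding D_def using u mpos by (simp add: integral_distr integral_density)
  interpret D: real_distribution D by (rule rd)
  have "char D s = (CLINT x|D. complex_of_real (cos (s * x + 0)) + \<i> * complex_of_real (cos (s * x + (- (pi/2)))))"
    unfolding char_def by (intro Bochner_Integration.integral_cong) (auto simp: complex_eq_iff cos_add cos_diff Re_exp Im_exp)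
  also have "\<dots> = complex_of_real (\<integral>x. cos (s * x + 0) \<partial>D) + \<i> * complex_of_real (\<integral>x. cos (s * x + (- (pi/2))) \<partial>D)"
    by (subst Bochner_Integration.integral_add)
      (auto intro!: D.integrable_const_bound[of _ 1] integrable_mult_right)
  finally show "char D s = complex_of_real ((\<integral>x. u x * cos (s * Z x + 0) \<partial>L) / m)
           + \<i> * complex_of_real ((\<integral>x. u x * cos (s * Z x + (- (pi/2))) \<partial>L) / m)"
    by (subst (asm) (1 2) D) auto
  have "measure D {..a} = (\<integral>x. indicator {..a} x \<partial>D)" by simp
  also have "\<dots> = (\<integral>x. u x * indicator {..a} (Z x) \<partial>L) / m" by (rule D) simp
  finally show "measure D {..a} = (\<integral>x. u x * indicator {..a} (Z x) \<partial>L) / m" .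
qed

text \<open>
  The one-dimensional uniqueness theorem with weights. They are needed because the
  passage to several dimensions conditions on the remaining coordinates.
\<close>

lemma weighted_halfline_eqI:
  fixes M :: "'a measure" and N :: "'b measure" and w X :: "'a \<Rightarrow> real" and v Y :: "'b \<Rightarrow> real"
  assumes int: "integrable M w" "integrable N v"
    and meas: "X \<in> borel_measurable M" "Y \<in> borel_measurable N"
    and w: "\<And>x. 0 \<le> w x" and v: "\<And>x. 0 \<le> v x"
    and eq: "\<And>s c. (\<integral>x. w x * cos (s * X x + c) \<partial>M) = (\<integral>x. v x * cos (s * Y x + c) \<partial>N)"
  shows "(\<integral>x. w x * indicator {..a} (X x) \<partial>M) = (\<integral>x. v x * indicator {..a} (Y x) \<partial>N)"
proof -
  define m where "m = (\<integral>x. w x \<partial>M)"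
  have mN: "m = (\<integral>x. v x \<partial>N)" using eq[of 0 0] by (simp add: m_def)
  show ?thesis
  proof (cases "m = 0")
    case True
    have "AE x in M. w x = 0"
      using integral_nonneg_eq_0_iff_AE[OF int(1)] w True m_def by auto
    moreover have "AE x in N. v x = 0"
      using integral_nonneg_eq_0_iff_AE[OF int(2)] v True mN by auto
    ultimately have "AE x in M. w x * indicator {..a} (X x) = 0" "AE x in N. v x * indicator {..a} (Y x) = 0"
      by auto
    then show ?thesis by (simp add: integral_eq_zero_AE)
  next
    case False
    then have mpos: "m > 0" using w by (auto simp: m_def less_le intro!: integral_nonneg)
    note LM = weighted_law[OF int(1) meas(1) w m_def mpos]
    note LN = weighted_law[OF int(2) meas(2) v mN mpos]
    have "distr (density M (\<lambda>x. ennreal (w x / m))) borel X = distr (density N (\<lambda>x. ennreal (v x / m))) borel Y"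
      by (rule Levy_uniqueness[OF LM(1) LN(1)]) (intro ext, simp only: LM(2) LN(2) eq)
    then show ?thesis using LM(3)[of a] LN(3)[of a] mpos by simp
  qed
qed

text \<open>
  Separability makes the norm the supremum of countably many functionals, norming for the points of a
  countable dense set. Closed balls are thus countable intersections of half-spaces, and every
  open set is a countable union of closed balls.
\<close>

lemma halfspaces_generate_borel:
  "sets (borel :: 'a::{real_normed_vector, second_countable_topology} measure) =
     sigma_sets UNIV (range (\<lambda>(l :: 'a \<Rightarrow>\<^sub>L real, a). {x. l x \<le> a}))" (is "_ = sigma_sets UNIV ?H")
proof -
  define S where "S = sigma UNIV ?H"
  have sp[simp]: "space S = UNIV" by (simp add: S_def)
  have l[measurable]: "blinfun_apply l \<in> borel_measurable S" for l :: "'a \<Rightarrow>\<^sub>L real"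
  proof (rule borel_measurable_iff_le[THEN iffD2], intro allI)
    fix a
    have "{x. l x \<le> a} \<in> ?H" by (auto simp: image_iff) 
    then show "{x \<in> space S. l x \<le> a} \<in> sets S" unfolding S_def by (simp add: sigma_sets.Basic)
  qed
  obtain D :: "'a set" where D: "countable D" "\<And>X. open X \<Longrightarrow> X \<noteq> {} \<Longrightarrow> \<exists>d\<in>D. d \<in> X"
    using countable_dense_exists[where 'a='a] by auto
  have "\<exists>l :: 'a \<Rightarrow>\<^sub>L real. (\<forall>x. l x \<le> norm x) \<and> l y = norm y" for y
    using norming_functional[of y] by metis
  then obtain n :: "'a \<Rightarrow> 'a \<Rightarrow>\<^sub>L real" where n: "\<And>y x. n y x \<le> norm x" "\<And>y. n y y = norm y" by metis
  have nrm: "norm x \<le> r \<longleftrightarrow> (\<forall>y\<in>D. n y x \<le> r)" for x r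
  proof
    assume "norm x \<le> r" then show "\<forall>y\<in>D. n y x \<le> r" using n(1) order_trans by blast
  next
    assume *: "\<forall>y\<in>D. n y x \<le> r"
    show "norm x \<le> r"
    proof (rule field_le_epsilon)
      fix e :: real assume "e > 0"
      then obtain y where y: "y \<in> D" "dist x y < e / 2" using D(2)[of "ball x (e/2)"] by force
      have "norm x \<le> norm y + norm (x - y)" using norm_triangle_sub by blast
      also have "norm y = n y x + n y (y - x)" using n(2)[of y] by (simp add: blinfun.diff_right)
      also have "\<dots> \<le> r + norm (y - x)" using n(1)[of y "y - x"] * y(1) by (intro add_mono) auto
      finally show "norm x \<le> r + e" using y(2) by (simp add: dist_norm norm_minus_commute)
    qed
  qed
  have cb: "cball c r \<in> sets S" for c r
  proof -
    have "cball c r = {x \<in> space S. \<forall>y\<in>D. n y x - n y c \<le> r}"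
      using nrm[of "_ - c" r] by (auto simp: dist_norm norm_minus_commute blinfun.diff_right)
    also have "\<dots> \<in> sets S" using D(1) by measurable
    finally show ?thesis .
  qed
  have op: "U \<in> sets S" if U: "open U" for U
  proof -
    have "U = (\<Union>(d, k)\<in>{(d, k). d \<in> D \<and> cball d (inverse (real (Suc k))) \<subseteq> U}. cball d (inverse (real (Suc k))))"
      (is "_ = ?R")
    proof
      show "U \<subseteq> ?R"
      proof
        fix x assume "x \<in> U"
        then obtain e where e: "e > 0" "ball x e \<subseteq> U" using U open_contains_ball by blast
        obtain k where k: "inverse (real (Suc k)) < e / 2" using reals_Archimedean[of "e/2"] e by auto
        obtain d where d: "d \<in> D" "dist x d < inverse (real (Suc k))"
          using D(2)[of "ball x (inverse (real (Suc k)))"] by force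
        have "cball d (inverse (real (Suc k))) \<subseteq> ball x e"
        proof
          fix z assume "z \<in> cball d (inverse (real (Suc k)))"
          then show "z \<in> ball x e" using d k dist_triangle[of x z d] by auto
        qed
        then show "x \<in> ?R" using d e by (auto simp: dist_commute intro!: exI[of _ d] exI[of _ k])
      qed
    qed auto
    also have "\<dots> \<in> sets S"
    proof (rule sets.countable_UN'')
      show "countable {(d, k :: nat). d \<in> D \<and> cball d (inverse (real (Suc k))) \<subseteq> U}"
        by (rule countable_subset[of _ "D \<times> UNIV"]) (use D(1) in auto)
    qed (use cb in auto)
    finally show ?thesis .
  qed
  have S: "sets S = sigma_sets UNIV ?H" by (simp add: S_def)
  have "sets borel \<subseteq> sets S"
  proof -
    have "sets (borel :: 'a measure) = sigma_sets UNIV {U. open U}" unfolding borel_def by (rule sets_measure_of) simp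
    also have "\<dots> \<subseteq> sets S"
    proof (rule sigma_algebra.sigma_sets_subset)
      show "sigma_algebra UNIV (sets S)" using sets.sigma_algebra_axioms[of S] by (simp only: sp)
      show "{U. open U} \<subseteq> sets S" by (rule subsetI, rule op, simp)
    qed
    finally show ?thesis .
  qed
  moreover have "sigma_sets UNIV ?H \<subseteq> sets (borel :: 'a measure)"
  proof (rule sets.sigma_sets_subset[of _ "borel :: 'a measure", simplified], safe)
    fix l :: "'a \<Rightarrow>\<^sub>L real" and a
    show "{x. l x \<le> a} \<in> sets borel"
      by (intro borel_closed closed_Collect_le continuous_intros)
  qed
  ultimately show ?thesis using S by blast
qed

text \<open>
  One half-space at a time: if the characteristic functionals agree after restriction to \<open>C\<close>, they
  agree after restriction to \<open>C \<inter> {l \<le> a}\<close>. This is the one-dimensional theorem for \<open>l\<close> with the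
  weight \<open>1 + cos (l' + c)\<close> on \<open>C\<close>, because products of cosines are sums of cosines of functionals. Finite
  intersections of half-spaces generate the Borel sets.
\<close>

theorem finite_measure_eqI_char:
  fixes M N :: "'a::{real_normed_vector, second_countable_topology} measure"
  assumes M: "finite_measure M" "sets M = sets borel" and N: "finite_measure N" "sets N = sets borel"
    and eq: "\<And>l :: 'a \<Rightarrow>\<^sub>L real. \<And>c. (\<integral>x. cos (l x + c) \<partial>M) = (\<integral>x. cos (l x + c) \<partial>N)"
  shows "M = N"
proof -
  interpret M: finite_measure M by fact
  interpret N: finite_measure N by fact
  define good where "good C \<longleftrightarrow> C \<in> sets borel \<and>
    (\<forall>l :: 'a \<Rightarrow>\<^sub>L real. \<forall>c. (\<integral>x. indicator C x * cos (l x + c) \<partial>M) = (\<integral>x. indicator C x * cos (l x + c) \<partial>N))" for C :: "'a set"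
  have step: "good (C \<inter> {x. l x \<le> a})" if C: "good C" for C a and l :: "'a \<Rightarrow>\<^sub>L real"
    unfolding good_def
  proof (intro conjI allI)
    have [measurable]: "C \<in> sets borel" using C by (simp add: good_def)
    show "C \<inter> {x. l x \<le> a} \<in> sets borel"
      by (rule sets.Int, fact, intro borel_closed closed_Collect_le continuous_intros)
    fix l' :: "'a \<Rightarrow>\<^sub>L real" and c
    define J where "J L c = (\<integral>x. indicator C x * (1 + cos (l' x + c)) * indicator {..a} (l x) \<partial>L)" for L c
    have int: "integrable L (\<lambda>x. indicator C x * g x)"
      if "finite_measure L" and L: "sets L = sets borel" and g: "g \<in> borel_measurable borel" and b: "\<And>x. \<bar>g x\<bar> \<le> 2" for L and g :: "'a \<Rightarrow> real"
    proof -
      interpret L: finite_measure L by fact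
      have "(\<lambda>x. indicator C x * g x) \<in> borel_measurable L"
        unfolding measurable_cong_sets[OF L refl] using g by measurable
      moreover have "norm (indicator C x * g x) \<le> 2" for x using b[of x] by (simp split: split_indicator)
      ultimately show ?thesis by (intro L.integrable_const_bound[of _ 2] AE_I2)
    qed
    have *: "J M c = J N c" for c
      unfolding J_def
    proof (rule weighted_halfline_eqI)
      fix s b
      \<comment> \<open>the product of two cosines is half the sum of the cosines of the sum and the difference\<close>
      have dec: "indicator C x * (1 + cos (l' x + c)) * cos (s * l x + b) =
          indicator C x * cos ((s *\<^sub>R l) x + b)
          + (1/2) * (indicator C x * cos ((s *\<^sub>R l + l') x + (b + c)))
          + (1/2) * (indicator C x * cos ((s *\<^sub>R l - l') x + (b - c)))" for x
        by (simp add: blinfun.add_left blinfun.diff_left blinfun.scaleR_left cos_add cos_diff sin_add sin_diff algebra_simps split: split_indicator)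
      have tot: "(\<integral>x. indicator C x * (1 + cos (l' x + c)) * cos (s * l x + b) \<partial>L) =
          (\<integral>x. indicator C x * cos ((s *\<^sub>R l) x + b) \<partial>L)
          + (1/2) * (\<integral>x. indicator C x * cos ((s *\<^sub>R l + l') x + (b + c)) \<partial>L)
          + (1/2) * (\<integral>x. indicator C x * cos ((s *\<^sub>R l - l') x + (b - c)) \<partial>L)"
        if L: "finite_measure L" "sets L = sets borel" for L
      proof -
        have i: "integrable L (\<lambda>x. indicator C x * cos (k x + r))" for k :: "'a \<Rightarrow>\<^sub>L real" and r
          by (rule int[OF L]) (auto intro: order_trans[OF abs_cos_le_one])
        show ?thesis unfolding dec by (simp add: i)
      qed
      show "(\<integral>x. indicator C x * (1 + cos (l' x + c)) * cos (s * l x + b) \<partial>M) = (\<integral>x. indicator C x * (1 + cos (l' x + c)) * cos (s * l x + b) \<partial>N)"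
        unfolding tot[OF M] tot[OF N] using C by (simp add: good_def)
    next
      have b: "\<bar>1 + cos (l' x + c)\<bar> \<le> 2" for x
        using abs_cos_le_one[of "l' x + c"] by linarith
      show "integrable M (\<lambda>x. indicator C x * (1 + cos (l' x + c)))" by (rule int[OF M]) (auto simp: b)
      show "integrable N (\<lambda>x. indicator C x * (1 + cos (l' x + c)))" by (rule int[OF N]) (auto simp: b)
      show "0 \<le> indicator C x * (1 + cos (l' x + c))" for x
        by (intro mult_nonneg_nonneg) (simp, use cos_ge_minus_one[of "l' x + c"] in linarith)
      show "0 \<le> indicator C x * (1 + cos (l' x + c))" for x
        by (intro mult_nonneg_nonneg) (simp, use cos_ge_minus_one[of "l' x + c"] in linarith)
      show "blinfun_apply l \<in> borel_measurable M" unfolding measurable_cong_sets[OF M(2) refl] by measurable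
      show "blinfun_apply l \<in> borel_measurable N" unfolding measurable_cong_sets[OF N(2) refl] by measurable
    qed
    have J: "(\<integral>x. indicator (C \<inter> {x. l x \<le> a}) x * cos (l' x + c) \<partial>L) = (1/2) * (J L c - J L (c + pi))"
      if L: "finite_measure L" "sets L = sets borel" for L
    proof -
      have i: "integrable L (\<lambda>x. indicator C x * (1 + cos (l' x + r)) * indicator {..a} (l x))" for r
      proof -
        have "\<bar>(1 + cos (l' x + r)) * indicator {..a} (l x)\<bar> \<le> 2" for x
          by (cases "l x \<le> a") (simp, use cos_ge_minus_one[of "l' x + r"] cos_le_one[of "l' x + r"] in linarith, simp)
        from int[OF L _ this] show ?thesis by (simp add: mult.assoc)
      qed
      \<comment> \<open>the weights for the phases \<open>c\<close> and \<open>c + pi\<close> differ by \<open>2 cos (l' x + c)\<close>\<close>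
      have pt: "indicator (C \<inter> {x. l x \<le> a}) x * cos (l' x + c) =
          (1/2) * (indicator C x * (1 + cos (l' x + c)) * indicator {..a} (l x)
            - indicator C x * (1 + cos (l' x + (c + pi))) * indicator {..a} (l x))" for x
        using cos_periodic_pi[of "l' x + c"] by (simp add: add.assoc split: split_indicator)
      show ?thesis unfolding J_def pt
        by (simp only: integral_mult_right_zero Bochner_Integration.integral_diff[OF i i])
    qed
    show "(\<integral>x. indicator (C \<inter> {x. l x \<le> a}) x * cos (l' x + c) \<partial>M) = (\<integral>x. indicator (C \<inter> {x. l x \<le> a}) x * cos (l' x + c) \<partial>N)"
      unfolding J[OF M] J[OF N] * ..
  qed
  have good_UNIV: "good UNIV" using eq by (simp add: good_def)
  define cap :: "(('a \<Rightarrow>\<^sub>L real) \<times> real) set \<Rightarrow> 'a set" where "cap F = \<Inter>((\<lambda>(l :: 'a \<Rightarrow>\<^sub>L real, a). {x. l x \<le> a}) ` F)" for F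
  define E where "E = {cap F | F. finite F}"
  have good_E: "good (cap F)" if "finite F" for F
    using that unfolding cap_def
  proof (induction F)
    case (insert p F)
    then show ?case using step[OF insert.IH, of "fst p" "snd p"] by (simp add: case_prod_beta Int_commute)
  qed (simp add: good_UNIV)
  have E_borel: "E \<subseteq> sets borel" using good_E unfolding E_def good_def by blast
  have sig: "sets borel = sigma_sets UNIV E"
  proof
    show "sigma_sets UNIV E \<subseteq> sets borel"
      by (rule sets.sigma_sets_subset[of _ "borel :: 'a measure", simplified]) (rule E_borel)
    have "range (\<lambda>(l :: 'a \<Rightarrow>\<^sub>L real, a). {x. l x \<le> a}) \<subseteq> E"
    proof
      fix U assume "U \<in> range (\<lambda>(l :: 'a \<Rightarrow>\<^sub>L real, a). {x. l x \<le> a})"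
      then obtain p where p: "U = (\<lambda>(l :: 'a \<Rightarrow>\<^sub>L real, a). {x. l x \<le> a}) p" by auto
      show "U \<in> E" unfolding E_def by (rule CollectI, rule exI[of _ "{p}"]) (simp add: p cap_def)
    qed
    then show "sets borel \<subseteq> sigma_sets UNIV E"
      unfolding halfspaces_generate_borel by (rule sigma_sets_mono')
  qed
  show "M = N"
  proof (rule measure_eqI_generator_eq[where E = E and \<Omega> = UNIV and A = "\<lambda>_. UNIV"])
    show "Int_stable E"
    proof (rule Int_stableI)
      fix U V assume "U \<in> E" "V \<in> E"
      then obtain F G where "finite F" "finite G" "U = cap F" "V = cap G" unfolding E_def by blast
      moreover have "cap F \<inter> cap G = cap (F \<union> G)" by (simp only: cap_def image_Un Inter_Un_distrib)
      ultimately show "U \<inter> V \<in> E" unfolding E_def by blast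
    qed
    show "emeasure M X = emeasure N X" if "X \<in> E" for X
    proof -
      have g: "good X" using that good_E unfolding E_def by (elim CollectE exE conjE) simp
      from g have "(\<integral>x. indicator X x * cos ((0 :: 'a \<Rightarrow>\<^sub>L real) x + 0) \<partial>M) = (\<integral>x. indicator X x * cos ((0 :: 'a \<Rightarrow>\<^sub>L real) x + 0) \<partial>N)"
        unfolding good_def by (elim conjE allE)
      moreover have "X \<in> sets M" "X \<in> sets N" using g M(2) N(2) by (simp_all only: good_def)
      ultimately have "measure M X = measure N X" by simp
      then show ?thesis by (simp add: M.emeasure_eq_measure N.emeasure_eq_measure)
    qed
    have "UNIV \<in> E" unfolding E_def by (rule CollectI, rule exI[of _ "{}"]) (simp add: cap_def)
    then show "range (\<lambda>_. UNIV) \<subseteq> E" by blast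
    show "sets M = sigma_sets UNIV E" "sets N = sigma_sets UNIV E" by (simp_all only: M(2) N(2) sig)
    show "emeasure M ((\<lambda>_. UNIV) i) \<noteq> \<infinity>" for i :: nat by simp
  qed (rule subset_UNIV | simp)+
qed

section \<open>Orthonormal bases and Hilbert-Schmidt norms\<close>

locale onb =
  fixes e :: "nat \<Rightarrow> 'h::{real_inner, banach}"
  assumes inner_e: "e i \<bullet> e j = (if i = j then 1 else 0)"
    and dense_e: "closure (span (range e)) = UNIV"
begin

definition proj :: "nat \<Rightarrow> 'h \<Rightarrow> 'h" where
  "proj n x = (\<Sum>i<n. (x \<bullet> e i) *\<^sub>R e i)"

lemma norm_sum_e: "finite S \<Longrightarrow> (norm (\<Sum>i\<in>S. c i *\<^sub>R e i))\<^sup>2 = (\<Sum>i\<in>S. (c i)\<^sup>2)"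
  unfolding power2_norm_eq_inner
  by (simp add: inner_sum_left inner_sum_right inner_e if_distrib[of "\<lambda>x. _ * x"] sum.delta power2_eq_square cong: if_cong)

lemma inner_proj: "proj n x \<bullet> y = (\<Sum>i<n. (x \<bullet> e i) * (y \<bullet> e i))"
  by (simp add: proj_def inner_sum_left inner_commute[of y])

lemma norm_proj_le: "norm (proj n x) \<le> norm x"
proof -
  have "(norm (proj n x))\<^sup>2 = proj n x \<bullet> x"
    unfolding inner_proj unfolding proj_def norm_sum_e[OF finite_lessThan] by (simp add: power2_eq_square)
  also have "\<dots> \<le> norm (proj n x) * norm x" by (rule norm_cauchy_schwarz)
  finally have "norm (proj n x) * norm (proj n x) \<le> norm (proj n x) * norm x" by (simp add: power2_eq_square)
  then show ?thesis by (cases "proj n x = 0") auto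
qed

lemma proj_diff: "proj n (x - y) = proj n x - proj n y"
  by (simp add: proj_def inner_diff_left scaleR_diff_left sum_subtractf)

lemma proj_LIMSEQ: "(\<lambda>n. proj n x) \<longlonglongrightarrow> x"
proof -
  let ?V = "{y. \<exists>N. \<forall>n\<ge>N. proj n y = y}"
  have "subspace ?V"
  proof (rule subspaceI)
    show "0 \<in> ?V" by (simp add: proj_def)
    fix x y assume "x \<in> ?V" "y \<in> ?V"
    then obtain N N' where N: "\<forall>n\<ge>N. proj n x = x" "\<forall>n\<ge>N'. proj n y = y" by blast
    show "x + y \<in> ?V"
    proof (intro CollectI exI[of _ "max N N'"] allI impI)
      fix n assume "max N N' \<le> n"
      then have "proj n x = x" "proj n y = y" using N by auto
      then show "proj n (x + y) = x + y"
        by (simp add: proj_def inner_add_left scaleR_add_left sum.distrib)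
    qed
    fix c :: real
    show "c *\<^sub>R x \<in> ?V"
    proof (intro CollectI exI[of _ N] allI impI)
      fix n assume "N \<le> n"
      then have "c *\<^sub>R proj n x = c *\<^sub>R x" using N by auto
      then show "proj n (c *\<^sub>R x) = c *\<^sub>R x" by (simp add: proj_def scaleR_sum_right)
    qed
  qed
  moreover have "range e \<subseteq> ?V"
  proof safe
    fix j
    have "proj n (e j) = e j" if "j < n" for n
      unfolding proj_def using that by (simp add: inner_e if_distrib[of "\<lambda>c. c *\<^sub>R _"] sum.delta' cong: if_cong)
    then show "\<exists>N. \<forall>n\<ge>N. proj n (e j) = e j" by (intro exI[of _ "Suc j"]) simp
  qed
  ultimately have span: "span (range e) \<subseteq> ?V" by (simp add: span_minimal)
  show ?thesis
  proof (rule LIMSEQ_I)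
    fix r :: real assume r: "0 < r"
    have "x \<in> closure (span (range e))" using dense_e by simp
    then obtain y where y: "y \<in> span (range e)" "dist y x < r / 2"
      using r closure_approachable by (metis half_gt_zero)
    obtain N where N: "\<And>n. n \<ge> N \<Longrightarrow> proj n y = y" using span y(1) by blast
    show "\<exists>N. \<forall>n\<ge>N. norm (proj n x - x) < r"
    proof (intro exI[of _ N] allI impI)
      fix n assume n: "N \<le> n"
      have "proj n x - x = proj n (x - y) + (y - x)" using N[OF n] by (simp add: proj_diff)
      then have "norm (proj n x - x) \<le> norm (proj n (x - y)) + norm (y - x)"
        using norm_triangle_ineq by metis
      also have "\<dots> \<le> norm (x - y) + norm (y - x)" using norm_proj_le by simp
      finally show "norm (proj n x - x) < r" using y(2) by (simp add: dist_norm norm_minus_commute)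
    qed
  qed
qed

lemma parseval: "(\<lambda>i. (x \<bullet> e i) * (y \<bullet> e i)) sums (x \<bullet> y)"
  unfolding sums_def inner_proj[symmetric] by (intro tendsto_intros proj_LIMSEQ)

text \<open>
  The representer is the Fourier series \<open>\<Sum>\<^sub>i l (e i) e i\<close>; testing \<open>l\<close> on its partial sums bounds their norms by \<open>norm l\<close>.
\<close>

lemma riesz:
  fixes l :: "'h \<Rightarrow>\<^sub>L real"
  shows "\<exists>h. \<forall>k. h \<bullet> k = l k"
proof -
  define c where "c i = l (e i)" for i
  have bd: "(\<Sum>i<n. (c i)\<^sup>2) \<le> (norm l)\<^sup>2" for n
  proof -
    define y where "y = (\<Sum>i<n. c i *\<^sub>R e i)"
    have y2: "(norm y)\<^sup>2 = (\<Sum>i<n. (c i)\<^sup>2)" by (simp add: y_def norm_sum_e)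
    have "l y = (\<Sum>i<n. (c i)\<^sup>2)"
      by (simp add: y_def blinfun.sum_right blinfun.scaleR_right power2_eq_square flip: c_def)
    then have "(norm y)\<^sup>2 \<le> norm l * norm y" using norm_blinfun[of l y] y2 by simp
    then have "norm y \<le> norm l" by (cases "y = 0") (auto simp: power2_eq_square)
    then show ?thesis using y2 by (metis norm_ge_zero power_mono)
  qed
  have "summable (\<lambda>i. (c i)\<^sup>2)"
    by (rule bounded_imp_summable[of _ "(norm l)\<^sup>2"]) (use bd[of "Suc _"] in \<open>auto simp: lessThan_Suc_atMost\<close>)
  have "summable (\<lambda>i. c i *\<^sub>R e i)"
    unfolding summable_Cauchy
  proof (intro allI impI)
    fix r :: real assume r: "0 < r"
    then obtain N where N: "\<And>m n. m \<ge> N \<Longrightarrow> norm (\<Sum>i\<in>{m..<n}. (c i)\<^sup>2) < r\<^sup>2"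
      using \<open>summable (\<lambda>i. (c i)\<^sup>2)\<close> unfolding summable_Cauchy by (meson zero_less_power)
    have "norm (\<Sum>i\<in>{m..<n}. c i *\<^sub>R e i) < r" if "m \<ge> N" for m n
    proof (rule power2_less_imp_less)
      show "(norm (\<Sum>i\<in>{m..<n}. c i *\<^sub>R e i))\<^sup>2 < r\<^sup>2"
        using N[OF that, of n] by (simp add: norm_sum_e)
    qed (use r in simp)
    then show "\<exists>N. \<forall>m\<ge>N. \<forall>n. norm (\<Sum>i\<in>{m..<n}. c i *\<^sub>R e i) < r" by blast
  qed
  then obtain h where h: "(\<lambda>i. c i *\<^sub>R e i) sums h" unfolding summable_def by blast
  have "h \<bullet> k = l k" for k
  proof -
    have "(\<lambda>n. (\<Sum>i<n. c i *\<^sub>R e i) \<bullet> k) \<longlonglongrightarrow> h \<bullet> k"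
      using h unfolding sums_def by (intro tendsto_intros)
    moreover have "(\<Sum>i<n. c i *\<^sub>R e i) \<bullet> k = l (proj n k)" for n
      by (simp add: proj_def inner_sum_left blinfun.sum_right blinfun.scaleR_right c_def inner_commute[of k] mult.commute)
    moreover have "(\<lambda>n. l (proj n k)) \<longlonglongrightarrow> l k" by (intro tendsto_intros proj_LIMSEQ)
    ultimately show ?thesis using LIMSEQ_unique by auto
  qed
  then show ?thesis by blast
qed

lemma inner_dual_embed:
  fixes \<iota> :: "'h \<Rightarrow>\<^sub>L 'w::banach"
  shows "dual_embed \<iota> l \<bullet> k = l (\<iota> k)"
proof -
  obtain h where h: "\<forall>k. h \<bullet> k = (l o\<^sub>L \<iota>) k" using riesz by blast
  have "\<exists>!h. \<forall>k. h \<bullet> k = l (\<iota> k)"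
  proof (rule ex1I[of _ h])
    show "\<forall>k. h \<bullet> k = l (\<iota> k)" using h by simp
    fix h' assume "\<forall>k. h' \<bullet> k = l (\<iota> k)"
    then have "(h' - h) \<bullet> (h' - h) = 0" using h by (simp add: inner_diff_left)
    then show "h' = h" by simp
  qed
  from theI'[OF this] show ?thesis unfolding dual_embed_def by blast
qed

lemma ext_inner: "(\<And>k. h \<bullet> k = h' \<bullet> k) \<Longrightarrow> h = (h' :: 'h)"
  by (metis inner_diff_left inner_eq_zero_iff right_minus_eq)

lemma eqI_inner_e: "(\<And>i. h \<bullet> e i = h' \<bullet> e i) \<Longrightarrow> h = h'"
  by (rule ext_inner) (metis (no_types, lifting) parseval sums_unique2 sums_cong)

end

text \<open>
  The index sets over which the Hilbert-Schmidt norm is a supremum.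
\<close>

definition orthonormal_set :: "'h::real_inner set \<Rightarrow> bool" where
  "orthonormal_set S \<longleftrightarrow> finite S \<and> pairwise orthogonal S \<and> (\<forall>x\<in>S. norm x = 1)"

lemma bessel:
  assumes "orthonormal_set S"
  shows "(\<Sum>x\<in>S. (y \<bullet> x)\<^sup>2) \<le> (norm y)\<^sup>2"
proof -
  have fin: "finite S" using assms by (simp add: orthonormal_set_def)
  have o: "x \<bullet> z = (if x = z then 1 else 0)" if "x \<in> S" "z \<in> S" for x z
    using assms that unfolding orthonormal_set_def pairwise_def orthogonal_def
    by (auto simp: norm_eq_1)
  define p where "p = (\<Sum>x\<in>S. (y \<bullet> x) *\<^sub>R x)"
  have yp: "y \<bullet> p = (\<Sum>x\<in>S. (y \<bullet> x)\<^sup>2)" by (simp add: p_def inner_sum_right power2_eq_square)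
  have xp: "x \<bullet> p = y \<bullet> x" if "x \<in> S" for x
  proof -
    have "x \<bullet> p = (\<Sum>z\<in>S. (y \<bullet> z) * (if x = z then 1 else 0))"
      unfolding p_def inner_sum_right inner_scaleR_right by (intro sum.cong refl) (simp add: o that)
    then show ?thesis using fin that by (simp add: if_distrib[of "\<lambda>x. _ * x"] sum.delta cong: if_cong)
  qed
  have "p \<bullet> p = (\<Sum>x\<in>S. (y \<bullet> x) * (x \<bullet> p))" by (subst (1) p_def) (simp add: inner_sum_left)
  also have "\<dots> = (\<Sum>x\<in>S. (y \<bullet> x)\<^sup>2)" by (intro sum.cong refl) (simp add: xp power2_eq_square)
  finally have pp: "p \<bullet> p = (\<Sum>x\<in>S. (y \<bullet> x)\<^sup>2)" .
  have "0 \<le> (y - p) \<bullet> (y - p)" by simp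
  also have "\<dots> = (norm y)\<^sup>2 - (\<Sum>x\<in>S. (y \<bullet> x)\<^sup>2)"
    by (simp add: inner_diff_left inner_diff_right inner_commute[of p y] yp pp power2_norm_eq_inner)
  finally show ?thesis by simp
qed

lemma L2_set_le_iff: "0 \<le> c \<Longrightarrow> L2_set f S \<le> c \<longleftrightarrow> (\<Sum>x\<in>S. (f x)\<^sup>2) \<le> c\<^sup>2"
  unfolding L2_set_def by (metis real_sqrt_le_iff real_sqrt_abs abs_of_nonneg)

lemma hs_norm_nonneg: "0 \<le> hs_norm K" if "hilbert_schmidt K"
proof -
  have "0 \<in> hs_partial_sums K" unfolding hs_partial_sums_def by (rule image_eqI[of _ _ "{}"]) auto
  then show ?thesis using that unfolding hs_norm_def hilbert_schmidt_def by (simp add: cSup_upper)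
qed

lemma hs_upper:
  fixes K :: "'h::{real_inner, banach} \<Rightarrow>\<^sub>L 'h"
  assumes "hilbert_schmidt K" "orthonormal_set S"
  shows "L2_set (\<lambda>x. norm (K x)) S \<le> hs_norm K"
proof -
  have "(\<Sum>x\<in>S. (norm (K x))\<^sup>2) \<in> hs_partial_sums K"
    using assms(2) unfolding hs_partial_sums_def orthonormal_set_def by blast
  then show ?thesis using assms(1) unfolding hs_norm_def hilbert_schmidt_def L2_set_def
    by (simp add: cSup_upper)
qed

text \<open>
  Together with \<open>hs_upper\<close> this reduces Hilbert-Schmidt norms to Euclidean norms over finite
  orthonormal sets, from which the triangle inequality and lower semicontinuity are inherited.
\<close>

lemma hs_least:
  fixes K :: "'h::{real_inner, banach} \<Rightarrow>\<^sub>L 'h"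
  assumes "\<And>S. orthonormal_set S \<Longrightarrow> L2_set (\<lambda>x. norm (K x)) S \<le> c"
  shows "hilbert_schmidt K" "hs_norm K \<le> c"
proof -
  have c: "0 \<le> c" using assms[of "{}"] by (simp add: orthonormal_set_def L2_set_def pairwise_empty)
  have le: "y \<le> c\<^sup>2" if y: "y \<in> hs_partial_sums K" for y
  proof -
    obtain S where "orthonormal_set S" "y = (\<Sum>x\<in>S. (norm (K x))\<^sup>2)"
      using y unfolding hs_partial_sums_def orthonormal_set_def by blast
    then show ?thesis using iffD1[OF L2_set_le_iff[OF c] assms] by simp
  qed
  show hs: "hilbert_schmidt K" unfolding hilbert_schmidt_def using le by (rule bdd_aboveI)
  have "Sup (hs_partial_sums K) \<le> c\<^sup>2"
  proof (rule cSup_least)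
    show "hs_partial_sums K \<noteq> {}" unfolding hs_partial_sums_def by (auto intro!: exI[of _ "{}"] simp: pairwise_empty)
  qed (rule le)
  then show "hs_norm K \<le> c" unfolding hs_norm_def using c by (simp add: real_le_lsqrt real_sqrt_le_iff)
qed

lemma hs_zero:
  "hilbert_schmidt (0 :: 'h::{real_inner, banach} \<Rightarrow>\<^sub>L 'h)" "hs_norm (0 :: 'h \<Rightarrow>\<^sub>L 'h) = 0"
proof -
  show h: "hilbert_schmidt (0 :: 'h \<Rightarrow>\<^sub>L 'h)" by (rule hs_least(1)[of _ 0]) (simp add: L2_set_def)
  have "hs_norm (0 :: 'h \<Rightarrow>\<^sub>L 'h) \<le> 0" by (rule hs_least(2)) (simp add: L2_set_def)
  then show "hs_norm (0 :: 'h \<Rightarrow>\<^sub>L 'h) = 0" using hs_norm_nonneg[OF h] by simp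
qed

lemma hs_add:
  fixes K L :: "'h::{real_inner, banach} \<Rightarrow>\<^sub>L 'h"
  assumes "hilbert_schmidt K" "hilbert_schmidt L"
  shows "hilbert_schmidt (K + L)" "hs_norm (K + L) \<le> hs_norm K + hs_norm L"
proof -
  have *: "L2_set (\<lambda>x. norm ((K + L) x)) S \<le> hs_norm K + hs_norm L" if S: "orthonormal_set S" for S
  proof -
    have "L2_set (\<lambda>x. norm ((K + L) x)) S \<le> L2_set (\<lambda>x. norm (K x) + norm (L x)) S"
      by (rule L2_set_mono) (auto simp: blinfun.add_left norm_triangle_ineq)
    also have "\<dots> \<le> L2_set (\<lambda>x. norm (K x)) S + L2_set (\<lambda>x. norm (L x)) S" by (rule L2_set_triangle_ineq)
    also have "\<dots> \<le> hs_norm K + hs_norm L" using assms hs_upper S by (intro add_mono) auto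
    finally show ?thesis .
  qed
  show "hilbert_schmidt (K + L)" by (rule hs_least(1)) (rule *)
  show "hs_norm (K + L) \<le> hs_norm K + hs_norm L" by (rule hs_least(2)) (rule *)
qed

lemma hs_scaleR:
  fixes K :: "'h::{real_inner, banach} \<Rightarrow>\<^sub>L 'h"
  assumes K: "hilbert_schmidt K"
  shows "hilbert_schmidt (c *\<^sub>R K)" "hs_norm (c *\<^sub>R K) \<le> \<bar>c\<bar> * hs_norm K"
proof -
  have *: "L2_set (\<lambda>x. norm ((c *\<^sub>R K) x)) S \<le> \<bar>c\<bar> * hs_norm K" if S: "orthonormal_set S" for S
    using hs_upper[OF K S] by (simp add: blinfun.scaleR_left L2_set_right_distrib[symmetric] mult_left_mono)
  show "hilbert_schmidt (c *\<^sub>R K)" by (rule hs_least(1)) (rule *)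
  show "hs_norm (c *\<^sub>R K) \<le> \<bar>c\<bar> * hs_norm K" by (rule hs_least(2)) (rule *)
qed

lemma hs_diff:
  fixes K L :: "'h::{real_inner, banach} \<Rightarrow>\<^sub>L 'h"
  assumes K: "hilbert_schmidt K" and L: "hilbert_schmidt L"
  shows "hilbert_schmidt (K - L)" "hs_norm (K - L) \<le> hs_norm K + hs_norm L"
  using hs_add[OF K hs_scaleR(1)[OF L, of "-1"]] hs_scaleR(2)[OF L, of "-1"] by auto

lemma hs_sum:
  fixes K :: "'i \<Rightarrow> 'h::{real_inner, banach} \<Rightarrow>\<^sub>L 'h"
  assumes "finite I" "\<And>i. i \<in> I \<Longrightarrow> hilbert_schmidt (K i)"
  shows "hilbert_schmidt (\<Sum>i\<in>I. K i) \<and> hs_norm (\<Sum>i\<in>I. K i) \<le> (\<Sum>i\<in>I. hs_norm (K i))"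
  using assms
proof (induction I)
  case (insert i I)
  then have "hilbert_schmidt (K i)" "hilbert_schmidt (\<Sum>i\<in>I. K i)" by auto
  from hs_add[OF this] insert show ?case by auto
qed (simp add: hs_zero)

lemma norm_le_hs_norm:
  fixes K :: "'h::{real_inner, banach} \<Rightarrow>\<^sub>L 'h"
  assumes "hilbert_schmidt K"
  shows "norm K \<le> hs_norm K"
proof (rule norm_blinfun_bound)
  show "0 \<le> hs_norm K" by (rule hs_norm_nonneg) fact
  fix x
  show "norm (K x) \<le> hs_norm K * norm x"
  proof (cases "x = 0")
    case False
    have "orthonormal_set {inverse (norm x) *\<^sub>R x}" using False by (simp add: orthonormal_set_def pairwise_singleton)
    from hs_upper[OF assms this] False show ?thesis
      by (simp add: L2_set_def blinfun.scaleR_right real_sqrt_divide field_simps)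
  qed simp
qed

lemma hs_rank_one:
  fixes g h :: "'h::{real_inner, banach}"
  shows "hilbert_schmidt (blinfun_scaleR_left h o\<^sub>L blinfun_inner_right g)"
proof (rule hs_least(1)[of _ "norm g * norm h"])
  fix S :: "'h set" assume S: "orthonormal_set S"
  have "(\<Sum>x\<in>S. (norm ((blinfun_scaleR_left h o\<^sub>L blinfun_inner_right g) x))\<^sup>2) = (\<Sum>x\<in>S. (g \<bullet> x)\<^sup>2) * (norm h)\<^sup>2"
    by (simp add: sum_distrib_right power_mult_distrib)
  also have "\<dots> \<le> (norm g)\<^sup>2 * (norm h)\<^sup>2" by (intro mult_right_mono bessel S) simp
  finally show "L2_set (\<lambda>x. norm ((blinfun_scaleR_left h o\<^sub>L blinfun_inner_right g) x)) S \<le> norm g * norm h"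
    by (subst L2_set_le_iff) (auto simp: power_mult_distrib)
qed

lemma hs_norm_LIMSEQ_le:
  fixes K :: "nat \<Rightarrow> 'h::{real_inner, banach} \<Rightarrow>\<^sub>L 'h" and L :: "'h \<Rightarrow>\<^sub>L 'h"
  assumes "\<And>x. (\<lambda>n. K n x) \<longlonglongrightarrow> L x" "\<And>n. hilbert_schmidt (K n)" "\<And>n. hs_norm (K n) \<le> c"
  shows "hilbert_schmidt L" "hs_norm L \<le> c"
proof -
  have *: "L2_set (\<lambda>x. norm (L x)) S \<le> c" if S: "orthonormal_set S" for S
  proof (rule LIMSEQ_le_const2)
    show "(\<lambda>n. L2_set (\<lambda>x. norm (K n x)) S) \<longlonglongrightarrow> L2_set (\<lambda>x. norm (L x)) S"
      unfolding L2_set_def by (intro tendsto_intros assms)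
    show "\<exists>N. \<forall>n\<ge>N. L2_set (\<lambda>x. norm (K n x)) S \<le> c"
      using hs_upper[OF assms(2) S] assms(3) order_trans by blast
  qed
  show "hilbert_schmidt L" by (rule hs_least(1)) (rule *)
  show "hs_norm L \<le> c" by (rule hs_least(2)) (rule *)
qed

context onb begin

lemma orthonormal_e: "orthonormal_set (e ` {..<n})"
  unfolding orthonormal_set_def pairwise_def orthogonal_def
  by (auto simp: norm_eq_1 inner_e)

lemma inj_e: "inj e"
  by (rule injI) (metis inner_e zero_neq_one)

text \<open>
  The supremum is attained along the basis. For orthonormal \<open>S\<close>, Bessel's inequality for \<open>S\<close> and
  Parseval's identity for \<open>e\<close> bound \<open>\<Sum>\<^sub>x |K x|\<^sup>2\<close> over \<open>S\<close> by \<open>\<Sum>\<^sub>i |K (e i)|\<^sup>2\<close>. To keep all sums finite, \<open>x\<close> is first projected to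
  \<open>n\<close> basis vectors and \<open>K x\<close> to \<open>m\<close> coordinates.
\<close>

lemma hs_norm_LIMSEQ:
  fixes K :: "'h \<Rightarrow>\<^sub>L 'h"
  assumes K: "hilbert_schmidt K"
  shows "(\<lambda>n. sqrt (\<Sum>i<n. (norm (K (e i)))\<^sup>2)) \<longlonglongrightarrow> hs_norm K"
proof -
  define a where "a n = (\<Sum>i<n. (norm (K (e i)))\<^sup>2)" for n
  have a0: "0 \<le> a n" for n by (simp add: a_def sum_nonneg)
  have ale: "sqrt (a n) \<le> hs_norm K" for n
    using hs_upper[OF K orthonormal_e, of n] inj_e
    by (simp add: L2_set_def sum.reindex inj_on_subset a_def)
  have inc: "incseq (\<lambda>n. sqrt (a n))"
    by (rule incseq_SucI) (simp add: a_def)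
  then obtain s where s: "(\<lambda>n. sqrt (a n)) \<longlonglongrightarrow> s" and sle: "\<And>n. sqrt (a n) \<le> s"
    using incseq_convergent[OF inc, of "hs_norm K"] ale by blast
  have "hs_norm K \<le> s"
  proof (rule hs_least(2))
    fix S :: "'h set" assume S: "orthonormal_set S"
    have s0: "0 \<le> s" using sle[of 0] a0[of 0] by (simp add: a_def)
    have 1: "(\<Sum>x\<in>S. \<Sum>j<m. (K (proj n x) \<bullet> e j)\<^sup>2) \<le> s\<^sup>2" for n m
    proof -
      have K': "K (proj n x) \<bullet> e j = (\<Sum>i<n. (K (e i) \<bullet> e j) *\<^sub>R e i) \<bullet> x" for x j
        by (simp add: proj_def blinfun.sum_right blinfun.scaleR_right inner_sum_left inner_commute[of x] mult.commute)
      have "(\<Sum>x\<in>S. \<Sum>j<m. (K (proj n x) \<bullet> e j)\<^sup>2) = (\<Sum>j<m. \<Sum>x\<in>S. ((\<Sum>i<n. (K (e i) \<bullet> e j) *\<^sub>R e i) \<bullet> x)\<^sup>2)"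
        unfolding K' by (rule sum.swap)
      also have "\<dots> \<le> (\<Sum>j<m. (norm (\<Sum>i<n. (K (e i) \<bullet> e j) *\<^sub>R e i))\<^sup>2)"
        by (intro sum_mono bessel S)
      also have "\<dots> = (\<Sum>i<n. \<Sum>j<m. (K (e i) \<bullet> e j)\<^sup>2)" unfolding norm_sum_e[OF finite_lessThan] by (rule sum.swap)
      also have "\<dots> \<le> a n" unfolding a_def
      proof (rule sum_mono)
        fix i
        have "(\<Sum>j<m. (K (e i) \<bullet> e j)\<^sup>2) = (norm (proj m (K (e i))))\<^sup>2" by (simp add: proj_def norm_sum_e)
        also have "\<dots> \<le> (norm (K (e i)))\<^sup>2" by (intro power_mono norm_proj_le) simp
        finally show "(\<Sum>j<m. (K (e i) \<bullet> e j)\<^sup>2) \<le> (norm (K (e i)))\<^sup>2" .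
      qed
      also have "\<dots> \<le> s\<^sup>2" using sle[of n] a0[of n] by (simp add: sqrt_le_D)
      finally show ?thesis .
    qed
    have 2: "(\<Sum>x\<in>S. \<Sum>j<m. (K x \<bullet> e j)\<^sup>2) \<le> s\<^sup>2" for m
    proof (rule LIMSEQ_le_const2)
      show "(\<lambda>n. \<Sum>x\<in>S. \<Sum>j<m. (K (proj n x) \<bullet> e j)\<^sup>2) \<longlonglongrightarrow> (\<Sum>x\<in>S. \<Sum>j<m. (K x \<bullet> e j)\<^sup>2)"
        by (intro tendsto_intros proj_LIMSEQ)
    qed (use 1 in blast)
    have "(\<Sum>x\<in>S. (norm (K x))\<^sup>2) \<le> s\<^sup>2"
    proof (rule LIMSEQ_le_const2)
      have "(\<lambda>m. \<Sum>j<m. (K x \<bullet> e j)\<^sup>2) \<longlonglongrightarrow> (norm (K x))\<^sup>2" for x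
        using parseval[of "K x" "K x"] unfolding sums_def power2_eq_square power2_norm_eq_inner[unfolded power2_eq_square] .
      then show "(\<lambda>m. \<Sum>x\<in>S. \<Sum>j<m. (K x \<bullet> e j)\<^sup>2) \<longlonglongrightarrow> (\<Sum>x\<in>S. (norm (K x))\<^sup>2)" by (intro tendsto_sum)
    qed (use 2 in blast)
    then show "L2_set (\<lambda>x. norm (K x)) S \<le> s" using L2_set_le_iff[OF s0] by blast
  qed
  moreover have "s \<le> hs_norm K" using s ale by (meson LIMSEQ_le_const2)
  ultimately show ?thesis using s by (simp add: a_def)
qed

text \<open>
  A supremum over all finite orthonormal sets is not visibly measurable, its limit along the basis is. Measurability
  is indispensable, as nonnegative integrals of nonmeasurable functions are not additive.
\<close>

lemma borel_measurable_hs_norm: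
  fixes Y :: "'a \<Rightarrow> 'h \<Rightarrow>\<^sub>L 'h"
  assumes "\<And>x. (\<lambda>\<omega>. Y \<omega> x) \<in> borel_measurable M" "\<And>\<omega>. hilbert_schmidt (Y \<omega>)"
  shows "(\<lambda>\<omega>. hs_norm (Y \<omega>)) \<in> borel_measurable M"
proof (rule borel_measurable_LIMSEQ_real[OF hs_norm_LIMSEQ[OF assms(2)]])
  have [measurable]: "(\<lambda>\<omega>. Y \<omega> (e i)) \<in> borel_measurable M" for i by (rule assms)
  show "(\<lambda>\<omega>. sqrt (\<Sum>i<n. (norm (Y \<omega> (e i)))\<^sup>2)) \<in> borel_measurable M" for n by measurable
qed

end

section \<open>Calculus of smooth bounded functions\<close>

text \<open>
  A class of functions of the first \<open>n\<close> coordinates that is closed under partial derivatives. Since its members are bounded,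
  continuous and differentiable, all of them are smooth, and no iterated derivative
  ever has to be computed. Shifts place functions of different functionals side by side.
\<close>

inductive smooth_gen :: "nat \<Rightarrow> ((nat \<Rightarrow> real) \<Rightarrow> real) \<Rightarrow> bool" for n where
  shift: "Cb_infinity m \<phi> \<Longrightarrow> k + m \<le> n \<Longrightarrow> smooth_gen n (\<lambda>x. \<phi> (\<lambda>j. x (j + k)))"
| const: "smooth_gen n (\<lambda>_. c)"
| coord: "k < n \<Longrightarrow> smooth_gen n (\<lambda>x. sin (x k + c))"
| add: "smooth_gen n \<phi> \<Longrightarrow> smooth_gen n \<psi> \<Longrightarrow> smooth_gen n (\<lambda>x. \<phi> x + \<psi> x)"
| mult: "smooth_gen n \<phi> \<Longrightarrow> smooth_gen n \<psi> \<Longrightarrow> smooth_gen n (\<lambda>x. \<phi> x * \<psi> x)"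
| sine: "smooth_gen n \<phi> \<Longrightarrow> smooth_gen n (\<lambda>x. sin (\<phi> x + c))"

lemma Cb_depends: "Cb_infinity n \<phi> \<Longrightarrow> (\<And>i. i < n \<Longrightarrow> x i = y i) \<Longrightarrow> \<phi> x = \<phi> y"
  unfolding Cb_infinity_def by blast

lemma Cb_iter:
  assumes "Cb_infinity n \<phi>" "set js \<subseteq> {..<n}"
  shows "continuous_on UNIV (foldr pd js \<phi>)" "bounded (range (foldr pd js \<phi>))"
    "i < n \<Longrightarrow> (\<lambda>s. foldr pd js \<phi> (x(i := s))) differentiable (at (x i))"
  using assms unfolding Cb_infinity_def by simp_all

lemma Cb_cont: "Cb_infinity n \<phi> \<Longrightarrow> continuous_on UNIV \<phi>"
  using Cb_iter(1)[of n \<phi> "[]"] by simp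

lemma Cb_bounded: "Cb_infinity n \<phi> \<Longrightarrow> bounded (range \<phi>)"
  using Cb_iter(2)[of n \<phi> "[]"] by simp

lemma Cb_deriv:
  assumes "Cb_infinity n \<phi>" "i < n"
  shows "((\<lambda>s. \<phi> (x(i := s))) has_real_derivative pd i \<phi> x) (at (x i))"
proof -
  have "(\<lambda>s. \<phi> (x(i := s))) differentiable (at (x i))"
    using Cb_iter(3)[OF assms(1), of "[]" i x] assms(2) by simp
  then show ?thesis unfolding pd_def by (simp add: DERIV_deriv_iff_real_differentiable)
qed

lemma Cb_pd:
  assumes "Cb_infinity n \<phi>" "i < n"
  shows "Cb_infinity n (pd i \<phi>)"
  unfolding Cb_infinity_def
proof (intro conjI allI impI)
  fix x y :: "nat \<Rightarrow> real" assume xy: "\<forall>i<n. x i = y i"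
  have "(\<lambda>s. \<phi> (x(i := s))) = (\<lambda>s. \<phi> (y(i := s)))"
    by (intro ext Cb_depends[OF assms(1)]) (use xy in auto)
  then show "pd i \<phi> x = pd i \<phi> y" unfolding pd_def using xy assms(2) by simp
next
  fix js i' x assume js: "set js \<subseteq> {..<n}"
  have *: "foldr pd js (pd i \<phi>) = foldr pd (js @ [i]) \<phi>" by simp
  have js': "set (js @ [i]) \<subseteq> {..<n}" using js assms(2) by auto
  show "continuous_on UNIV (foldr pd js (pd i \<phi>))" "bounded (range (foldr pd js (pd i \<phi>)))"
    unfolding * by (rule Cb_iter[OF assms(1) js'])+
  show "(\<lambda>s. foldr pd js (pd i \<phi>) (x(i' := s))) differentiable (at (x i'))" if "i' < n"
    unfolding * by (rule Cb_iter(3)[OF assms(1) js' that])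
qed

lemma pdI:
  assumes "\<And>x. ((\<lambda>s. \<phi> (x(i := s))) has_real_derivative \<phi>' x) (at (x i))"
  shows "pd i \<phi> = \<phi>'"
  unfolding pd_def by (rule ext) (rule DERIV_imp_deriv[OF assms])

lemma smooth_gen_deriv:
  assumes "smooth_gen n \<phi>"
  shows "\<exists>\<phi>'. smooth_gen n \<phi>' \<and> (\<forall>x. ((\<lambda>s. \<phi> (x(i := s))) has_real_derivative \<phi>' x) (at (x i)))"
  using assms
proof (induction \<phi>)
  case (shift m \<phi> k)
  show ?case
  proof (cases "k \<le> i \<and> i < k + m")
    case True
    have eq: "(\<lambda>j. (x(i := s)) (j + k)) = (\<lambda>j. x (j + k))(i - k := s)" for x :: "nat \<Rightarrow> real" and s
      using True by (auto intro!: ext)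
    have "((\<lambda>s. \<phi> (\<lambda>j. (x(i := s)) (j + k))) has_real_derivative pd (i - k) \<phi> (\<lambda>j. x (j + k))) (at (x i))" for x
    proof -
      have "i - k < m" "i - k + k = i" using True by auto
      then show ?thesis using Cb_deriv[OF shift(1), of "i - k" "\<lambda>j. x (j + k)"] unfolding eq by simp
    qed
    moreover have "smooth_gen n (\<lambda>x. pd (i - k) \<phi> (\<lambda>j. x (j + k)))"
      by (rule smooth_gen.shift[of m]) (use shift True Cb_pd in auto)
    ultimately show ?thesis by blast
  next
    case False
    have eq: "\<phi> (\<lambda>j. (x(i := s)) (j + k)) = \<phi> (\<lambda>j. x (j + k))" for x :: "nat \<Rightarrow> real" and s
      by (rule Cb_depends[OF shift(1)]) (use False in auto)
    show ?thesis unfolding eq using smooth_gen.const[of n 0] by (intro exI[of _ "\<lambda>_. 0"]) auto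
  qed
next
  case (const c)
  show ?case using smooth_gen.const[of n 0] by (intro exI[of _ "\<lambda>_. 0"]) auto
next
  case (coord k c)
  show ?case
  proof (cases "k = i")
    case True
    have "smooth_gen n (\<lambda>x. sin (x k + (c + pi / 2)))" by (rule smooth_gen.coord) fact
    then show ?thesis unfolding True
      by (intro exI[of _ "\<lambda>x. sin (x i + (c + pi/2))"] conjI allI)
        (auto intro!: derivative_eq_intros simp: sin_add[of _ "pi/2"] simp flip: add.assoc)
  next
    case False
    then show ?thesis using smooth_gen.const[of n 0] by (intro exI[of _ "\<lambda>_. 0"]) auto
  qed
next
  case (add \<phi> \<psi>)
  then obtain \<phi>' \<psi>' where "smooth_gen n \<phi>'" "smooth_gen n \<psi>'"
    and d[rule_format]: "\<forall>x. ((\<lambda>s. \<phi> (x(i := s))) has_real_derivative \<phi>' x) (at (x i))"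
     "\<forall>x. ((\<lambda>s. \<psi> (x(i := s))) has_real_derivative \<psi>' x) (at (x i))" by blast
  then have "smooth_gen n (\<lambda>x. \<phi>' x + \<psi>' x)" by (intro smooth_gen.add)
  moreover have "((\<lambda>s. \<phi> (x(i := s)) + \<psi> (x(i := s))) has_real_derivative \<phi>' x + \<psi>' x) (at (x i))" for x
    by (intro derivative_intros d)
  ultimately show ?case by blast
next
  case (mult \<phi> \<psi>)
  then obtain \<phi>' \<psi>' where g: "smooth_gen n \<phi>'" "smooth_gen n \<psi>'"
    and d[rule_format]: "\<forall>x. ((\<lambda>s. \<phi> (x(i := s))) has_real_derivative \<phi>' x) (at (x i))"
     "\<forall>x. ((\<lambda>s. \<psi> (x(i := s))) has_real_derivative \<psi>' x) (at (x i))" by blast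
  have "smooth_gen n (\<lambda>x. \<phi>' x * \<psi> x + \<psi>' x * \<phi> x)" by (intro smooth_gen.add smooth_gen.mult g mult)
  moreover have "((\<lambda>s. \<phi> (x(i := s)) * \<psi> (x(i := s))) has_real_derivative \<phi>' x * \<psi> x + \<psi>' x * \<phi> x) (at (x i))" for x
    using DERIV_mult[OF d(1)[of x] d(2)[of x]] by simp
  ultimately show ?case by blast
next
  case (sine \<phi> c)
  then obtain \<phi>' where g: "smooth_gen n \<phi>'"
    and d[rule_format]: "\<forall>x. ((\<lambda>s. \<phi> (x(i := s))) has_real_derivative \<phi>' x) (at (x i))" by blast
  have "smooth_gen n (\<lambda>x. sin (\<phi> x + (c + pi/2)) * \<phi>' x)" by (intro smooth_gen.mult smooth_gen.sine g sine)
  moreover have "((\<lambda>s. sin (\<phi> (x(i := s)) + c)) has_real_derivative sin (\<phi> x + (c + pi/2)) * \<phi>' x) (at (x i))" for x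
  proof -
    have "((\<lambda>s. sin (\<phi> (x(i := s)) + c)) has_real_derivative cos (\<phi> (x(i := x i)) + c) * (\<phi>' x + 0)) (at (x i))"
      by (intro derivative_intros d)
    moreover have "sin (\<phi> x + (c + pi/2)) = cos (\<phi> x + c)" by (simp add: sin_add[of _ "pi/2"] flip: add.assoc)
    ultimately show ?thesis by simp
  qed
  ultimately show ?case by blast
qed

lemma smooth_gen_cont: "smooth_gen n \<phi> \<Longrightarrow> continuous_on UNIV \<phi>"
proof (induction \<phi> rule: smooth_gen.induct)
  case (shift m \<phi> k)
  have "continuous_on UNIV (\<lambda>x. (\<lambda>j. x (j + k)) :: nat \<Rightarrow> real)"
    by (intro continuous_on_coordinatewise_then_product) simp
  from continuous_on_compose2[OF Cb_cont[OF shift(1)] this] show ?case by simp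
qed (intro continuous_intros continuous_on_product_coordinates; assumption)+

lemma smooth_gen_bounded: "smooth_gen n \<phi> \<Longrightarrow> bounded (range \<phi>)"
proof (induction \<phi> rule: smooth_gen.induct)
  case (shift m \<phi> k)
  show ?case by (rule bounded_subset[OF Cb_bounded[OF shift(1)]]) auto
next
  case (coord k c)
  show ?case by (rule boundedI[of _ 1]) auto
next
  case (sine \<phi> c)
  show ?case by (rule boundedI[of _ 1]) auto
next
  case (add \<phi> \<psi>)
  then show ?case by (simp add: bounded_plus_comp)
next
  case (mult \<phi> \<psi>)
  then obtain A B where "\<And>x. \<bar>\<phi> x\<bar> \<le> A" "\<And>x. \<bar>\<psi> x\<bar> \<le> B"
    unfolding bounded_iff by auto
  then have "\<bar>\<phi> x * \<psi> x\<bar> \<le> A * B" for x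
    unfolding abs_mult by (intro mult_mono) (auto intro: order_trans[OF abs_ge_zero])
  then show ?case by (intro boundedI[of _ "A * B"]) auto
qed simp_all

lemma smooth_gen_depends: "smooth_gen n \<phi> \<Longrightarrow> \<forall>x y. (\<forall>i<n. x i = y i) \<longrightarrow> \<phi> x = \<phi> y"
proof (induction \<phi> rule: smooth_gen.induct)
  case (shift m \<phi> k)
  show ?case by (intro allI impI Cb_depends[OF shift(1)]) (use shift in auto)
next
  case (add \<phi> \<psi>)
  show ?case by (intro allI impI arg_cong2[where f = "(+)"]) (use add.IH in blast)+
next
  case (mult \<phi> \<psi>)
  show ?case by (intro allI impI arg_cong2[where f = "(*)"]) (use mult.IH in blast)+
next
  case (sine \<phi> c)
  show ?case by (intro allI impI arg_cong[where f = "\<lambda>u. sin (u + c)"]) (use sine.IH in blast)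
qed simp_all

lemma smooth_gen_Cb:
  assumes "smooth_gen n \<phi>"
  shows "Cb_infinity n \<phi>"
proof -
  have *: "smooth_gen n (foldr pd js \<phi>)" for js
  proof (induction js)
    case (Cons i js)
    obtain \<phi>' where "smooth_gen n \<phi>'" "\<forall>x. ((\<lambda>s. foldr pd js \<phi> (x(i := s))) has_real_derivative \<phi>' x) (at (x i))"
      using smooth_gen_deriv[OF Cons] by blast
    then show ?case using pdI[of "foldr pd js \<phi>" i \<phi>'] by simp
  qed (use assms in simp)
  show ?thesis unfolding Cb_infinity_def
  proof (intro conjI allI impI)
    show "\<phi> x = \<phi> y" if "\<forall>i<n. x i = y i" for x y using smooth_gen_depends[OF assms] that by blast
    fix js i x
    show "(\<lambda>s. foldr pd js \<phi> (x(i := s))) differentiable (at (x i))"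
      using smooth_gen_deriv[OF *, of js i] real_differentiable_def by blast
    show "continuous_on UNIV (foldr pd js \<phi>)" by (rule smooth_gen_cont[OF *])
    show "bounded (range (foldr pd js \<phi>))" by (rule smooth_gen_bounded[OF *])
  qed
qed

lemma Cb_gen: "Cb_infinity n \<phi> \<Longrightarrow> smooth_gen n \<phi>"
  using smooth_gen.shift[of n \<phi> 0 n] by simp

text \<open>
  Change one coordinate at a time and apply the mean value theorem to each step.
\<close>

lemma Cb_mean_value:
  assumes \<phi>: "Cb_infinity n \<phi>"
  shows "\<exists>\<xi>. \<phi> y - \<phi> x = (\<Sum>j<n. (y j - x j) * pd j \<phi> (\<xi> j)) \<and> (\<forall>j k. \<bar>\<xi> j k - x k\<bar> \<le> \<bar>y k - x k\<bar>)"
proof -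
  define z where "z j = (\<lambda>k. if k < j then y k else x k)" for j :: nat
  have step: "\<exists>s. \<phi> (z (Suc j)) - \<phi> (z j) = (y j - x j) * pd j \<phi> ((z j)(j := s)) \<and> \<bar>s - x j\<bar> \<le> \<bar>y j - x j\<bar>"
    if j: "j < n" for j
  proof -
    define g where "g s = \<phi> ((z j)(j := s))" for s
    have g': "(g has_real_derivative pd j \<phi> ((z j)(j := s))) (at s)" for s
      using Cb_deriv[OF \<phi> j, of "(z j)(j := s)"] by (simp add: g_def[abs_def])
    have e: "g (y j) = \<phi> (z (Suc j))" "g (x j) = \<phi> (z j)"
      unfolding g_def by (auto simp: z_def intro!: arg_cong[where f = \<phi>])
    consider "x j < y j" | "x j = y j" | "y j < x j" by linarith
    then have "\<exists>s. g (y j) - g (x j) = (y j - x j) * pd j \<phi> ((z j)(j := s)) \<and> \<bar>s - x j\<bar> \<le> \<bar>y j - x j\<bar>"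
    proof cases
      case 1
      from MVT2[OF this, of g "\<lambda>s. pd j \<phi> ((z j)(j := s))"] g' obtain s
        where "x j < s" "s < y j" "g (y j) - g (x j) = (y j - x j) * pd j \<phi> ((z j)(j := s))" by blast
      then show ?thesis by (intro exI[of _ s]) auto
    next
      case 2
      then show ?thesis by (intro exI[of _ "x j"]) auto
    next
      case 3
      from MVT2[OF this, of g "\<lambda>s. pd j \<phi> ((z j)(j := s))"] g' obtain s
        where "y j < s" "s < x j" "g (x j) - g (y j) = (x j - y j) * pd j \<phi> ((z j)(j := s))" by blast
      then show ?thesis by (intro exI[of _ s]) (auto simp: algebra_simps)
    qed
    then show ?thesis unfolding e .
  qed
  then obtain s where s: "\<And>j. j < n \<Longrightarrow> \<phi> (z (Suc j)) - \<phi> (z j) = (y j - x j) * pd j \<phi> ((z j)(j := s j))"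
    "\<And>j. j < n \<Longrightarrow> \<bar>s j - x j\<bar> \<le> \<bar>y j - x j\<bar>" by metis
  have "\<phi> y = \<phi> (z n)" by (rule Cb_depends[OF \<phi>]) (simp add: z_def)
  moreover have "\<phi> x = \<phi> (z 0)" by (simp add: z_def)
  ultimately have "\<phi> y - \<phi> x = (\<Sum>j<n. \<phi> (z (Suc j)) - \<phi> (z j))"
    using sum_lessThan_telescope[of "\<lambda>j. \<phi> (z j)" n] by simp
  also have "\<dots> = (\<Sum>j<n. (y j - x j) * pd j \<phi> ((z j)(j := s j)))" using s by simp
  finally show ?thesis
    by (intro exI[of _ "\<lambda>j. if j < n then (z j)(j := s j) else x"]) (use s in \<open>auto simp: z_def\<close>)
qed

lemma tendsto_coordinatewise:
  fixes g :: "'a \<Rightarrow> nat \<Rightarrow> real"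
  assumes "\<And>k. ((\<lambda>h. g h k) \<longlongrightarrow> L k) F"
  shows "(g \<longlongrightarrow> L) F"
proof -
  have "limitin (product_topology (\<lambda>i. euclidean) UNIV) g L F"
    unfolding limitin_componentwise using assms by (simp add: extensional_UNIV)
  then show ?thesis by (simp add: euclidean_product_topology)
qed

text \<open>
  The intermediate points of the mean value formula converge coordinatewise, which is convergence in
  the product topology, in which the partial derivatives are continuous.
\<close>

lemma Cb_chain_rule:
  assumes \<phi>: "Cb_infinity n \<phi>"
    and X: "\<And>j. ((\<lambda>s. X s j) has_real_derivative X' j) (at t)"
  shows "((\<lambda>s. \<phi> (X s)) has_real_derivative (\<Sum>j<n. pd j \<phi> (X t) * X' j)) (at t)"
proof -
  have "\<forall>h. \<exists>\<xi>. \<phi> (X (t + h)) - \<phi> (X t) = (\<Sum>j<n. (X (t + h) j - X t j) * pd j \<phi> (\<xi> j)) \<and>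
      (\<forall>j k. \<bar>\<xi> j k - X t k\<bar> \<le> \<bar>X (t + h) k - X t k\<bar>)"
    by (intro allI Cb_mean_value[OF \<phi>])
  from choice[OF this] obtain \<xi>
    where \<xi>: "\<And>h. \<phi> (X (t + h)) - \<phi> (X t) = (\<Sum>j<n. (X (t + h) j - X t j) * pd j \<phi> (\<xi> h j))"
      and \<xi>_le: "\<And>h j k. \<bar>\<xi> h j k - X t k\<bar> \<le> \<bar>X (t + h) k - X t k\<bar>" by auto
  have Xc: "((\<lambda>h. X (t + h) k - X t k) \<longlongrightarrow> 0) (at 0)" for k
  proof -
    have "isCont (\<lambda>s. X s k) t" by (rule DERIV_isCont[OF X])
    then have "((\<lambda>h. X (t + h) k) \<longlongrightarrow> X t k) (at 0)" by (simp only: isCont_iff)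
    then show ?thesis by (simp add: LIM_zero)
  qed
  have \<xi>_lim: "((\<lambda>h. \<xi> h j) \<longlongrightarrow> X t) (at 0)" for j
  proof (rule tendsto_coordinatewise)
    fix k
    have "((\<lambda>h. \<xi> h j k - X t k) \<longlongrightarrow> 0) (at 0)"
      by (rule Lim_null_comparison[OF _ tendsto_rabs_zero[OF Xc[of k]]]) (use \<xi>_le in auto)
    then show "((\<lambda>h. \<xi> h j k) \<longlongrightarrow> X t k) (at 0)" by (rule LIM_zero_cancel)
  qed
  have "((\<lambda>h. \<Sum>j<n. (X (t + h) j - X t j) / h * pd j \<phi> (\<xi> h j)) \<longlongrightarrow> (\<Sum>j<n. X' j * pd j \<phi> (X t))) (at 0)"
  proof (intro tendsto_sum tendsto_mult)
    fix j assume j: "j \<in> {..<n}"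
    show "((\<lambda>h. (X (t + h) j - X t j) / h) \<longlongrightarrow> X' j) (at 0)" using X[of j] by (simp add: DERIV_def)
    have "isCont (pd j \<phi>) (X t)"
      using Cb_cont[OF Cb_pd[OF \<phi>]] j by (simp add: continuous_on_eq_continuous_at)
    then show "((\<lambda>h. pd j \<phi> (\<xi> h j)) \<longlongrightarrow> pd j \<phi> (X t)) (at 0)"
      by (rule isCont_tendsto_compose[OF _ \<xi>_lim])
  qed
  moreover have "(\<Sum>j<n. (X (t + h) j - X t j) / h * pd j \<phi> (\<xi> h j)) = (\<phi> (X (t + h)) - \<phi> (X t)) / h" for h
    unfolding \<xi> sum_divide_distrib by (intro sum.cong) auto
  ultimately show ?thesis unfolding DERIV_def by (simp add: mult.commute)
qed

text \<open>
  The left-hand side is symmetric in \<open>i\<close> and \<open>j\<close>; applying the mean value theorem in both orders thus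
  compares the two mixed derivatives at nearby points.
\<close>

lemma Cb_second_difference:
  assumes \<phi>: "Cb_infinity n \<phi>" and ij: "i < n" "j < n" "i \<noteq> j" and h: "0 < h"
  shows "\<exists>a b. \<bar>a - x i\<bar> \<le> h \<and> \<bar>b - x j\<bar> \<le> h \<and>
     \<phi> (x(i := x i + h, j := x j + h)) - \<phi> (x(i := x i + h)) - \<phi> (x(j := x j + h)) + \<phi> x
       = h * h * pd j (pd i \<phi>) (x(i := a, j := b))"
proof -
  define g where "g s = \<phi> (x(i := s, j := x j + h)) - \<phi> (x(i := s))" for s
  have g': "(g has_real_derivative pd i \<phi> (x(i := s, j := x j + h)) - pd i \<phi> (x(i := s))) (at s)" for s
  proof -
    have "((\<lambda>s. \<phi> (x(i := s, j := x j + h))) has_real_derivative pd i \<phi> (x(i := s, j := x j + h))) (at s)"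
      using Cb_deriv[OF \<phi> ij(1), of "x(i := s, j := x j + h)"] ij(3) by (simp add: fun_upd_twist)
    moreover have "((\<lambda>s. \<phi> (x(i := s))) has_real_derivative pd i \<phi> (x(i := s))) (at s)"
      using Cb_deriv[OF \<phi> ij(1), of "x(i := s)"] by simp
    ultimately show ?thesis unfolding g_def[abs_def] by (rule DERIV_diff)
  qed
  from MVT2[of "x i" "x i + h" g "\<lambda>s. pd i \<phi> (x(i := s, j := x j + h)) - pd i \<phi> (x(i := s))"] g' h
  obtain a where a: "x i < a" "a < x i + h"
    "g (x i + h) - g (x i) = h * (pd i \<phi> (x(i := a, j := x j + h)) - pd i \<phi> (x(i := a)))" by auto
  have k': "((\<lambda>s. pd i \<phi> (x(i := a, j := s))) has_real_derivative pd j (pd i \<phi>) (x(i := a, j := s))) (at s)" for s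
    using Cb_deriv[OF Cb_pd[OF \<phi> ij(1)] ij(2), of "x(i := a, j := s)"] by simp
  from MVT2[of "x j" "x j + h" "\<lambda>s. pd i \<phi> (x(i := a, j := s))" "\<lambda>s. pd j (pd i \<phi>) (x(i := a, j := s))"] k' h
  obtain b where b: "x j < b" "b < x j + h"
    "pd i \<phi> (x(i := a, j := x j + h)) - pd i \<phi> (x(i := a, j := x j)) = h * pd j (pd i \<phi>) (x(i := a, j := b))"
    by auto
  have "x(i := a, j := x j) = x(i := a)" using ij(3) by auto
  moreover have "x(i := x i, j := x j + h) = x(j := x j + h)" by simp
  ultimately show ?thesis using a b by (intro exI[of _ a] exI[of _ b]) (auto simp: g_def mult.assoc)
qed

lemma pd_commute:
  assumes \<phi>: "Cb_infinity n \<phi>" and ij: "i < n" "j < n"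
  shows "pd i (pd j \<phi>) = pd j (pd i \<phi>)"
proof (cases "i = j")
  case False
  show ?thesis
  proof
    fix x
    define H where "H k = inverse (real (Suc k))" for k
    have "H \<longlonglongrightarrow> 0" unfolding H_def by (rule LIMSEQ_inverse_real_of_nat)
    have H: "0 < H k" for k by (simp add: H_def)
    have "\<forall>k. \<exists>a b. \<bar>a - x i\<bar> \<le> H k \<and> \<bar>b - x j\<bar> \<le> H k \<and>
       \<phi> (x(i := x i + H k, j := x j + H k)) - \<phi> (x(i := x i + H k)) - \<phi> (x(j := x j + H k)) + \<phi> x
       = H k * H k * pd j (pd i \<phi>) (x(i := a, j := b))"
      by (intro allI Cb_second_difference[OF \<phi> ij False H])
    then obtain a b where ab: "\<And>k. \<bar>a k - x i\<bar> \<le> H k" "\<And>k. \<bar>b k - x j\<bar> \<le> H k"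
      "\<And>k. \<phi> (x(i := x i + H k, j := x j + H k)) - \<phi> (x(i := x i + H k)) - \<phi> (x(j := x j + H k)) + \<phi> x
       = H k * H k * pd j (pd i \<phi>) (x(i := a k, j := b k))"
      by metis
    have "\<forall>k. \<exists>a b. \<bar>a - x j\<bar> \<le> H k \<and> \<bar>b - x i\<bar> \<le> H k \<and>
       \<phi> (x(j := x j + H k, i := x i + H k)) - \<phi> (x(j := x j + H k)) - \<phi> (x(i := x i + H k)) + \<phi> x
       = H k * H k * pd i (pd j \<phi>) (x(j := a, i := b))"
      by (intro allI Cb_second_difference[OF \<phi> ij(2,1) False[symmetric] H])
    then obtain a' b' where ab': "\<And>k. \<bar>a' k - x j\<bar> \<le> H k" "\<And>k. \<bar>b' k - x i\<bar> \<le> H k"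
      "\<And>k. \<phi> (x(j := x j + H k, i := x i + H k)) - \<phi> (x(j := x j + H k)) - \<phi> (x(i := x i + H k)) + \<phi> x
       = H k * H k * pd i (pd j \<phi>) (x(j := a' k, i := b' k))"
      by metis
    have "H k * H k * pd j (pd i \<phi>) (x(i := a k, j := b k)) = H k * H k * pd i (pd j \<phi>) (x(j := a' k, i := b' k))" for k
      using ab(3)[of k] ab'(3)[of k] unfolding fun_upd_twist[OF False, of x "x i + H k" "x j + H k"] by linarith
    then have eq: "pd j (pd i \<phi>) (x(i := a k, j := b k)) = pd i (pd j \<phi>) (x(j := a' k, i := b' k))" for k
      using H[of k] by (metis mult_cancel_left mult_pos_pos less_irrefl)
    have lim: "c \<longlonglongrightarrow> y" if "\<And>k. \<bar>c k - y\<bar> \<le> H k" for c :: "nat \<Rightarrow> real" and y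
    proof -
      have "(\<lambda>k. c k - y) \<longlonglongrightarrow> 0" by (rule Lim_null_comparison[OF _ \<open>H \<longlonglongrightarrow> 0\<close>]) (use that in auto)
      then show ?thesis by (rule LIM_zero_cancel)
    qed
    have upd: "(\<lambda>k. x(i' := c k, j' := d k)) \<longlonglongrightarrow> x" if "c \<longlonglongrightarrow> x i'" "d \<longlonglongrightarrow> x j'" for c d :: "nat \<Rightarrow> real" and i' j'
    proof (rule tendsto_coordinatewise)
      fix l show "(\<lambda>k. (x(i' := c k, j' := d k)) l) \<longlonglongrightarrow> x l"
        using that by (cases "l = j'"; cases "l = i'") simp_all
    qed
    have cont: "isCont (pd j (pd i \<phi>)) x" "isCont (pd i (pd j \<phi>)) x"
      using Cb_cont[OF Cb_pd[OF Cb_pd[OF \<phi> ij(1)] ij(2)]] Cb_cont[OF Cb_pd[OF Cb_pd[OF \<phi> ij(2)] ij(1)]]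
      by (auto simp: continuous_on_eq_continuous_at)
    have "(\<lambda>k. pd j (pd i \<phi>) (x(i := a k, j := b k))) \<longlonglongrightarrow> pd j (pd i \<phi>) x"
      by (rule isCont_tendsto_compose[OF cont(1) upd[OF lim[OF ab(1)] lim[OF ab(2)]]])
    moreover have "(\<lambda>k. pd i (pd j \<phi>) (x(j := a' k, i := b' k))) \<longlonglongrightarrow> pd i (pd j \<phi>) x"
      by (rule isCont_tendsto_compose[OF cont(2) upd[OF lim[OF ab'(1)] lim[OF ab'(2)]]])
    ultimately show "pd i (pd j \<phi>) x = pd j (pd i \<phi>) x" unfolding eq using LIMSEQ_unique by blast
  qed
qed simp

section \<open>Smooth functionals and their gradients\<close>

text \<open>
  Membership in the generated class replaces the verification of smoothness.
\<close>

lemma smooth_gradI: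
  fixes l :: "nat \<Rightarrow> 'w::banach \<Rightarrow>\<^sub>L real"
  assumes "smooth_gen n \<phi>" "\<And>\<omega>. F \<omega> = \<phi> (\<lambda>j. l j \<omega>)"
    and "\<And>\<omega>. G \<omega> = (\<Sum>j<n. pd j \<phi> (\<lambda>j. l j \<omega>) *\<^sub>R dual_embed \<iota> (l j))"
  shows "smooth_grad \<iota> F G"
  unfolding smooth_grad_def cylinder_def
  using smooth_gen_Cb[OF assms(1)] assms(2,3) by (intro exI[of _ n] exI[of _ l] exI[of _ \<phi>]) auto

lemma smooth_gradE:
  fixes \<iota> :: "'h::{real_inner, banach} \<Rightarrow>\<^sub>L 'w::banach"
  assumes "smooth_grad \<iota> F G"
  obtains n and l :: "nat \<Rightarrow> 'w \<Rightarrow>\<^sub>L real" and \<phi> where "Cb_infinity n \<phi>" "F = (\<lambda>\<omega>. \<phi> (\<lambda>j. l j \<omega>))"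
    "G = (\<lambda>\<omega>. \<Sum>j<n. pd j \<phi> (\<lambda>j. l j \<omega>) *\<^sub>R dual_embed \<iota> (l j))"
  using assms unfolding smooth_grad_def cylinder_def by blast

lemma cylinder_continuous:
  fixes l :: "nat \<Rightarrow> 'w::real_normed_vector \<Rightarrow>\<^sub>L real"
  assumes "Cb_infinity n \<phi>"
  shows "continuous_on UNIV (\<lambda>\<omega>. \<phi> (\<lambda>j. l j \<omega>))"
proof -
  have "continuous_on UNIV (\<lambda>\<omega>. (\<lambda>j. l j \<omega>))"
    by (intro continuous_on_coordinatewise_then_product continuous_intros)
  from continuous_on_compose2[OF Cb_cont[OF assms] this] show ?thesis by simp
qed

lemma smooth_grad_continuous:
  fixes \<iota> :: "'h::{real_inner, banach} \<Rightarrow>\<^sub>L 'w::banach"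
  assumes "smooth_grad \<iota> F G"
  shows "continuous_on UNIV F" "continuous_on UNIV G"
proof -
  obtain n and l :: "nat \<Rightarrow> 'w \<Rightarrow>\<^sub>L real" and \<phi> where \<phi>: "Cb_infinity n \<phi>" and F: "F = (\<lambda>\<omega>. \<phi> (\<lambda>j. l j \<omega>))"
    and G: "G = (\<lambda>\<omega>. \<Sum>j<n. pd j \<phi> (\<lambda>j. l j \<omega>) *\<^sub>R dual_embed \<iota> (l j))"
    using assms by (rule smooth_gradE)
  show "continuous_on UNIV F" unfolding F by (rule cylinder_continuous[OF \<phi>])
  show "continuous_on UNIV G" unfolding G
    by (intro continuous_intros cylinder_continuous[of n] Cb_pd[OF \<phi>]) simp
qed

lemma Cb_bound: "Cb_infinity n \<phi> \<Longrightarrow> \<exists>C. \<forall>x. \<bar>\<phi> x\<bar> \<le> C"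
  using Cb_bounded[of n \<phi>] unfolding bounded_iff by auto

lemma smooth_grad_bounded:
  fixes \<iota> :: "'h::{real_inner, banach} \<Rightarrow>\<^sub>L 'w::banach"
  assumes "smooth_grad \<iota> F G"
  obtains C where "\<And>\<omega>. \<bar>F \<omega>\<bar> \<le> C" "\<And>\<omega>. norm (G \<omega>) \<le> C"
proof -
  obtain n and l :: "nat \<Rightarrow> 'w \<Rightarrow>\<^sub>L real" and \<phi> where \<phi>: "Cb_infinity n \<phi>" and F: "F = (\<lambda>\<omega>. \<phi> (\<lambda>j. l j \<omega>))"
    and G: "G = (\<lambda>\<omega>. \<Sum>j<n. pd j \<phi> (\<lambda>j. l j \<omega>) *\<^sub>R dual_embed \<iota> (l j))"
    using assms by (rule smooth_gradE)
  have "\<forall>j\<in>{..<n}. \<exists>C. \<forall>x. \<bar>pd j \<phi> x\<bar> \<le> C" using Cb_bound[OF Cb_pd[OF \<phi>]] by simp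
  from bchoice[OF this] obtain C where C: "\<And>j x. j < n \<Longrightarrow> \<bar>pd j \<phi> x\<bar> \<le> C j" by auto
  obtain C0 where C0: "\<And>x. \<bar>\<phi> x\<bar> \<le> C0" using Cb_bound[OF \<phi>] by auto
  define D where "D = (\<Sum>j<n. C j * norm (dual_embed \<iota> (l j)))"
  have D: "norm (G \<omega>) \<le> D" for \<omega>
    unfolding G D_def by (rule sum_norm_le) (simp add: C mult_right_mono)
  show thesis by (rule that[of "max C0 D"]) (use C0 D in \<open>auto simp: F max.coboundedI1 max.coboundedI2\<close>)
qed

lemma smooth_grad_const: "smooth_grad \<iota> (\<lambda>_. c) (\<lambda>_. 0)"
  by (rule smooth_gradI[OF smooth_gen.const[of 0 c]]) auto

lemma sum_lessThan_add: "(\<Sum>j<a + b. f j) = (\<Sum>j<a. f j) + (\<Sum>j<b. f (a + j :: nat))"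
  for f :: "nat \<Rightarrow> 'a::comm_monoid_add"
  by (induction b) (auto simp: add.assoc)

text \<open>
  The two lists of functionals are concatenated, and the second factor reads the coordinates
  shifted by \<open>n1\<close>.
\<close>

lemma smooth_grad_mult:
  fixes \<iota> :: "'h::{real_inner, banach} \<Rightarrow>\<^sub>L 'w::banach"
  assumes "smooth_grad \<iota> F1 G1" "smooth_grad \<iota> F2 G2"
  shows "smooth_grad \<iota> (\<lambda>\<omega>. F1 \<omega> * F2 \<omega>) (\<lambda>\<omega>. F2 \<omega> *\<^sub>R G1 \<omega> + F1 \<omega> *\<^sub>R G2 \<omega>)"
proof -
  obtain n1 and l1 :: "nat \<Rightarrow> 'w \<Rightarrow>\<^sub>L real" and \<phi>1 where \<phi>1: "Cb_infinity n1 \<phi>1" and F1: "F1 = (\<lambda>\<omega>. \<phi>1 (\<lambda>j. l1 j \<omega>))"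
    and G1: "G1 = (\<lambda>\<omega>. \<Sum>j<n1. pd j \<phi>1 (\<lambda>j. l1 j \<omega>) *\<^sub>R dual_embed \<iota> (l1 j))"
    using assms(1) by (rule smooth_gradE)
  obtain n2 and l2 :: "nat \<Rightarrow> 'w \<Rightarrow>\<^sub>L real" and \<phi>2 where \<phi>2: "Cb_infinity n2 \<phi>2" and F2: "F2 = (\<lambda>\<omega>. \<phi>2 (\<lambda>j. l2 j \<omega>))"
    and G2: "G2 = (\<lambda>\<omega>. \<Sum>j<n2. pd j \<phi>2 (\<lambda>j. l2 j \<omega>) *\<^sub>R dual_embed \<iota> (l2 j))"
    using assms(2) by (rule smooth_gradE)
  define l where "l j = (if j < n1 then l1 j else l2 (j - n1))" for j
  define \<phi> where "\<phi> x = \<phi>1 x * \<phi>2 (\<lambda>j. x (j + n1))" for x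
  have gen: "smooth_gen (n1 + n2) \<phi>"
    unfolding \<phi>_def[abs_def] using smooth_gen.shift[OF \<phi>1, of 0 "n1 + n2"] smooth_gen.shift[OF \<phi>2, of n1 "n1 + n2"]
    by (intro smooth_gen.mult) simp_all
  have pd1: "pd j \<phi> = (\<lambda>x. pd j \<phi>1 x * \<phi>2 (\<lambda>j. x (j + n1)))" if j: "j < n1" for j
  proof (rule pdI)
    fix x :: "nat \<Rightarrow> real"
    have "(\<lambda>i. (x(j := s)) (i + n1)) = (\<lambda>i. x (i + n1))" for s using j by auto
    then show "((\<lambda>s. \<phi> (x(j := s))) has_real_derivative pd j \<phi>1 x * \<phi>2 (\<lambda>j. x (j + n1))) (at (x j))"
      unfolding \<phi>_def by (simp only:) (rule DERIV_cmult_right[OF Cb_deriv[OF \<phi>1 j]])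
  qed
  have pd2: "pd (n1 + j) \<phi> = (\<lambda>x. \<phi>1 x * pd j \<phi>2 (\<lambda>j. x (j + n1)))" if j: "j < n2" for j
  proof (rule pdI)
    fix x :: "nat \<Rightarrow> real"
    have 1: "(\<lambda>i. (x(n1 + j := s)) (i + n1)) = (\<lambda>i. x (i + n1))(j := s)" for s by auto
    have 2: "\<phi>1 (x(n1 + j := s)) = \<phi>1 x" for s by (rule Cb_depends[OF \<phi>1]) simp
    have "((\<lambda>s. \<phi>2 ((\<lambda>i. x (i + n1))(j := s))) has_real_derivative pd j \<phi>2 (\<lambda>j. x (j + n1))) (at (x (n1 + j)))"
      using Cb_deriv[OF \<phi>2 j, of "\<lambda>i. x (i + n1)"] by (simp add: add.commute)
    then show "((\<lambda>s. \<phi> (x(n1 + j := s))) has_real_derivative \<phi>1 x * pd j \<phi>2 (\<lambda>j. x (j + n1))) (at (x (n1 + j)))"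
      unfolding \<phi>_def 1 2 by (rule DERIV_cmult)
  qed
  have l1: "f (\<lambda>j. l j \<omega>) = f (\<lambda>j. l1 j \<omega>)" if "Cb_infinity n1 f" for f \<omega>
    by (rule Cb_depends[OF that]) (simp add: l_def)
  have l2: "(\<lambda>j. l (j + n1) \<omega>) = (\<lambda>j. l2 j \<omega>)" for \<omega> by (simp add: l_def)
  show ?thesis
  proof (rule smooth_gradI[OF gen])
    fix \<omega>
    show "F1 \<omega> * F2 \<omega> = \<phi> (\<lambda>j. l j \<omega>)" by (simp add: F1 F2 \<phi>_def l1[OF \<phi>1] l2)
    have "(\<Sum>j<n1 + n2. pd j \<phi> (\<lambda>j. l j \<omega>) *\<^sub>R dual_embed \<iota> (l j)) =
      (\<Sum>j<n1. (pd j \<phi>1 (\<lambda>j. l1 j \<omega>) * F2 \<omega>) *\<^sub>R dual_embed \<iota> (l1 j)) +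
      (\<Sum>j<n2. (F1 \<omega> * pd j \<phi>2 (\<lambda>j. l2 j \<omega>)) *\<^sub>R dual_embed \<iota> (l2 j))"
      unfolding sum_lessThan_add
      by (intro arg_cong2[where f = "(+)"] sum.cong refl)
        (simp_all add: pd1 pd2 l1[OF Cb_pd[OF \<phi>1]] l1[OF \<phi>1] l2 F1 F2, simp_all add: l_def)
    then show "F2 \<omega> *\<^sub>R G1 \<omega> + F1 \<omega> *\<^sub>R G2 \<omega> = (\<Sum>j<n1 + n2. pd j \<phi> (\<lambda>j. l j \<omega>) *\<^sub>R dual_embed \<iota> (l j))"
      by (simp add: G1 G2 scaleR_sum_right mult.commute)
  qed
qed

lemma smooth_grad_sin:
  fixes \<iota> :: "'h::{real_inner, banach} \<Rightarrow>\<^sub>L 'w::banach"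
  assumes "smooth_grad \<iota> F G"
  shows "smooth_grad \<iota> (\<lambda>\<omega>. sin (s * F \<omega> + c)) (\<lambda>\<omega>. (s * cos (s * F \<omega> + c)) *\<^sub>R G \<omega>)"
proof -
  obtain n and l :: "nat \<Rightarrow> 'w \<Rightarrow>\<^sub>L real" and \<phi> where \<phi>: "Cb_infinity n \<phi>" and F: "F = (\<lambda>\<omega>. \<phi> (\<lambda>j. l j \<omega>))"
    and G: "G = (\<lambda>\<omega>. \<Sum>j<n. pd j \<phi> (\<lambda>j. l j \<omega>) *\<^sub>R dual_embed \<iota> (l j))"
    using assms by (rule smooth_gradE)
  show ?thesis
  proof (rule smooth_gradI[where n = n and \<phi> = "\<lambda>x. sin (s * \<phi> x + c)" and l = l])
    show "smooth_gen n (\<lambda>x. sin (s * \<phi> x + c))"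
      by (intro smooth_gen.sine smooth_gen.mult smooth_gen.const Cb_gen \<phi>)
    have "pd j (\<lambda>x. sin (s * \<phi> x + c)) = (\<lambda>x. (s * cos (s * \<phi> x + c)) * pd j \<phi> x)" if "j < n" for j
    proof (rule pdI)
      fix x
      have "((\<lambda>r. s * \<phi> (x(j := r)) + c) has_real_derivative s * pd j \<phi> x) (at (x j))"
        using DERIV_add[OF DERIV_cmult[OF Cb_deriv[OF \<phi> that]] DERIV_const] by simp
      from DERIV_fun_sin[OF this]
      show "((\<lambda>r. sin (s * \<phi> (x(j := r)) + c)) has_real_derivative (s * cos (s * \<phi> x + c)) * pd j \<phi> x) (at (x j))"
        by (simp add: mult_ac)
    qed
    then show "(s * cos (s * F \<omega> + c)) *\<^sub>R G \<omega> =
      (\<Sum>j<n. pd j (\<lambda>x. sin (s * \<phi> x + c)) (\<lambda>j. l j \<omega>) *\<^sub>R dual_embed \<iota> (l j))" for \<omega>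
      by (simp add: F G scaleR_sum_right)
  qed (simp add: F)
qed

lemma smooth_grad_sin_functional:
  "smooth_grad \<iota> (\<lambda>\<omega>. sin (blinfun_apply l \<omega> + c)) (\<lambda>\<omega>. cos (l \<omega> + c) *\<^sub>R dual_embed \<iota> l)"
proof (rule smooth_gradI[where l = "\<lambda>_. l"])
  show "smooth_gen 1 (\<lambda>x. sin (x 0 + c))" by (rule smooth_gen.coord) simp
  have "pd 0 (\<lambda>x. sin (x 0 + c)) = (\<lambda>x. cos (x 0 + c))"
    by (rule pdI) (auto intro!: derivative_eq_intros)
  then show "cos (l \<omega> + c) *\<^sub>R dual_embed \<iota> l = (\<Sum>j<1. pd j (\<lambda>x. sin (x 0 + c)) (\<lambda>j. l \<omega>) *\<^sub>R dual_embed \<iota> l)" for \<omega>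
    by simp
qed simp

locale wiener_basis = prob_space \<mu> + onb e
  for \<mu> :: "'w::{banach, second_countable_topology} measure"
    and e :: "nat \<Rightarrow> 'h::{real_inner, banach, second_countable_topology}" +
  fixes \<iota> :: "'h \<Rightarrow>\<^sub>L 'w"
  assumes sets_\<mu> [measurable_cong]: "sets \<mu> = sets borel"
    and functional_law: "distr \<mu> borel (blinfun_apply l) = gaussian_law (norm (dual_embed \<iota> l))"
    and smooth_e: "e i \<in> range (dual_embed \<iota>)"

lemma wiener_basisI: "abstract_wiener_space \<mu> \<iota> \<Longrightarrow> smooth_onb \<iota> e \<Longrightarrow> wiener_basis \<mu> e \<iota>"
  unfolding abstract_wiener_space_def smooth_onb_def wiener_basis_def wiener_basis_axioms_def onb_def
  by simp

context wiener_basis begin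

lemma space_\<mu> [simp]: "space \<mu> = UNIV"
  using sets_eq_imp_space_eq[OF sets_\<mu>] by simp

lemma borel_measurable_continuous: "continuous_on UNIV F \<Longrightarrow> F \<in> borel_measurable \<mu>"
  unfolding measurable_cong_sets[OF sets_\<mu> refl] by (rule borel_measurable_continuous_onI)

lemma smooth_grad_measurable:
  assumes "smooth_grad \<iota> F G"
  shows "F \<in> borel_measurable \<mu>" "G \<in> borel_measurable \<mu>"
  using smooth_grad_continuous[OF assms] borel_measurable_continuous by auto

lemma smooth_grad_direction:
  assumes "smooth_grad \<iota> F G"
  shows "((\<lambda>s. F (\<omega> + s *\<^sub>R \<iota> h)) has_real_derivative G (\<omega> + t *\<^sub>R \<iota> h) \<bullet> h) (at t)"
proof -
  obtain n and l :: "nat \<Rightarrow> 'w \<Rightarrow>\<^sub>L real" and \<phi> where \<phi>: "Cb_infinity n \<phi>" and F: "F = (\<lambda>\<omega>. \<phi> (\<lambda>j. l j \<omega>))"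
    and G: "G = (\<lambda>\<omega>. \<Sum>j<n. pd j \<phi> (\<lambda>j. l j \<omega>) *\<^sub>R dual_embed \<iota> (l j))"
    using assms by (rule smooth_gradE)
  have "((\<lambda>s. l j (\<omega> + s *\<^sub>R \<iota> h)) has_real_derivative l j (\<iota> h)) (at t)" for j
    unfolding blinfun.add_right blinfun.scaleR_right by (auto intro!: derivative_eq_intros)
  from Cb_chain_rule[OF \<phi> this] show ?thesis
    unfolding F G by (simp add: inner_sum_left inner_dual_embed)
qed

text \<open>
  The characteristic functional of \<open>\<mu>\<close>, with a phase \<open>c\<close> in place of complex values. The standard deviation 0
  is separate, as a Dirac measure has no density.
\<close>

lemma functional_cos: "(\<integral>\<omega>. cos (l \<omega> + c) \<partial>\<mu>) = cos c * exp (- (norm (dual_embed \<iota> l))\<^sup>2 / 2)" for l :: "'w \<Rightarrow>\<^sub>L real"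
proof -
  define \<sigma> where "\<sigma> = norm (dual_embed \<iota> l)"
  have std: "(\<integral>x. cos (t * x + c) \<partial>std_normal_distribution) = cos c * exp (- t\<^sup>2 / 2)" for t
  proof -
    interpret N: real_distribution std_normal_distribution by (rule real_dist_normal_dist)
    have iC: "integrable std_normal_distribution (\<lambda>x. cos (t * x))" "integrable std_normal_distribution (\<lambda>x. sin (t * x))"
      by (auto intro!: N.integrable_const_bound[of _ 1])
    have "char std_normal_distribution t = complex_of_real (\<integral>x. cos (t * x) \<partial>std_normal_distribution)
        + \<i> * complex_of_real (\<integral>x. sin (t * x) \<partial>std_normal_distribution)"
    proof -
      have "char std_normal_distribution t = (CLINT x|std_normal_distribution. complex_of_real (cos (t * x)) + \<i> * complex_of_real (sin (t * x)))"
        unfolding char_def by (intro Bochner_Integration.integral_cong) (auto simp: complex_eq_iff Re_exp Im_exp)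
      also have "\<dots> = complex_of_real (\<integral>x. cos (t * x) \<partial>std_normal_distribution)
        + \<i> * complex_of_real (\<integral>x. sin (t * x) \<partial>std_normal_distribution)"
        by (subst Bochner_Integration.integral_add) (use iC in \<open>auto intro!: integrable_mult_right\<close>)
      finally show ?thesis .
    qed
    then have "(\<integral>x. cos (t * x) \<partial>std_normal_distribution) = exp (- t\<^sup>2 / 2)" "(\<integral>x. sin (t * x) \<partial>std_normal_distribution) = 0"
      unfolding char_std_normal_distribution by (auto simp: complex_eq_iff)
    then show ?thesis unfolding cos_add using iC by simp
  qed
  show ?thesis
  proof (cases "\<sigma> = 0")
    case True
    have "(\<integral>\<omega>. cos (l \<omega> + c) \<partial>\<mu>) = (\<integral>x. cos (x + c) \<partial>distr \<mu> borel l)" by (simp add: integral_distr)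
    also have "\<dots> = cos c" unfolding functional_law using True by (simp add: gaussian_law_def \<sigma>_def integral_return)
    finally show ?thesis using True by (simp add: \<sigma>_def)
  next
    case False
    have "dual_embed \<iota> (inverse \<sigma> *\<^sub>R l) = inverse \<sigma> *\<^sub>R dual_embed \<iota> l"
      by (rule ext_inner) (simp add: inner_dual_embed blinfun.scaleR_left)
    then have "norm (dual_embed \<iota> (inverse \<sigma> *\<^sub>R l)) = 1" using False by (simp add: \<sigma>_def)
    then have "distr \<mu> borel (inverse \<sigma> *\<^sub>R l) = std_normal_distribution"
      using functional_law[of "inverse \<sigma> *\<^sub>R l"] by (simp add: gaussian_law_def)
    then have std': "std_normal_distribution = distr \<mu> borel (inverse \<sigma> *\<^sub>R l)" ..
    have "(\<integral>x. cos (\<sigma> * x + c) \<partial>std_normal_distribution) = (\<integral>\<omega>. cos (\<sigma> * (inverse \<sigma> *\<^sub>R l) \<omega> + c) \<partial>\<mu>)"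
      unfolding std' by (rule integral_distr) measurable
    moreover have "\<sigma> * (inverse \<sigma> *\<^sub>R l) \<omega> = l \<omega>" for \<omega> using False by (simp add: blinfun.scaleR_left)
    ultimately show ?thesis unfolding std by (simp add: \<sigma>_def)
  qed
qed

end

section \<open>Gaussian integration by parts\<close>

text \<open>
  The standard normal density \<open>n\<close> satisfies \<open>n' x = - x * n x\<close>, so the difference of the two integrands is the derivative
  of \<open>\<phi> n\<close>, which vanishes at both ends.
\<close>

lemma gaussian_integration_by_parts:
  fixes \<phi> \<phi>' :: "real \<Rightarrow> real"
  assumes d: "\<And>x. (\<phi> has_real_derivative \<phi>' x) (at x)" and c: "continuous_on UNIV \<phi>'"
    and b: "\<And>x. \<bar>\<phi> x\<bar> \<le> C" "\<And>x. \<bar>\<phi>' x\<bar> \<le> C"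
  shows "(\<integral>x. \<phi> x * x \<partial>std_normal_distribution) = (\<integral>x. \<phi>' x \<partial>std_normal_distribution)"
proof -
  let ?n = std_normal_density
  have cphi: "continuous_on UNIV \<phi>" using d by (meson DERIV_isCont continuous_at_imp_continuous_on)
  have [measurable]: "\<phi> \<in> borel_measurable borel" "\<phi>' \<in> borel_measurable borel"
    using c cphi by (auto intro: borel_measurable_continuous_onI)
  have dn: "(?n has_real_derivative - x * ?n x) (at x)" for x
  proof -
    have "((\<lambda>x. k * exp (- x\<^sup>2 / 2)) has_real_derivative - x * (k * exp (- x\<^sup>2 / 2))) (at x)" for k :: real
      by (auto intro!: derivative_eq_intros)
    then show ?thesis unfolding std_normal_density_def[abs_def] .
  qed
  have cn: "continuous_on UNIV ?n" using dn by (meson DERIV_isCont continuous_at_imp_continuous_on)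
  have C0: "0 \<le> C" using b(1)[of 0] by simp
  have b1: "?n x * \<bar>\<phi>' x\<bar> \<le> C * ?n x" for x
    using mult_right_mono[OF b(2)[of x], of "?n x"] by (simp add: mult.commute)
  have b2: "?n x * (\<bar>\<phi> x\<bar> * \<bar>x\<bar>) \<le> C * (?n x * \<bar>x\<bar>)" for x
    using mult_right_mono[OF b(1)[of x], of "?n x * \<bar>x\<bar>"] by (simp add: mult_ac)
  have i1: "integrable lborel (\<lambda>x. ?n x * \<phi>' x)"
    by (rule Bochner_Integration.integrable_bound[OF integrable_mult_right[OF integrable_std_normal_moment[of 0], of C]])
      (simp, rule AE_I2, use b1 C0 in \<open>simp add: abs_mult mult.commute\<close>)
  have i2: "integrable lborel (\<lambda>x. ?n x * (\<phi> x * x))"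
    by (rule Bochner_Integration.integrable_bound[OF integrable_mult_right[OF integrable_std_normal_moment[of 1], of C]])
      (simp, rule AE_I2, use b2 C0 in \<open>simp add: abs_mult mult_ac\<close>)
  have lim: "((\<lambda>x. \<phi> x * ?n x) \<longlongrightarrow> 0) F" if n0: "(?n \<longlongrightarrow> 0) F" for F
  proof (rule Lim_null_comparison)
    show "((\<lambda>x. C * ?n x) \<longlongrightarrow> 0) F" using tendsto_mult_right_zero[OF n0] by simp
    show "eventually (\<lambda>x. norm (\<phi> x * ?n x) \<le> C * ?n x) F"
      using b by (auto simp: abs_mult intro!: always_eventually mult_right_mono)
  qed
  have n1: "(?n \<longlongrightarrow> 0) at_top" unfolding std_normal_density_def[abs_def] by real_asymp
  have n2: "(?n \<longlongrightarrow> 0) at_bot" unfolding std_normal_density_def[abs_def] by real_asymp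
  have "(LBINT x=-\<infinity>..\<infinity>. ?n x * \<phi>' x - ?n x * (\<phi> x * x)) = 0 - 0"
  proof (rule interval_integral_FTC_integrable[where F = "\<lambda>x. \<phi> x * ?n x"])
    show "((\<lambda>x. \<phi> x * ?n x) has_vector_derivative ?n x * \<phi>' x - ?n x * (\<phi> x * x)) (at x)" for x
      unfolding has_real_derivative_iff_has_vector_derivative[symmetric]
      using DERIV_mult[OF d[of x] dn[of x]] by (simp add: algebra_simps)
    show "isCont (\<lambda>x. ?n x * \<phi>' x - ?n x * (\<phi> x * x)) x" for x
      using c cn cphi by (intro continuous_intros) (auto simp: continuous_on_eq_continuous_at)
    show "set_integrable lborel (einterval (- \<infinity>) \<infinity>) (\<lambda>x. ?n x * \<phi>' x - ?n x * (\<phi> x * x))"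
      using i1 i2 by (simp add: set_integrable_def)
    show "(((\<lambda>x. \<phi> x * ?n x) \<circ> real_of_ereal) \<longlongrightarrow> 0) (at_right (- \<infinity>))"
      unfolding ereal_tendsto_simps by (rule lim[OF n2])
    show "(((\<lambda>x. \<phi> x * ?n x) \<circ> real_of_ereal) \<longlongrightarrow> 0) (at_left \<infinity>)"
      unfolding ereal_tendsto_simps by (rule lim[OF n1])
  qed simp
  then have "(\<integral>x. ?n x * \<phi>' x - ?n x * (\<phi> x * x) \<partial>lborel) = 0"
    by (simp add: interval_lebesgue_integral_def set_lebesgue_integral_def)
  then have "(\<integral>x. ?n x * \<phi>' x \<partial>lborel) = (\<integral>x. ?n x * (\<phi> x * x) \<partial>lborel)" using i1 i2 by simp
  then show ?thesis by (simp add: integral_density)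
qed

context wiener_basis begin

lemma dual_embed_add: "dual_embed \<iota> (l + m) = dual_embed \<iota> l + dual_embed \<iota> m"
  by (rule ext_inner) (simp add: inner_dual_embed blinfun.add_left inner_add_left)

lemma dual_embed_scaleR: "dual_embed \<iota> (r *\<^sub>R l) = r *\<^sub>R dual_embed \<iota> l"
  by (rule ext_inner) (simp add: inner_dual_embed blinfun.scaleR_left)

lemma functional_measurable [measurable]: "blinfun_apply (l :: 'w \<Rightarrow>\<^sub>L real) \<in> borel_measurable \<mu>"
  by (intro borel_measurable_continuous continuous_intros)

lemma law_unit_functional:
  assumes "dual_embed \<iota> l = e i"
  shows "distr \<mu> borel l = std_normal_distribution"
proof -
  have "norm (e i) = 1" by (simp add: norm_eq_1 inner_e)
  then show ?thesis unfolding functional_law assms by (simp add: gaussian_law_def)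
qed

text \<open>
  Subtracting from \<open>\<omega>\<close> its component in the direction \<open>e i\<close> leaves a variable independent of \<open>l\<close>. Both
  sides have the same characteristic functional, since the functionals of the residual have representers
  orthogonal to \<open>e i\<close>.
\<close>

lemma independent_residual:
  assumes l: "dual_embed \<iota> l = e i"
  defines "Y \<equiv> \<lambda>\<omega>. \<omega> - l \<omega> *\<^sub>R \<iota> (e i)"
  shows "distr \<mu> borel (\<lambda>\<omega>. (Y \<omega>, l \<omega>)) = distr \<mu> borel Y \<Otimes>\<^sub>M distr \<mu> borel l"
proof (rule finite_measure_eqI_char)
  have Yc: "continuous_on UNIV Y" unfolding Y_def by (intro continuous_intros)
  have Ym[measurable]: "Y \<in> borel_measurable \<mu>" by (rule borel_measurable_continuous[OF Yc])
  have YLm[measurable]: "(\<lambda>\<omega>. (Y \<omega>, l \<omega>)) \<in> borel_measurable \<mu>"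
    by (rule borel_measurable_continuous) (intro continuous_intros Yc)
  interpret DY: prob_space "distr \<mu> borel Y" by (rule prob_space_distr) measurable
  interpret DL: prob_space "distr \<mu> borel l" by (rule prob_space_distr) measurable
  interpret P: pair_prob_space "distr \<mu> borel Y" "distr \<mu> borel l" ..
  show "finite_measure (distr \<mu> borel (\<lambda>\<omega>. (Y \<omega>, l \<omega>)))" by (rule finite_measure_distr) (rule YLm)
  show "finite_measure (distr \<mu> borel Y \<Otimes>\<^sub>M distr \<mu> borel l)" by (rule P.P.finite_measure_axioms)
  show sP: "sets (distr \<mu> borel Y \<Otimes>\<^sub>M distr \<mu> borel l) = sets borel"
    unfolding borel_prod[symmetric] by (intro sets_pair_measure_cong) simp_all
  fix K :: "('w \<times> real) \<Rightarrow>\<^sub>L real" and c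
  define s where "s = K (0, 1)"
  have "bounded_linear (\<lambda>x. K (x, 0))"
    by (intro bounded_linear_compose[OF blinfun.bounded_linear_right] bounded_linear_Pair bounded_linear_ident bounded_linear_zero)
  from bounded_linear_Blinfun_apply[OF this]
  obtain k :: "'w \<Rightarrow>\<^sub>L real" where k: "\<And>x. k x = K (x, 0)" by metis
  have K: "K (x, r) = k x + s * r" for x r
  proof -
    have "(x, r) = (x, 0) + r *\<^sub>R (0, 1)" by simp
    then have "K (x, r) = K (x, 0) + r *\<^sub>R K (0, 1)" by (metis blinfun.add_right blinfun.scaleR_right)
    then show ?thesis by (simp add: k s_def)
  qed
  define a where "a = k (\<iota> (e i))"
  define k' where "k' = k + (- a) *\<^sub>R l"
  \<comment> \<open>functionals of the residual are functionals of \<open>\<omega>\<close> with representer orthogonal to \<open>e i\<close>\<close>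
  have k': "k (Y \<omega>) = k' \<omega>" for \<omega>
    by (simp add: Y_def k'_def a_def blinfun.diff_right blinfun.scaleR_right blinfun.diff_left blinfun.scaleR_left)
  have ka: "dual_embed \<iota> k \<bullet> e i = a" by (simp add: inner_dual_embed a_def)
  have dk': "dual_embed \<iota> k' = dual_embed \<iota> k + (- a) *\<^sub>R e i" unfolding k'_def dual_embed_add dual_embed_scaleR l ..
  have orth: "dual_embed \<iota> k' \<bullet> e i = 0" unfolding dk' by (simp add: inner_diff_left ka inner_e)
  have nrm: "(norm (dual_embed \<iota> (s *\<^sub>R l + k')))\<^sup>2 = s\<^sup>2 + (norm (dual_embed \<iota> k'))\<^sup>2"
    unfolding dual_embed_add dual_embed_scaleR l power2_norm_eq_inner
    by (simp add: inner_add_left inner_add_right orth inner_commute[of "e i"] inner_e power2_eq_square)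
  have sl: "(norm (dual_embed \<iota> (s *\<^sub>R l)))\<^sup>2 = s\<^sup>2"
    unfolding dual_embed_scaleR l power2_norm_eq_inner by (simp add: inner_e power2_eq_square)
  have "(\<integral>z. cos (K z + c) \<partial>distr \<mu> borel (\<lambda>\<omega>. (Y \<omega>, l \<omega>))) = (\<integral>\<omega>. cos ((s *\<^sub>R l + k') \<omega> + c) \<partial>\<mu>)"
    by (subst integral_distr) (auto simp: K k' blinfun.add_left blinfun.scaleR_left add_ac)
  also have "\<dots> = cos c * exp (- (s\<^sup>2 + (norm (dual_embed \<iota> k'))\<^sup>2) / 2)" unfolding functional_cos nrm ..
  also have "\<dots> = exp (- s\<^sup>2 / 2) * (cos c * exp (- (norm (dual_embed \<iota> k'))\<^sup>2 / 2))"
    by (simp add: exp_add[symmetric] add_divide_distrib mult.left_commute[of "exp _"])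
  also have "\<dots> = exp (- s\<^sup>2 / 2) * (\<integral>\<omega>. cos (k' \<omega> + c) \<partial>\<mu>)" unfolding functional_cos ..
  also have "\<dots> = exp (- s\<^sup>2 / 2) * (\<integral>y. cos (k y + c) \<partial>distr \<mu> borel Y)"
    by (subst integral_distr) (auto simp: k')
  also have "\<dots> = (\<integral>y. (\<integral>r. cos (K (y, r) + c) \<partial>distr \<mu> borel l) \<partial>distr \<mu> borel Y)"
  proof -
    have "(\<integral>r. cos (K (y, r) + c) \<partial>distr \<mu> borel l) = exp (- s\<^sup>2 / 2) * cos (k y + c)" for y
    proof -
      have "(\<integral>r. cos (K (y, r) + c) \<partial>distr \<mu> borel l) = (\<integral>r. cos (s * r + (k y + c)) \<partial>distr \<mu> borel l)"
        by (simp add: K add_ac)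
      also have "\<dots> = (\<integral>\<omega>. cos ((s *\<^sub>R l) \<omega> + (k y + c)) \<partial>\<mu>)"
        by (subst integral_distr) (auto simp: blinfun.scaleR_left)
      also have "\<dots> = cos (k y + c) * exp (- s\<^sup>2 / 2)" unfolding functional_cos sl ..
      finally show ?thesis by (simp add: mult.commute)
    qed
    then show ?thesis by simp
  qed
  also have "\<dots> = (\<integral>z. cos (K z + c) \<partial>(distr \<mu> borel Y \<Otimes>\<^sub>M distr \<mu> borel l))"
  proof (rule P.integral_fst')
    show "integrable (distr \<mu> borel Y \<Otimes>\<^sub>M distr \<mu> borel l) (\<lambda>z. cos (K z + c))"
      by (rule P.P.integrable_const_bound[of _ 1]) (auto simp: measurable_cong_sets[OF sP refl])
  qed
  finally show "(\<integral>z. cos (K z + c) \<partial>distr \<mu> borel (\<lambda>\<omega>. (Y \<omega>, l \<omega>))) =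
    (\<integral>z. cos (K z + c) \<partial>(distr \<mu> borel Y \<Otimes>\<^sub>M distr \<mu> borel l))" .
qed simp

lemma integrable_unit_functional:
  assumes l: "dual_embed \<iota> l = e i"
  shows "integrable \<mu> l"
proof -
  have "integrable std_normal_distribution (\<lambda>x. x)"
    using integrable_std_normal_moment[of 1] by (subst integrable_density) auto
  then have "integrable (distr \<mu> borel l) (\<lambda>x. x)" unfolding law_unit_functional[OF l] .
  then show ?thesis by (subst (asm) integrable_distr_eq) auto
qed

text \<open>
  Fubini for the independent pair: for a fixed residual, the claim is one-dimensional
  integration by parts along the line in the direction \<open>e i\<close>.
\<close>

lemma integration_by_parts:
  assumes l: "dual_embed \<iota> l = e i" and FG: "smooth_grad \<iota> F G"
  shows "(\<integral>\<omega>. F \<omega> * l \<omega> \<partial>\<mu>) = (\<integral>\<omega>. G \<omega> \<bullet> e i \<partial>\<mu>)"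
proof -
  define Y where "Y = (\<lambda>\<omega>. \<omega> - l \<omega> *\<^sub>R \<iota> (e i))"
  obtain C where C: "\<And>\<omega>. \<bar>F \<omega>\<bar> \<le> C" "\<And>\<omega>. norm (G \<omega>) \<le> C" using smooth_grad_bounded[OF FG] by blast
  note cont = smooth_grad_continuous[OF FG]
  note mFG[measurable] = smooth_grad_measurable[OF FG]
  have Yc: "continuous_on UNIV Y" unfolding Y_def by (intro continuous_intros)
  have Ym[measurable]: "Y \<in> borel_measurable \<mu>" by (rule borel_measurable_continuous[OF Yc])
  have YLm[measurable]: "(\<lambda>\<omega>. (Y \<omega>, l \<omega>)) \<in> borel_measurable \<mu>"
    by (rule borel_measurable_continuous) (intro continuous_intros Yc)
  interpret DY: prob_space "distr \<mu> borel Y" by (rule prob_space_distr) measurable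
  interpret DL: prob_space "distr \<mu> borel l" by (rule prob_space_distr) measurable
  interpret P: pair_prob_space "distr \<mu> borel Y" "distr \<mu> borel l" ..
  have ind: "distr \<mu> borel (\<lambda>\<omega>. (Y \<omega>, l \<omega>)) = distr \<mu> borel Y \<Otimes>\<^sub>M distr \<mu> borel l"
    unfolding Y_def by (rule independent_residual[OF l])
  define J where "J z = F (fst z + snd z *\<^sub>R \<iota> (e i)) * snd z" for z :: "'w \<times> real"
  define K where "K z = G (fst z + snd z *\<^sub>R \<iota> (e i)) \<bullet> e i" for z :: "'w \<times> real"
  have Jm: "J \<in> borel_measurable borel" unfolding J_def
    by (intro borel_measurable_continuous_onI continuous_intros continuous_on_compose2[OF cont(1)]) auto
  have Km: "K \<in> borel_measurable borel" unfolding K_def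
    by (intro borel_measurable_continuous_onI continuous_intros continuous_on_compose2[OF cont(2)]) auto
  have YJ: "J (Y \<omega>, l \<omega>) = F \<omega> * l \<omega>" "K (Y \<omega>, l \<omega>) = G \<omega> \<bullet> e i" for \<omega> by (simp_all add: J_def K_def Y_def)
  have "integrable \<mu> (\<lambda>\<omega>. F \<omega> * l \<omega>)"
    by (rule Bochner_Integration.integrable_bound[OF integrable_mult_right[OF integrable_unit_functional[OF l], of C]])
      (use C in \<open>auto simp: abs_mult intro!: mult_right_mono order_trans[OF C(1)]\<close>)
  then have iJ: "integrable (distr \<mu> borel Y \<Otimes>\<^sub>M distr \<mu> borel l) J"
    unfolding ind[symmetric] by (subst integrable_distr_eq[OF YLm Jm]) (simp add: YJ)
  have GC: "norm (G \<omega> \<bullet> h) \<le> C * norm h" for \<omega> h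
    using Cauchy_Schwarz_ineq2[of "G \<omega>" h] C(2)[of \<omega>] by (simp add: order_trans mult_right_mono)
  have "integrable \<mu> (\<lambda>\<omega>. G \<omega> \<bullet> e i)"
    by (rule integrable_const_bound[of _ "C * norm (e i)"]) (use GC in auto)
  then have iK: "integrable (distr \<mu> borel Y \<Otimes>\<^sub>M distr \<mu> borel l) K"
    unfolding ind[symmetric] by (subst integrable_distr_eq[OF YLm Km]) (simp add: YJ)
  have inner: "(\<integral>r. J (y, r) \<partial>distr \<mu> borel l) = (\<integral>r. K (y, r) \<partial>distr \<mu> borel l)" for y
    unfolding law_unit_functional[OF l] J_def K_def fst_conv snd_conv
  proof (rule gaussian_integration_by_parts)
    show "((\<lambda>r. F (y + r *\<^sub>R \<iota> (e i))) has_real_derivative G (y + r *\<^sub>R \<iota> (e i)) \<bullet> e i) (at r)" for r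
      by (rule smooth_grad_direction[OF FG])
    show "continuous_on UNIV (\<lambda>r. G (y + r *\<^sub>R \<iota> (e i)) \<bullet> e i)"
      by (intro continuous_intros continuous_on_compose2[OF cont(2)]) auto
    show "\<bar>F (y + r *\<^sub>R \<iota> (e i))\<bar> \<le> C" for r by (rule C)
    have "norm (e i) = 1" by (simp add: norm_eq_1 inner_e)
    then show "\<bar>G (y + r *\<^sub>R \<iota> (e i)) \<bullet> e i\<bar> \<le> C" for r using GC[of _ "e i"] by simp
  qed
  have "(\<integral>\<omega>. F \<omega> * l \<omega> \<partial>\<mu>) = (\<integral>z. J z \<partial>distr \<mu> borel (\<lambda>\<omega>. (Y \<omega>, l \<omega>)))"
    by (simp add: integral_distr[OF YLm Jm] YJ)
  also have "\<dots> = (\<integral>y. (\<integral>r. J (y, r) \<partial>distr \<mu> borel l) \<partial>distr \<mu> borel Y)"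
    unfolding ind by (rule P.integral_fst'[OF iJ, symmetric])
  also have "\<dots> = (\<integral>z. K z \<partial>distr \<mu> borel (\<lambda>\<omega>. (Y \<omega>, l \<omega>)))"
    unfolding inner ind by (rule P.integral_fst'[OF iK])
  also have "\<dots> = (\<integral>\<omega>. G \<omega> \<bullet> e i \<partial>\<mu>)" by (simp add: integral_distr[OF YLm Km] YJ)
  finally show ?thesis .
qed

lemma has_divergence_basis:
  assumes l: "dual_embed \<iota> l = e i"
  shows "has_divergence \<mu> \<iota> (\<lambda>_. e i) l"
  unfolding has_divergence_def
  using integration_by_parts[OF l] integrable_unit_functional[OF l]
  by (simp add: inner_commute[of "e i"])

text \<open>
  Test against \<open>cos (l + c)\<close>: the measures with the positive and the negative part of \<open>h\<close> as densities have the
  same characteristic functional.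
\<close>

lemma smooth_functionals_separate:
  assumes h: "integrable \<mu> h" and 0: "\<And>\<psi> G. smooth_grad \<iota> \<psi> G \<Longrightarrow> (\<integral>\<omega>. \<psi> \<omega> * h \<omega> \<partial>\<mu>) = 0"
  shows "AE \<omega> in \<mu>. h \<omega> = (0 :: real)"
proof -
  have [measurable]: "h \<in> borel_measurable \<mu>" using h by auto
  define pos where "pos \<omega> = max 0 (h \<omega>)" for \<omega>
  define neg where "neg \<omega> = max 0 (- h \<omega>)" for \<omega>
  have [measurable]: "pos \<in> borel_measurable \<mu>" "neg \<in> borel_measurable \<mu>" unfolding pos_def neg_def by measurable
  have nn [simp]: "0 \<le> pos \<omega>" "0 \<le> neg \<omega>" for \<omega> by (simp_all add: pos_def neg_def)
  have ip: "integrable \<mu> pos" "integrable \<mu> neg" unfolding pos_def neg_def using h by (auto intro!: integrable_max)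
  have fin: "finite_measure (density \<mu> (\<lambda>\<omega>. ennreal (g \<omega>)))" if "integrable \<mu> g" "\<And>\<omega>. 0 \<le> g \<omega>" for g :: "'w \<Rightarrow> real"
  proof (rule finite_measureI)
    have [measurable]: "g \<in> borel_measurable \<mu>" using that by auto
    have "emeasure (density \<mu> (\<lambda>\<omega>. ennreal (g \<omega>))) (space (density \<mu> (\<lambda>\<omega>. ennreal (g \<omega>)))) = (\<integral>\<^sup>+\<omega>. ennreal (g \<omega>) \<partial>\<mu>)"
      by (simp add: emeasure_density)
    also have "\<dots> < \<infinity>" using that by (subst nn_integral_eq_integral) auto
    finally show "emeasure (density \<mu> (\<lambda>\<omega>. ennreal (g \<omega>))) (space (density \<mu> (\<lambda>\<omega>. ennreal (g \<omega>)))) \<noteq> \<infinity>" by simp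
  qed
  have "density \<mu> (\<lambda>\<omega>. ennreal (pos \<omega>)) = density \<mu> (\<lambda>\<omega>. ennreal (neg \<omega>))"
  proof (rule finite_measure_eqI_char)
    fix l :: "'w \<Rightarrow>\<^sub>L real" and c
    have b: "integrable \<mu> (\<lambda>\<omega>. g \<omega> * cos (l \<omega> + c))" if "integrable \<mu> g" for g :: "'w \<Rightarrow> real"
      by (rule Bochner_Integration.integrable_bound[OF that]) (use that in \<open>auto simp: abs_mult mult_left_le\<close>)
    have "(\<integral>\<omega>. pos \<omega> * cos (l \<omega> + c) \<partial>\<mu>) - (\<integral>\<omega>. neg \<omega> * cos (l \<omega> + c) \<partial>\<mu>) = (\<integral>\<omega>. sin (l \<omega> + (c + pi/2)) * h \<omega> \<partial>\<mu>)"
      unfolding Bochner_Integration.integral_diff[OF b[OF ip(1)] b[OF ip(2)], symmetric]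
      by (intro Bochner_Integration.integral_cong) (auto simp: pos_def neg_def sin_add[of _ "pi/2"] max_def simp flip: add.assoc)
    also have "\<dots> = 0" by (rule 0[OF smooth_grad_sin_functional])
    finally show "(\<integral>\<omega>. cos (l \<omega> + c) \<partial>density \<mu> (\<lambda>\<omega>. ennreal (pos \<omega>))) = (\<integral>\<omega>. cos (l \<omega> + c) \<partial>density \<mu> (\<lambda>\<omega>. ennreal (neg \<omega>)))"
      by (simp add: integral_density)
  qed (use ip in \<open>auto simp: sets_\<mu> intro!: fin\<close>)
  then have "AE \<omega> in \<mu>. ennreal (pos \<omega>) = ennreal (neg \<omega>)"
    by (subst (asm) density_unique_iff) auto
  then show ?thesis by eventually_elim (auto simp: pos_def neg_def max_def split: if_splits)
qed

end

section \<open>Limits in the duality and uniqueness of the gradient\<close>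

lemma ennreal_tendsto_zeroI:
  assumes "\<And>r. 0 < r \<Longrightarrow> eventually (\<lambda>n. X n \<le> ennreal r) F"
  shows "(X \<longlongrightarrow> 0) F"
proof (rule order_tendstoI)
  fix a :: ennreal assume "0 < a"
  then obtain b where b: "0 < b" "b < a" using dense by blast
  then have "b < top" using less_le_trans by fastforce
  then have r: "b = ennreal (enn2real b)" "0 < enn2real b" using b(1) by (auto simp: enn2real_positive_iff)
  from assms[OF r(2)] show "eventually (\<lambda>n. X n < a) F"
    by eventually_elim (use b(2) r(1) in auto)
qed simp

text \<open>
  A substitute for Jensen's inequality that shows at once that convergence in \<open>L\<^sup>p\<close> implies convergence in \<open>L\<^sup>1\<close> on a probability space.
\<close>

lemma power_interpolation:
  fixes t r p :: real
  assumes "0 \<le> t" "0 < r" "1 \<le> p"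
  shows "t \<le> r + r powr (1 - p) * t powr p"
proof (cases "t \<le> r")
  case False
  then have "r powr (p - 1) \<le> t powr (p - 1)" using assms by (intro powr_mono2) auto
  then have "r powr (1 - p) * (t * r powr (p - 1)) \<le> r powr (1 - p) * (t * t powr (p - 1))"
    using assms by (intro mult_left_mono) auto
  moreover have "r powr (1 - p) * (t * r powr (p - 1)) = t"
    using assms by (simp add: mult.left_commute[of _ t] flip: powr_add)
  moreover have "t * t powr (p - 1) = t powr p"
    using False assms by (simp add: powr_mult_base)
  ultimately show ?thesis using assms by simp
next
  case True
  moreover have "0 \<le> r powr (1 - p) * t powr p" by simp
  ultimately show ?thesis by linarith
qed

lemma (in prob_space) Lp_null_L1:
  assumes X: "Lp_null M p X" and p: "1 \<le> p" and m[measurable]: "\<And>n. X n \<in> borel_measurable M"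
  shows "(\<lambda>n. \<integral>\<^sup>+\<omega>. ennreal \<bar>X n \<omega>\<bar> \<partial>M) \<longlonglongrightarrow> 0"
proof (rule ennreal_tendsto_zeroI)
  fix r :: real assume r: "0 < r"
  define c where "c = (r / 2) powr (1 - p)"
  have c: "0 < c" using r by (simp add: c_def)
  have "eventually (\<lambda>n. (\<integral>\<^sup>+\<omega>. ennreal (\<bar>X n \<omega>\<bar> powr p) \<partial>M) < ennreal (r / 2 / c)) sequentially"
    using X r c unfolding Lp_null_def by (intro order_tendstoD(2)) auto
  then show "eventually (\<lambda>n. (\<integral>\<^sup>+\<omega>. ennreal \<bar>X n \<omega>\<bar> \<partial>M) \<le> ennreal r) sequentially"
  proof eventually_elim
    case (elim n)
    have "(\<integral>\<^sup>+\<omega>. ennreal \<bar>X n \<omega>\<bar> \<partial>M) \<le> (\<integral>\<^sup>+\<omega>. ennreal (r / 2) + ennreal c * ennreal (\<bar>X n \<omega>\<bar> powr p) \<partial>M)"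
      using power_interpolation[of "\<bar>X n _\<bar>" "r / 2" p] r p c
      by (intro nn_integral_mono) (simp add: c_def[symmetric] flip: ennreal_mult ennreal_plus)
    also have "\<dots> = ennreal (r / 2) + ennreal c * (\<integral>\<^sup>+\<omega>. ennreal (\<bar>X n \<omega>\<bar> powr p) \<partial>M)"
      by (subst nn_integral_add) (auto simp: nn_integral_cmult emeasure_space_1)
    also have "\<dots> \<le> ennreal (r / 2) + ennreal c * ennreal (r / 2 / c)"
      using elim by (intro add_left_mono mult_left_mono) auto
    also have "\<dots> = ennreal r" using r c by (simp flip: ennreal_mult ennreal_plus)
    finally show ?case .
  qed
qed

lemma (in prob_space) Lp_conv_L1:
  fixes X :: "nat \<Rightarrow> 'a \<Rightarrow> 'b::{real_normed_vector, second_countable_topology}"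
  assumes "Lp_conv M p X Y" "1 \<le> p" and [measurable]: "\<And>n. X n \<in> borel_measurable M" "Y \<in> borel_measurable M"
  shows "(\<lambda>n. \<integral>\<^sup>+\<omega>. ennreal (norm (X n \<omega> - Y \<omega>)) \<partial>M) \<longlonglongrightarrow> 0"
  using Lp_null_L1[OF assms(1)[unfolded Lp_conv_def] assms(2)] by simp

lemma nn_L1_AE_subseq:
  fixes Z :: "nat \<Rightarrow> 'a \<Rightarrow> 'b::{banach, second_countable_topology}"
  assumes m[measurable]: "\<And>n. Z n \<in> borel_measurable M"
    and lim: "(\<lambda>n. \<integral>\<^sup>+\<omega>. ennreal (norm (Z n \<omega>)) \<partial>M) \<longlonglongrightarrow> 0"
  obtains r :: "nat \<Rightarrow> nat" where "strict_mono r" "AE \<omega> in M. (\<lambda>n. Z (r n) \<omega>) \<longlonglongrightarrow> 0"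
proof -
  obtain N where N: "\<And>n. n \<ge> N \<Longrightarrow> (\<integral>\<^sup>+\<omega>. ennreal (norm (Z n \<omega>)) \<partial>M) < 1"
    using order_tendstoD(2)[OF lim, of 1] by (auto simp: eventually_sequentially)
  have int: "integrable M (Z (n + N))" for n
    using N[of "n + N"] by (auto intro!: integrableI_bounded intro: order.strict_trans[OF _ ennreal_one_less_top])
  have "(\<lambda>n. \<integral>\<^sup>+\<omega>. ennreal (norm (Z (n + N) \<omega>)) \<partial>M) \<longlonglongrightarrow> 0" by (rule LIMSEQ_ignore_initial_segment[OF lim])
  then have "(\<lambda>n. ennreal (\<integral>\<omega>. norm (Z (n + N) \<omega>) \<partial>M)) \<longlonglongrightarrow> ennreal 0"
    using int by (subst (asm) nn_integral_eq_integral) (auto intro: integrable_norm)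
  then have "(\<lambda>n. \<integral>\<omega>. norm (Z (n + N) \<omega>) \<partial>M) \<longlonglongrightarrow> 0"
    by (rule tendsto_ennrealD) (auto intro!: always_eventually integral_nonneg)
  from tendsto_L1_AE_subseq[OF int this] obtain r where "strict_mono r" "AE \<omega> in M. (\<lambda>n. Z (r n + N) \<omega>) \<longlonglongrightarrow> 0" by blast
  then show thesis by (intro that[of "\<lambda>n. r n + N"]) (auto simp: strict_mono_def)
qed

lemma integrable_L1_limit:
  fixes X :: "nat \<Rightarrow> 'a \<Rightarrow> 'b::{banach, second_countable_topology}"
  assumes X: "\<And>n. integrable M (X n)" and [measurable]: "Y \<in> borel_measurable M"
    and lim: "(\<lambda>n. \<integral>\<^sup>+\<omega>. ennreal (norm (X n \<omega> - Y \<omega>)) \<partial>M) \<longlonglongrightarrow> 0"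
  shows "integrable M Y"
proof -
  have [measurable]: "X n \<in> borel_measurable M" for n using X by auto
  obtain n where n: "(\<integral>\<^sup>+\<omega>. ennreal (norm (X n \<omega> - Y \<omega>)) \<partial>M) < 1"
    using order_tendstoD(2)[OF lim, of 1] by (auto simp: eventually_sequentially)
  have "integrable M (\<lambda>\<omega>. X n \<omega> - Y \<omega>)"
    by (rule integrableI_bounded) (measurable, use order.strict_trans[OF n ennreal_one_less_top] in simp)
  from Bochner_Integration.integrable_diff[OF X[of n] this] show ?thesis by simp
qed

lemma nn_L1_integral_LIMSEQ_zero:
  fixes Z :: "nat \<Rightarrow> 'a \<Rightarrow> real"
  assumes [measurable]: "\<And>n. Z n \<in> borel_measurable M"
    and lim: "(\<lambda>n. \<integral>\<^sup>+\<omega>. ennreal \<bar>Z n \<omega>\<bar> \<partial>M) \<longlonglongrightarrow> 0"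
    and bd: "\<And>n \<omega>. \<bar>Y n \<omega>\<bar> \<le> C * \<bar>Z n \<omega>\<bar>" and C: "0 \<le> C"
  shows "(\<lambda>n. \<integral>\<omega>. Y n \<omega> \<partial>M) \<longlonglongrightarrow> (0 :: real)"
proof -
  have b: "ennreal (norm (\<integral>\<omega>. Y n \<omega> \<partial>M)) \<le> ennreal C * (\<integral>\<^sup>+\<omega>. ennreal \<bar>Z n \<omega>\<bar> \<partial>M)" for n
  proof (cases "integrable M (Y n)")
    case True
    then have "ennreal (norm (\<integral>\<omega>. Y n \<omega> \<partial>M)) \<le> (\<integral>\<^sup>+\<omega>. ennreal (norm (Y n \<omega>)) \<partial>M)"
      by (rule integral_norm_bound_ennreal)
    also have "\<dots> \<le> (\<integral>\<^sup>+\<omega>. ennreal C * ennreal \<bar>Z n \<omega>\<bar> \<partial>M)"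
      using bd C by (intro nn_integral_mono) (simp flip: ennreal_mult)
    also have "\<dots> = ennreal C * (\<integral>\<^sup>+\<omega>. ennreal \<bar>Z n \<omega>\<bar> \<partial>M)" by (rule nn_integral_cmult) measurable
    finally show ?thesis .
  qed (simp add: not_integrable_integral_eq)
  have "(\<lambda>n. ennreal C * (\<integral>\<^sup>+\<omega>. ennreal \<bar>Z n \<omega>\<bar> \<partial>M)) \<longlonglongrightarrow> ennreal C * 0"
    by (intro ennreal_tendsto_cmult lim) simp
  then have lim0: "(\<lambda>n. ennreal C * (\<integral>\<^sup>+\<omega>. ennreal \<bar>Z n \<omega>\<bar> \<partial>M)) \<longlonglongrightarrow> ennreal 0" by simp
  have "(\<lambda>n. ennreal (norm (\<integral>\<omega>. Y n \<omega> \<partial>M))) \<longlonglongrightarrow> ennreal 0"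
    by (rule tendsto_sandwich[OF always_eventually always_eventually tendsto_const lim0]) (simp, rule allI, rule b)
  from tendsto_ennrealD[OF this] have "(\<lambda>n. norm (\<integral>\<omega>. Y n \<omega> \<partial>M)) \<longlonglongrightarrow> 0" by simp
  then show ?thesis by (rule tendsto_norm_zero_cancel)
qed

context wiener_basis begin

text \<open>
  The duality of \<open>a\<close> and \<open>d\<close> is applied to \<open>sin (s F\<^sub>n + c) \<psi>\<close>. The sine keeps the test functionals
  bounded, so that integrability of \<open>d\<close> and almost sure convergence of \<open>F\<^sub>n\<close> suffice for the limit. The gradients enter only
  through the pairing \<open>(a, G\<^sub>n)\<close>, which is assumed to converge in \<open>L\<^sup>1\<close>.
\<close>

lemma truncated_duality:
  fixes f d ag :: "'w \<Rightarrow> real" and a :: "'w \<Rightarrow> 'h"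
  assumes div: "has_divergence \<mu> \<iota> a d" and sg: "\<And>n. smooth_grad \<iota> (F n) (G n)"
    and F: "AE \<omega> in \<mu>. (\<lambda>n. F n \<omega>) \<longlonglongrightarrow> f \<omega>" and f[measurable]: "f \<in> borel_measurable \<mu>"
    and ag: "integrable \<mu> ag" "(\<lambda>n. \<integral>\<^sup>+\<omega>. ennreal \<bar>a \<omega> \<bullet> G n \<omega> - ag \<omega>\<bar> \<partial>\<mu>) \<longlonglongrightarrow> 0"
    and \<psi>: "smooth_grad \<iota> \<psi> g"
  shows "(\<integral>\<omega>. \<psi> \<omega> * (s * cos (s * f \<omega> + c)) * ag \<omega> \<partial>\<mu>) + (\<integral>\<omega>. sin (s * f \<omega> + c) * (a \<omega> \<bullet> g \<omega>) \<partial>\<mu>)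
    = (\<integral>\<omega>. sin (s * f \<omega> + c) * \<psi> \<omega> * d \<omega> \<partial>\<mu>)"
proof -
  have ia: "integrable \<mu> a" and id: "integrable \<mu> d" using div unfolding has_divergence_def by auto
  note ma[measurable] = borel_measurable_integrable[OF ia] borel_measurable_integrable[OF id] borel_measurable_integrable[OF ag(1)]
  note mG[measurable] = smooth_grad_measurable[OF sg] smooth_grad_measurable[OF \<psi>]
  obtain C where C: "\<And>\<omega>. \<bar>\<psi> \<omega>\<bar> \<le> C" "\<And>\<omega>. norm (g \<omega>) \<le> C" using smooth_grad_bounded[OF \<psi>] by blast
  have inner_int: "integrable \<mu> (\<lambda>\<omega>. a \<omega> \<bullet> H \<omega>)" if [measurable]: "H \<in> borel_measurable \<mu>" and H: "\<And>\<omega>. norm (H \<omega>) \<le> D" for H D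
  proof (rule Bochner_Integration.integrable_bound[OF integrable_mult_right[OF integrable_norm[OF ia], of D]])
    show "AE \<omega> in \<mu>. norm (a \<omega> \<bullet> H \<omega>) \<le> norm (D * norm (a \<omega>))"
    proof (rule AE_I2)
      fix \<omega>
      have "\<bar>a \<omega> \<bullet> H \<omega>\<bar> \<le> norm (a \<omega>) * norm (H \<omega>)" by (rule Cauchy_Schwarz_ineq2)
      also have "\<dots> \<le> norm (a \<omega>) * D" using H by (intro mult_left_mono) auto
      finally show "norm (a \<omega> \<bullet> H \<omega>) \<le> norm (D * norm (a \<omega>))" by (simp add: mult.commute)
    qed
  qed simp
  have iag: "integrable \<mu> (\<lambda>\<omega>. a \<omega> \<bullet> g \<omega>)" by (rule inner_int[OF mG(4) C(2)])
  have iaG: "integrable \<mu> (\<lambda>\<omega>. a \<omega> \<bullet> G n \<omega>)" for n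
  proof -
    obtain D where D: "\<And>\<omega>. \<bar>F n \<omega>\<bar> \<le> D" "\<And>\<omega>. norm (G n \<omega>) \<le> D" using smooth_grad_bounded[OF sg[of n]] by blast
    show ?thesis by (rule inner_int[OF mG(2) D(2)])
  qed
  define cs where "cs n \<omega> = \<psi> \<omega> * (s * cos (s * F n \<omega> + c))" for n \<omega>
  have cs_m[measurable]: "cs n \<in> borel_measurable \<mu>" for n unfolding cs_def by measurable
  have C0: "0 \<le> C" using C(1)[of 0] by simp
  have cs_le: "\<bar>cs n \<omega>\<bar> \<le> C * \<bar>s\<bar>" for n \<omega>
    unfolding cs_def abs_mult using C(1)[of \<omega>] C0 by (intro mult_mono) (auto simp: mult_left_le)
  have cs_int: "integrable \<mu> (\<lambda>\<omega>. cs n \<omega> * u \<omega>)" if "integrable \<mu> u" for n u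
    by (rule Bochner_Integration.integrable_bound[OF integrable_mult_right[OF that, of "C * \<bar>s\<bar>"]])
      (use that C0 cs_le in \<open>auto simp: abs_mult intro!: mult_right_mono\<close>)
  have dual: "(\<integral>\<omega>. cs n \<omega> * ag \<omega> \<partial>\<mu>) + (\<integral>\<omega>. cs n \<omega> * (a \<omega> \<bullet> G n \<omega> - ag \<omega>) \<partial>\<mu>)
     + (\<integral>\<omega>. sin (s * F n \<omega> + c) * (a \<omega> \<bullet> g \<omega>) \<partial>\<mu>) = (\<integral>\<omega>. sin (s * F n \<omega> + c) * \<psi> \<omega> * d \<omega> \<partial>\<mu>)" for n
  proof -
    have i1: "integrable \<mu> (\<lambda>\<omega>. cs n \<omega> * (a \<omega> \<bullet> G n \<omega>))" by (rule cs_int[OF iaG])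
    have i2: "integrable \<mu> (\<lambda>\<omega>. sin (s * F n \<omega> + c) * (a \<omega> \<bullet> g \<omega>))"
      by (rule Bochner_Integration.integrable_bound[OF iag]) (auto simp: abs_mult mult_left_le_one_le)
    have "(\<integral>\<omega>. a \<omega> \<bullet> (\<psi> \<omega> *\<^sub>R ((s * cos (s * F n \<omega> + c)) *\<^sub>R G n \<omega>) + sin (s * F n \<omega> + c) *\<^sub>R g \<omega>) \<partial>\<mu>)
      = (\<integral>\<omega>. sin (s * F n \<omega> + c) * \<psi> \<omega> * d \<omega> \<partial>\<mu>)"
      using div smooth_grad_mult[OF smooth_grad_sin[OF sg] \<psi>] unfolding has_divergence_def by blast
    moreover have "a \<omega> \<bullet> (\<psi> \<omega> *\<^sub>R ((s * cos (s * F n \<omega> + c)) *\<^sub>R G n \<omega>) + sin (s * F n \<omega> + c) *\<^sub>R g \<omega>)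
      = cs n \<omega> * (a \<omega> \<bullet> G n \<omega>) + sin (s * F n \<omega> + c) * (a \<omega> \<bullet> g \<omega>)" for \<omega>
      by (simp add: inner_add_right cs_def mult.assoc)
    ultimately have "(\<integral>\<omega>. cs n \<omega> * (a \<omega> \<bullet> G n \<omega>) \<partial>\<mu>) + (\<integral>\<omega>. sin (s * F n \<omega> + c) * (a \<omega> \<bullet> g \<omega>) \<partial>\<mu>)
      = (\<integral>\<omega>. sin (s * F n \<omega> + c) * \<psi> \<omega> * d \<omega> \<partial>\<mu>)" using i1 i2 by simp
    moreover have "(\<integral>\<omega>. cs n \<omega> * (a \<omega> \<bullet> G n \<omega>) \<partial>\<mu>) = (\<integral>\<omega>. cs n \<omega> * ag \<omega> \<partial>\<mu>) + (\<integral>\<omega>. cs n \<omega> * (a \<omega> \<bullet> G n \<omega> - ag \<omega>) \<partial>\<mu>)"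
      unfolding right_diff_distrib using cs_int[OF ag(1), of n] i1 by simp
    ultimately show ?thesis by simp
  qed
  have A: "(\<lambda>n. \<integral>\<omega>. cs n \<omega> * ag \<omega> \<partial>\<mu>) \<longlonglongrightarrow> (\<integral>\<omega>. \<psi> \<omega> * (s * cos (s * f \<omega> + c)) * ag \<omega> \<partial>\<mu>)"
  proof (rule integral_dominated_convergence)
    show "integrable \<mu> (\<lambda>\<omega>. C * \<bar>s\<bar> * \<bar>ag \<omega>\<bar>)" using ag(1) by auto
    show "AE \<omega> in \<mu>. (\<lambda>n. cs n \<omega> * ag \<omega>) \<longlonglongrightarrow> \<psi> \<omega> * (s * cos (s * f \<omega> + c)) * ag \<omega>"
      using F unfolding cs_def by eventually_elim (intro tendsto_intros)
    show "AE \<omega> in \<mu>. norm (cs n \<omega> * ag \<omega>) \<le> C * \<bar>s\<bar> * \<bar>ag \<omega>\<bar>" for n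
      using cs_le by (auto simp: abs_mult intro!: mult_right_mono)
  qed measurable
  have B: "(\<lambda>n. \<integral>\<omega>. cs n \<omega> * (a \<omega> \<bullet> G n \<omega> - ag \<omega>) \<partial>\<mu>) \<longlonglongrightarrow> 0"
    by (rule nn_L1_integral_LIMSEQ_zero[OF _ ag(2), of _ "C * \<bar>s\<bar>"])
      (use cs_le C0 in \<open>auto simp: abs_mult intro!: mult_right_mono\<close>)
  have D: "(\<lambda>n. \<integral>\<omega>. sin (s * F n \<omega> + c) * (a \<omega> \<bullet> g \<omega>) \<partial>\<mu>) \<longlonglongrightarrow> (\<integral>\<omega>. sin (s * f \<omega> + c) * (a \<omega> \<bullet> g \<omega>) \<partial>\<mu>)"
  proof (rule integral_dominated_convergence)
    show "integrable \<mu> (\<lambda>\<omega>. \<bar>a \<omega> \<bullet> g \<omega>\<bar>)" using iag by auto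
    show "AE \<omega> in \<mu>. (\<lambda>n. sin (s * F n \<omega> + c) * (a \<omega> \<bullet> g \<omega>)) \<longlonglongrightarrow> sin (s * f \<omega> + c) * (a \<omega> \<bullet> g \<omega>)"
      using F by eventually_elim (intro tendsto_intros)
  qed (auto simp: abs_mult mult_left_le_one_le)
  have E: "(\<lambda>n. \<integral>\<omega>. sin (s * F n \<omega> + c) * \<psi> \<omega> * d \<omega> \<partial>\<mu>) \<longlonglongrightarrow> (\<integral>\<omega>. sin (s * f \<omega> + c) * \<psi> \<omega> * d \<omega> \<partial>\<mu>)"
  proof (rule integral_dominated_convergence)
    show "integrable \<mu> (\<lambda>\<omega>. C * \<bar>d \<omega>\<bar>)" using id by auto
    show "AE \<omega> in \<mu>. (\<lambda>n. sin (s * F n \<omega> + c) * \<psi> \<omega> * d \<omega>) \<longlonglongrightarrow> sin (s * f \<omega> + c) * \<psi> \<omega> * d \<omega>"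
      using F by eventually_elim (intro tendsto_intros)
    have "\<bar>sin r\<bar> * \<bar>\<psi> \<omega>\<bar> \<le> C" for r \<omega>
      using mult_mono[OF abs_sin_le_one[of r] C(1)[of \<omega>]] by simp
    then show "AE \<omega> in \<mu>. norm (sin (s * F n \<omega> + c) * \<psi> \<omega> * d \<omega>) \<le> C * \<bar>d \<omega>\<bar>" for n
      by (auto simp: abs_mult intro!: mult_right_mono)
  qed measurable
  show ?thesis
    using LIMSEQ_unique[OF _ E, of "(\<integral>\<omega>. \<psi> \<omega> * (s * cos (s * f \<omega> + c)) * ag \<omega> \<partial>\<mu>) + 0 + (\<integral>\<omega>. sin (s * f \<omega> + c) * (a \<omega> \<bullet> g \<omega>) \<partial>\<mu>)"]
      tendsto_add[OF tendsto_add[OF A B] D] unfolding dual by simp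
qed

lemma inner_L1:
  assumes "(\<lambda>n. \<integral>\<^sup>+\<omega>. ennreal (norm (G n \<omega> - H \<omega>)) \<partial>\<mu>) \<longlonglongrightarrow> 0"
  shows "(\<lambda>n. \<integral>\<^sup>+\<omega>. ennreal \<bar>e i \<bullet> G n \<omega> - e i \<bullet> H \<omega>\<bar> \<partial>\<mu>) \<longlonglongrightarrow> 0"
proof (rule tendsto_sandwich[OF _ _ tendsto_const assms])
  have "norm (e i) = 1" by (simp add: norm_eq_1 inner_e)
  then have "\<bar>e i \<bullet> x - e i \<bullet> y\<bar> \<le> norm (x - y)" for x y
    using Cauchy_Schwarz_ineq2[of "e i" "x - y"] by (simp add: inner_diff_right)
  then show "\<forall>\<^sub>F n in sequentially. (\<integral>\<^sup>+\<omega>. ennreal \<bar>e i \<bullet> G n \<omega> - e i \<bullet> H \<omega>\<bar> \<partial>\<mu>) \<le> (\<integral>\<^sup>+\<omega>. ennreal (norm (G n \<omega> - H \<omega>)) \<partial>\<mu>)"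
    by (intro always_eventually allI nn_integral_mono ennreal_leI)
qed simp

text \<open>
  Closability of the gradient. With the constant \<open>a = e i\<close>, whose divergence is the functional of \<open>e i\<close>, the truncated duality determines
  \<open>cos (f + c) (e i, H)\<close> from \<open>f\<close>. The phases \<open>c = 0\<close> and \<open>c = pi/2\<close> remove the cosine, as sine and
  cosine have no common zero.
\<close>

lemma gradient_unique:
  assumes f[measurable]: "f \<in> borel_measurable \<mu>"
    and 1: "\<And>n. smooth_grad \<iota> (F n) (G n)" "AE \<omega> in \<mu>. (\<lambda>n. F n \<omega>) \<longlonglongrightarrow> f \<omega>"
      "(\<lambda>n. \<integral>\<^sup>+\<omega>. ennreal (norm (G n \<omega> - H \<omega>)) \<partial>\<mu>) \<longlonglongrightarrow> 0" "integrable \<mu> H"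
    and 2: "\<And>n. smooth_grad \<iota> (F' n) (G' n)" "AE \<omega> in \<mu>. (\<lambda>n. F' n \<omega>) \<longlonglongrightarrow> f \<omega>"
      "(\<lambda>n. \<integral>\<^sup>+\<omega>. ennreal (norm (G' n \<omega> - H' \<omega>)) \<partial>\<mu>) \<longlonglongrightarrow> 0" "integrable \<mu> H'"
  shows "AE \<omega> in \<mu>. H \<omega> = H' \<omega>"
proof -
  have "AE \<omega> in \<mu>. H \<omega> \<bullet> e i = H' \<omega> \<bullet> e i" for i
  proof -
    obtain l :: "'w \<Rightarrow>\<^sub>L real" where l: "dual_embed \<iota> l = e i" using smooth_e[of i] by force
    note div = has_divergence_basis[OF l]
    define u where "u \<omega> = e i \<bullet> H \<omega> - e i \<bullet> H' \<omega>" for \<omega>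
    have iH: "integrable \<mu> (\<lambda>\<omega>. e i \<bullet> H \<omega>)" "integrable \<mu> (\<lambda>\<omega>. e i \<bullet> H' \<omega>)"
      using 1(4) 2(4) by (auto intro: integrable_inner_right)
    have ci: "integrable \<mu> (\<lambda>\<omega>. v \<omega> * cos (r \<omega>) * w \<omega>)" if w: "integrable \<mu> w" and v: "v \<in> borel_measurable \<mu>" "\<And>\<omega>. \<bar>v \<omega>\<bar> \<le> C"
      and [measurable]: "r \<in> borel_measurable \<mu>" for w v r :: "'w \<Rightarrow> real" and C
    proof (rule Bochner_Integration.integrable_bound[OF integrable_mult_right[OF integrable_abs[OF w], of C]])
      note [measurable] = v(1) borel_measurable_integrable[OF w]
      show "(\<lambda>\<omega>. v \<omega> * cos (r \<omega>) * w \<omega>) \<in> borel_measurable \<mu>" by measurable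
      have "\<bar>v \<omega>\<bar> * \<bar>cos (r \<omega>)\<bar> \<le> C" for \<omega> using mult_mono[OF v(2)[of \<omega>] abs_cos_le_one[of "r \<omega>"]] v(2)[of \<omega>] by simp
      then have "\<bar>v \<omega>\<bar> * \<bar>cos (r \<omega>)\<bar> * \<bar>w \<omega>\<bar> \<le> C * \<bar>w \<omega>\<bar>" for \<omega> by (intro mult_right_mono) auto
      moreover have "0 \<le> C" using v(2)[of 0] by simp
      ultimately show "AE \<omega> in \<mu>. norm (v \<omega> * cos (r \<omega>) * w \<omega>) \<le> norm (C * \<bar>w \<omega>\<bar>)" by (auto simp: abs_mult)
    qed
    have z: "AE \<omega> in \<mu>. cos (f \<omega> + c) * u \<omega> = 0" for c
    proof (rule smooth_functionals_separate)
      have iu: "integrable \<mu> u" unfolding u_def using iH by simp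
      show "integrable \<mu> (\<lambda>\<omega>. cos (f \<omega> + c) * u \<omega>)"
        using ci[OF iu, of "\<lambda>_. 1" 1 "\<lambda>\<omega>. f \<omega> + c"] by simp
      fix \<psi> g assume \<psi>: "smooth_grad \<iota> \<psi> g"
      obtain C where C: "\<And>\<omega>. \<bar>\<psi> \<omega>\<bar> \<le> C" "\<And>\<omega>. norm (g \<omega>) \<le> C" using smooth_grad_bounded[OF \<psi>] by blast
      have i: "integrable \<mu> (\<lambda>\<omega>. \<psi> \<omega> * cos (f \<omega> + c) * w \<omega>)" if "integrable \<mu> w" for w
        by (rule ci[OF that smooth_grad_measurable(1)[OF \<psi>] C(1)]) measurable
      have "(\<integral>\<omega>. \<psi> \<omega> * cos (f \<omega> + c) * (e i \<bullet> H \<omega>) \<partial>\<mu>) = (\<integral>\<omega>. \<psi> \<omega> * cos (f \<omega> + c) * (e i \<bullet> H' \<omega>) \<partial>\<mu>)"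
        using truncated_duality[OF div 1(1,2) f iH(1) inner_L1[OF 1(3)] \<psi>, of 1 c]
          truncated_duality[OF div 2(1,2) f iH(2) inner_L1[OF 2(3)] \<psi>, of 1 c] by simp
      then show "(\<integral>\<omega>. \<psi> \<omega> * (cos (f \<omega> + c) * u \<omega>) \<partial>\<mu>) = 0"
        unfolding u_def using i[OF iH(1)] i[OF iH(2)] by (simp add: right_diff_distrib mult.assoc)
    qed
    from z[of 0] z[of "pi / 2"] show ?thesis
    proof eventually_elim
      case (elim \<omega>)
      have "cos (f \<omega> + pi / 2) = - sin (f \<omega>)" by (simp add: cos_add)
      then have "cos (f \<omega>) * u \<omega> = 0" "sin (f \<omega>) * u \<omega> = 0" using elim by auto
      then have "u \<omega> = 0" using sin_zero_abs_cos_one by fastforce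
      then show ?case by (simp add: u_def inner_commute)
    qed
  qed
  then have "AE \<omega> in \<mu>. \<forall>i. H \<omega> \<bullet> e i = H' \<omega> \<bullet> e i" by (simp add: AE_all_countable)
  then show ?thesis by eventually_elim (rule eqI_inner_e, blast)
qed

end

section \<open>Continuity of pairings on the Sobolev space\<close>

text \<open>
  Subsets \<open>J\<close> play the role of points of a Cantor space; sets that agree below \<open>N\<close> form its basic open neighbourhoods.
\<close>

definition subseries :: "(nat \<Rightarrow> 'a \<Rightarrow> real) \<Rightarrow> nat set \<Rightarrow> 'a \<Rightarrow> real" where
  "subseries v J \<omega> = (\<Sum>n. if n \<in> J then v n \<omega> else 0)"

definition agree_below :: "nat \<Rightarrow> nat set \<Rightarrow> nat set \<Rightarrow> bool" where
  "agree_below N J J' \<longleftrightarrow> (\<forall>n<N. n \<in> J \<longleftrightarrow> n \<in> J')"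

lemma summable_subseries:
  "summable (\<lambda>n. \<bar>v n \<omega>\<bar>) \<Longrightarrow> summable (\<lambda>n. if n \<in> J then v n \<omega> else (0::real))"
  by (rule summable_comparison_test'[where N = 0]) auto

lemma subseries_tail:
  assumes s: "summable (\<lambda>n. \<bar>v n \<omega>\<bar>)" and J: "agree_below N J J'"
  shows "\<bar>subseries v J \<omega> - subseries v J' \<omega>\<bar> \<le> 2 * (\<Sum>n. \<bar>v (n + N) \<omega>\<bar>)"
proof -
  have sN: "summable (\<lambda>n. \<bar>v (n + N) \<omega>\<bar>)" by (rule summable_ignore_initial_segment[OF s])
  have tail: "\<bar>\<Sum>n. if n + N \<in> J then v (n + N) \<omega> else 0\<bar> \<le> (\<Sum>n. \<bar>v (n + N) \<omega>\<bar>)" for J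
  proof -
    have "norm (\<Sum>n. if n + N \<in> J then v (n + N) \<omega> else 0) \<le> (\<Sum>n. \<bar>v (n + N) \<omega>\<bar>)"
      by (rule norm_suminf_le[OF _ sN]) simp
    then show ?thesis by simp
  qed
  have split: "subseries v J \<omega> = (\<Sum>n. if n + N \<in> J then v (n + N) \<omega> else 0) + (\<Sum>n<N. if n \<in> J then v n \<omega> else 0)" for J
    unfolding subseries_def by (rule suminf_split_initial_segment[OF summable_subseries[where v = v and \<omega> = \<omega>, OF s]])
  have eq: "(\<Sum>n<N. if n \<in> J then v n \<omega> else 0) = (\<Sum>n<N. if n \<in> J' then v n \<omega> else 0)"
    by (rule sum.cong) (use J in \<open>auto simp: agree_below_def\<close>)
  have "subseries v J \<omega> - subseries v J' \<omega> = (\<Sum>n. if n + N \<in> J then v (n + N) \<omega> else 0) - (\<Sum>n. if n + N \<in> J' then v (n + N) \<omega> else 0)"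
    unfolding split[of J] split[of J'] eq by simp
  then show ?thesis using tail[of J] tail[of J'] by linarith
qed

text \<open>
  A Baire category argument on the subsets of the natural numbers. By Fatou's lemma the integral of the subseries is a
  lower semicontinuous function of \<open>J\<close>. If it were unbounded near every set, successive refinements would lead to a set
  with an infinite integral. Hence it is bounded on the sets that agree with some \<open>J0\<close> below some \<open>N0\<close>;
  adding and removing an index \<open>n \<ge> N0\<close> bounds the integral of the single term \<open>v n\<close>.
\<close>

lemma bounded_subseries:
  fixes v :: "nat \<Rightarrow> 'a \<Rightarrow> real"
  assumes m[measurable]: "\<And>n. v n \<in> borel_measurable M"
    and s: "AE \<omega> in M. summable (\<lambda>n. \<bar>v n \<omega>\<bar>)"
    and fin: "\<And>J. (\<integral>\<^sup>+\<omega>. ennreal \<bar>subseries v J \<omega>\<bar> \<partial>M) < \<infinity>"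
  shows "\<exists>C::nat. \<exists>N. \<forall>n\<ge>N. (\<integral>\<^sup>+\<omega>. ennreal \<bar>v n \<omega>\<bar> \<partial>M) \<le> of_nat C"
proof -
  define q where "q J = (\<integral>\<^sup>+\<omega>. ennreal \<bar>subseries v J \<omega>\<bar> \<partial>M)" for J
  have sm[measurable]: "subseries v J \<in> borel_measurable M" for J
    unfolding subseries_def[abs_def] by measurable
  have lsc: "\<exists>N. \<forall>J'. agree_below N J' J \<longrightarrow> of_nat k < q J'" if k: "of_nat k < q J" for J and k :: nat
  proof (rule ccontr)
    assume "\<not> ?thesis"
    then have "\<forall>N. \<exists>J'. agree_below N J' J \<and> q J' \<le> of_nat k" by (auto simp: not_less)
    from choice[OF this] obtain J' where J': "\<And>N. agree_below N (J' N) J" "\<And>N. q (J' N) \<le> of_nat k" by auto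
    have "AE \<omega> in M. ennreal \<bar>subseries v J \<omega>\<bar> = liminf (\<lambda>N. ennreal \<bar>subseries v (J' N) \<omega>\<bar>)"
      using s
    proof eventually_elim
      case (elim \<omega>)
      have "(\<lambda>N. 2 * (\<Sum>n. \<bar>v (n + N) \<omega>\<bar>)) \<longlonglongrightarrow> 2 * 0" by (intro tendsto_mult tendsto_const suminf_exist_split2[OF elim])
      then have "(\<lambda>N. 2 * (\<Sum>n. \<bar>v (n + N) \<omega>\<bar>)) \<longlonglongrightarrow> 0" by simp
      from Lim_null_comparison[OF _ this, of "\<lambda>N. subseries v (J' N) \<omega> - subseries v J \<omega>"]
      have "(\<lambda>N. subseries v (J' N) \<omega> - subseries v J \<omega>) \<longlonglongrightarrow> 0"
        using subseries_tail[where v = v and \<omega> = \<omega>, OF elim J'(1)] by simp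
      then have "(\<lambda>N. subseries v (J' N) \<omega>) \<longlonglongrightarrow> subseries v J \<omega>" by (rule LIM_zero_cancel)
      then have "(\<lambda>N. ennreal \<bar>subseries v (J' N) \<omega>\<bar>) \<longlonglongrightarrow> ennreal \<bar>subseries v J \<omega>\<bar>"
        by (intro tendsto_ennrealI tendsto_rabs)
      from lim_imp_Liminf[OF _ this] show ?case by simp
    qed
    then have "q J = (\<integral>\<^sup>+\<omega>. liminf (\<lambda>N. ennreal \<bar>subseries v (J' N) \<omega>\<bar>) \<partial>M)" unfolding q_def by (rule nn_integral_cong_AE)
    also have "\<dots> \<le> liminf (\<lambda>N. q (J' N))" unfolding q_def by (rule nn_integral_liminf) measurable
    also have "\<dots> \<le> liminf (\<lambda>N. of_nat k)" by (rule Liminf_mono) (simp add: J'(2))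
    also have "\<dots> = of_nat k" by (simp add: Liminf_const)
    finally show False using k by simp
  qed
  have "\<exists>J0 N0. \<exists>k::nat. \<forall>J. agree_below N0 J J0 \<longrightarrow> q J \<le> of_nat k"
  proof (rule ccontr)
    assume neg: "\<not> ?thesis"
    have step: "\<exists>J' N'. agree_below N J' J \<and> Suc N \<le> N' \<and> (\<forall>J''. agree_below N' J'' J' \<longrightarrow> of_nat k < q J'')" for k J N
    proof -
      from neg obtain J' where J': "agree_below N J' J" "of_nat k < q J'"
        unfolding not_ex not_all not_imp not_le by blast
      from lsc[OF J'(2)] obtain N' where N': "\<forall>J''. agree_below N' J'' J' \<longrightarrow> of_nat k < q J''" by blast
      have "\<forall>J''. agree_below (max N' (Suc N)) J'' J' \<longrightarrow> of_nat k < q J''"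
        using N' by (auto simp: agree_below_def)
      then show ?thesis using J'(1) by (intro exI[of _ J'] exI[of _ "max N' (Suc N)"]) simp
    qed
    \<comment> \<open>the state is a set with the length of the prefix that is frozen from now on\<close>
    define st where "st = rec_nat ({} :: nat set, 0 :: nat) (\<lambda>k p. SOME p'. agree_below (snd p) (fst p') (fst p) \<and>
        Suc (snd p) \<le> snd p' \<and> (\<forall>J''. agree_below (snd p') J'' (fst p') \<longrightarrow> of_nat k < q J''))"
    have st: "agree_below (snd (st k)) (fst (st (Suc k))) (fst (st k)) \<and>
        Suc (snd (st k)) \<le> snd (st (Suc k)) \<and> (\<forall>J''. agree_below (snd (st (Suc k))) J'' (fst (st (Suc k))) \<longrightarrow> of_nat k < q J'')" for k
    proof -
      have e: "st (Suc k) = (SOME p'. agree_below (snd (st k)) (fst p') (fst (st k)) \<and>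
        Suc (snd (st k)) \<le> snd p' \<and> (\<forall>J''. agree_below (snd p') J'' (fst p') \<longrightarrow> of_nat k < q J''))" by (simp add: st_def)
      show ?thesis unfolding e by (rule someI_ex) (use step[of "snd (st k)" "fst (st k)" k] in auto)
    qed
    have mono: "snd (st k) + i \<le> snd (st (k + i))" for k i
    proof (induction i)
      case (Suc i)
      then show ?case using st[of "k + i"] by simp
    qed simp
    have ge: "k \<le> snd (st k)" for k using mono[of 0 k] by simp
    have coh: "agree_below (snd (st k)) (fst (st (k + i))) (fst (st k))" for k i
    proof (induction i)
      case (Suc i)
      have "snd (st k) \<le> snd (st (k + i))" using mono[of k i] by simp
      then have "agree_below (snd (st k)) (fst (st (Suc (k + i)))) (fst (st (k + i)))"
        using st[of "k + i"] unfolding agree_below_def by (meson order_less_le_trans)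
      then show ?case using Suc unfolding agree_below_def by simp
    qed (simp add: agree_below_def)
    define J where "J = {n. n \<in> fst (st (Suc n))}"
    have J: "agree_below (snd (st k)) J (fst (st k))" for k
      unfolding agree_below_def
    proof (intro allI impI)
      fix n assume n: "n < snd (st k)"
      have n': "n < snd (st (Suc n))" using ge[of "Suc n"] by simp
      show "n \<in> J \<longleftrightarrow> n \<in> fst (st k)"
      proof (cases "k \<le> Suc n")
        case True
        then show ?thesis using coh[of k "Suc n - k"] n unfolding agree_below_def J_def by simp
      next
        case False
        then show ?thesis using coh[of "Suc n" "k - Suc n"] n' unfolding agree_below_def J_def by simp
      qed
    qed
    have big: "of_nat k < q J" for k using st[of k] J[of "Suc k"] by blast
    have "q J < top" using fin[of J] by (simp add: q_def)
    then obtain k :: nat where "q J < of_nat k" using ennreal_Ex_less_of_nat by blast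
    then show False using big[of k] by simp
  qed
  then obtain J0 N0 and k :: nat where k: "\<And>J. agree_below N0 J J0 \<Longrightarrow> q J \<le> of_nat k" by blast
  have "(\<integral>\<^sup>+\<omega>. ennreal \<bar>v n \<omega>\<bar> \<partial>M) \<le> of_nat (k + k)" if n: "N0 \<le> n" for n
  proof -
    let ?A = "insert n J0" and ?B = "J0 - {n}"
    have ab: "agree_below N0 ?A J0" "agree_below N0 ?B J0" using n by (auto simp: agree_below_def)
    have "AE \<omega> in M. ennreal \<bar>v n \<omega>\<bar> \<le> ennreal \<bar>subseries v ?A \<omega>\<bar> + ennreal \<bar>subseries v ?B \<omega>\<bar>"
      using s
    proof eventually_elim
      case (elim \<omega>)
      have "subseries v ?A \<omega> - subseries v ?B \<omega> = (\<Sum>i. (if i \<in> ?A then v i \<omega> else 0) - (if i \<in> ?B then v i \<omega> else 0))"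
        unfolding subseries_def by (rule suminf_diff) (rule summable_subseries[where v = v and \<omega> = \<omega>, OF elim])+
      also have "\<dots> = (\<Sum>i. if i = n then v n \<omega> else 0)" by (intro arg_cong[where f = suminf] ext) auto
      also have "\<dots> = v n \<omega>" using suminf_finite[of "{n}" "\<lambda>i. if i = n then v n \<omega> else 0"] by simp
      finally have "\<bar>v n \<omega>\<bar> \<le> \<bar>subseries v ?A \<omega>\<bar> + \<bar>subseries v ?B \<omega>\<bar>" by linarith
      then show ?case by (simp flip: ennreal_plus)
    qed
    then have "(\<integral>\<^sup>+\<omega>. ennreal \<bar>v n \<omega>\<bar> \<partial>M) \<le> (\<integral>\<^sup>+\<omega>. ennreal \<bar>subseries v ?A \<omega>\<bar> + ennreal \<bar>subseries v ?B \<omega>\<bar> \<partial>M)"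
      by (rule nn_integral_mono_AE)
    also have "\<dots> = q ?A + q ?B" unfolding q_def by (rule nn_integral_add) measurable
    also have "\<dots> \<le> of_nat k + of_nat k" using k[OF ab(1)] k[OF ab(2)] by (rule add_mono)
    finally show ?thesis by simp
  qed
  then show ?thesis by blast
qed

lemma powr_add_le:
  fixes a b p :: real
  assumes "0 \<le> a" "0 \<le> b" "0 \<le> p"
  shows "(a + b) powr p \<le> 2 powr p * (a powr p + b powr p)"
proof -
  have "(a + b) powr p \<le> (2 * max a b) powr p" using assms by (intro powr_mono2) auto
  also have "\<dots> = 2 powr p * max a b powr p" using assms by (simp add: powr_mult)
  also have "max a b powr p \<le> a powr p + b powr p" by (auto simp: max_def)
  finally show ?thesis by simp
qed

lemma smooth_grad_H_zero: "smooth_grad_H \<iota> (\<lambda>_. 0) (\<lambda>_. 0)"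
  unfolding smooth_grad_H_def by (intro exI[of _ 0]) auto

lemma smooth_grad_H_const: "smooth_grad_H \<iota> (\<lambda>_. h) (\<lambda>_. 0)"
  unfolding smooth_grad_H_def
proof (intro exI conjI)
  show "\<forall>j<1. smooth_grad \<iota> ((\<lambda>_ _. 1) j) ((\<lambda>_ _. 0) j)" by (simp add: smooth_grad_const)
  show "(\<lambda>_. h) = (\<lambda>\<omega>. \<Sum>j<(1::nat). (\<lambda>_ _. 1) j \<omega> *\<^sub>R (\<lambda>_. h) j)" by simp
  show "(\<lambda>_. 0) = (\<lambda>\<omega>. \<Sum>j<1. blinfun_scaleR_left ((\<lambda>_. h) j) o\<^sub>L blinfun_inner_right ((\<lambda>_ _. 0) j \<omega>))"
    by (intro ext blinfun_eqI) (simp add: blinfun.sum_left)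
qed

lemma smooth_grad_H_scale:
  assumes "smooth_grad_H \<iota> u K"
  shows "smooth_grad_H \<iota> (\<lambda>\<omega>. c *\<^sub>R u \<omega>) (\<lambda>\<omega>. c *\<^sub>R K \<omega>)"
proof -
  obtain m F G h where *: "\<forall>j<m::nat. smooth_grad \<iota> (F j) (G j)" "u = (\<lambda>\<omega>. \<Sum>j<m. F j \<omega> *\<^sub>R h j)"
    "K = (\<lambda>\<omega>. \<Sum>j<m. blinfun_scaleR_left (h j) o\<^sub>L blinfun_inner_right (G j \<omega>))"
    using assms unfolding smooth_grad_H_def by blast
  show ?thesis unfolding smooth_grad_H_def
    by (intro exI[of _ m] exI[of _ F] exI[of _ G] exI[of _ "\<lambda>j. c *\<^sub>R h j"] conjI ext blinfun_eqI)
      (simp_all add: * scaleR_sum_right mult.commute blinfun.scaleR_left blinfun.sum_left)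
qed

lemma smooth_grad_H_add:
  assumes "smooth_grad_H \<iota> u K" "smooth_grad_H \<iota> v L"
  shows "smooth_grad_H \<iota> (\<lambda>\<omega>. u \<omega> + v \<omega>) (\<lambda>\<omega>. K \<omega> + L \<omega>)"
proof -
  obtain m F G h where 1: "\<forall>j<m::nat. smooth_grad \<iota> (F j) (G j)" "u = (\<lambda>\<omega>. \<Sum>j<m. F j \<omega> *\<^sub>R h j)"
    "K = (\<lambda>\<omega>. \<Sum>j<m. blinfun_scaleR_left (h j) o\<^sub>L blinfun_inner_right (G j \<omega>))"
    using assms(1) unfolding smooth_grad_H_def by blast
  obtain m' F' G' h' where 2: "\<forall>j<m'::nat. smooth_grad \<iota> (F' j) (G' j)" "v = (\<lambda>\<omega>. \<Sum>j<m'. F' j \<omega> *\<^sub>R h' j)"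
    "L = (\<lambda>\<omega>. \<Sum>j<m'. blinfun_scaleR_left (h' j) o\<^sub>L blinfun_inner_right (G' j \<omega>))"
    using assms(2) unfolding smooth_grad_H_def by blast
  let ?c = "\<lambda>f f' j. if j < m then f j else f' (j - m)"
  show ?thesis unfolding smooth_grad_H_def
  proof (intro exI[of _ "m + m'"] exI[of _ "?c F F'"] exI[of _ "?c G G'"] exI[of _ "?c h h'"] conjI allI impI)
    show "smooth_grad \<iota> (?c F F' j) (?c G G' j)" if "j < m + m'" for j
      using 1(1) 2(1) that by (cases "j < m") auto
    show "(\<lambda>\<omega>. u \<omega> + v \<omega>) = (\<lambda>\<omega>. \<Sum>j<m + m'. ?c F F' j \<omega> *\<^sub>R ?c h h' j)"
      unfolding sum_lessThan_add 1(2) 2(2) by (intro ext arg_cong2[where f = "(+)"] sum.cong) auto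
    show "(\<lambda>\<omega>. K \<omega> + L \<omega>) = (\<lambda>\<omega>. \<Sum>j<m + m'. blinfun_scaleR_left (?c h h' j) o\<^sub>L blinfun_inner_right (?c G G' j \<omega>))"
      unfolding sum_lessThan_add 1(3) 2(3) by (intro ext arg_cong2[where f = "(+)"] sum.cong) auto
  qed
qed

lemma smooth_grad_H_diff:
  assumes "smooth_grad_H \<iota> u K" "smooth_grad_H \<iota> v L"
  shows "smooth_grad_H \<iota> (\<lambda>\<omega>. u \<omega> - v \<omega>) (\<lambda>\<omega>. K \<omega> - L \<omega>)"
  using smooth_grad_H_add[OF assms(1) smooth_grad_H_scale[OF assms(2), of "-1"]] by simp

lemma smooth_grad_H_sum:
  "(\<And>i. i < n \<Longrightarrow> smooth_grad_H \<iota> (u i) (K i)) \<Longrightarrow> smooth_grad_H \<iota> (\<lambda>\<omega>. \<Sum>i<n. u i \<omega>) (\<lambda>\<omega>. \<Sum>i<(n::nat). K i \<omega>)"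
  by (induction n) (simp_all add: smooth_grad_H_zero smooth_grad_H_add)

lemma smooth_grad_H_hs: "smooth_grad_H \<iota> u K \<Longrightarrow> hilbert_schmidt (K \<omega>)"
  unfolding smooth_grad_H_def using hs_sum hs_rank_one by (metis (no_types, lifting) finite_lessThan)

context wiener_basis begin

lemma smooth_grad_H_measurable:
  assumes "smooth_grad_H \<iota> u K"
  shows "u \<in> borel_measurable \<mu>" "(\<lambda>\<omega>. K \<omega> x) \<in> borel_measurable \<mu>"
proof -
  obtain m F G h where *: "\<forall>j<m::nat. smooth_grad \<iota> (F j) (G j)" "u = (\<lambda>\<omega>. \<Sum>j<m. F j \<omega> *\<^sub>R h j)"
    "K = (\<lambda>\<omega>. \<Sum>j<m. blinfun_scaleR_left (h j) o\<^sub>L blinfun_inner_right (G j \<omega>))"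
    using assms unfolding smooth_grad_H_def by blast
  have FG: "F j \<in> borel_measurable \<mu>" "G j \<in> borel_measurable \<mu>" if "j < m" for j
    using *(1) that smooth_grad_measurable by auto
  show "u \<in> borel_measurable \<mu>" unfolding *(2)
    by (intro borel_measurable_sum borel_measurable_scaleR borel_measurable_const FG) auto
  show "(\<lambda>\<omega>. K \<omega> x) \<in> borel_measurable \<mu>" unfolding *(3) blinfun.sum_left blinfun_apply_blinfun_compose
    by (simp, intro borel_measurable_sum borel_measurable_scaleR borel_measurable_const borel_measurable_inner FG) auto
qed

end

lemma geometric_tail:
  fixes y :: "nat \<Rightarrow> 'b::banach"
  assumes y: "\<And>i. norm (y i) \<le> r * (1/2) ^ i"
  shows "summable (\<lambda>i. norm (y i))" "norm ((\<Sum>i<n. y i) - suminf y) \<le> 2 * r * (1/2) ^ n"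
proof -
  have g: "summable (\<lambda>i. r * (1/2) ^ i)" by (intro summable_mult summable_geometric) simp
  show s: "summable (\<lambda>i. norm (y i))" by (rule summable_comparison_test'[OF g]) (simp add: y)
  have gn: "(\<lambda>i. r * (1/2) ^ (i + n)) sums (r * (1/2) ^ n * 2)"
    using sums_mult[OF geometric_sums[of "1/2 :: real"], of "r * (1/2) ^ n"] by (simp add: power_add mult_ac)
  have "norm (\<Sum>i. y (i + n)) \<le> (\<Sum>i. r * (1/2) ^ (i + n))"
    by (rule norm_suminf_le[OF y sums_summable[OF gn]])
  also have "\<dots> = 2 * r * (1/2) ^ n" using sums_unique[OF gn] by simp
  finally have "norm (\<Sum>i. y (i + n)) \<le> 2 * r * (1/2) ^ n" .
  moreover have "suminf y = (\<Sum>i. y (i + n)) + (\<Sum>i<n. y i)"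
    by (rule suminf_split_initial_segment[OF summable_norm_cancel[OF s]])
  ultimately show "norm ((\<Sum>i<n. y i) - suminf y) \<le> 2 * r * (1/2) ^ n" by simp
qed

lemma hs_geometric_tail:
  fixes K :: "nat \<Rightarrow> 'h::{real_inner, banach} \<Rightarrow>\<^sub>L 'h"
  assumes hs: "\<And>i. hilbert_schmidt (K i)" and le: "\<And>i. hs_norm (K i) \<le> r * (1/2) ^ i"
  shows "hilbert_schmidt (suminf K)" "hs_norm ((\<Sum>i<n. K i) - suminf K) \<le> 2 * r * (1/2) ^ n"
proof -
  have nK: "norm (K i) \<le> r * (1/2) ^ i" for i using norm_le_hs_norm[OF hs] le order_trans by blast
  have sK: "K sums suminf K" by (rule summable_sums[OF summable_norm_cancel[OF geometric_tail(1)[OF nK]]])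
  have r: "0 \<le> r" using nK[of 0] norm_ge_zero[of "K 0"] by (simp del: norm_ge_zero)
  have part: "hilbert_schmidt ((\<Sum>i<n. K i) - suminf K) \<and> hs_norm ((\<Sum>i<n. K i) - suminf K) \<le> 2 * r * (1/2) ^ n" for n
  proof -
    define L where "L m = (\<Sum>i<n. K i) - (\<Sum>i<n + m. K i)" for m
    have L: "L m = (-1) *\<^sub>R (\<Sum>j<m. K (n + j))" for m by (simp add: L_def sum_lessThan_add)
    have hsL: "hilbert_schmidt (L m) \<and> hs_norm (L m) \<le> 2 * r * (1/2) ^ n" for m
    proof -
      have S: "hilbert_schmidt (\<Sum>j<m. K (n + j))" "hs_norm (\<Sum>j<m. K (n + j)) \<le> (\<Sum>j<m. hs_norm (K (n + j)))"
        using hs_sum[of "{..<m}" "\<lambda>j. K (n + j)"] hs by auto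
      have "(\<Sum>j<m. hs_norm (K (n + j))) \<le> (\<Sum>j<m. r * (1/2) ^ n * (1/2) ^ j)"
        by (intro sum_mono order_trans[OF le]) (simp add: power_add)
      also have "\<dots> = r * (1/2) ^ n * (\<Sum>j<m. (1/2) ^ j)" by (simp add: sum_distrib_left)
      also have "\<dots> \<le> r * (1/2) ^ n * 2"
      proof (intro mult_left_mono)
        have "(\<Sum>j<m. (1/2::real) ^ j) \<le> (\<Sum>j. (1/2) ^ j)" by (rule sum_le_suminf) (auto intro: summable_geometric)
        then show "(\<Sum>j<m. (1/2::real) ^ j) \<le> 2" by (simp add: suminf_geometric)
      qed (use r in simp)
      finally show ?thesis using hs_scaleR[OF S(1), of "-1"] S(2) unfolding L by simp
    qed
    have lim: "(\<lambda>m. L m x) \<longlonglongrightarrow> ((\<Sum>i<n. K i) - suminf K) x" for x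
    proof -
      have "(\<lambda>m. (\<Sum>i<m + n. K i)) \<longlonglongrightarrow> suminf K" using sK unfolding sums_def by (rule LIMSEQ_ignore_initial_segment)
      then have "L \<longlonglongrightarrow> (\<Sum>i<n. K i) - suminf K" unfolding L_def[abs_def] add.commute[of n] by (intro tendsto_diff tendsto_const)
      then show ?thesis by (intro tendsto_intros)
    qed
    show ?thesis using hs_norm_LIMSEQ_le[of L, OF lim] hsL by blast
  qed
  show "hs_norm ((\<Sum>i<n. K i) - suminf K) \<le> 2 * r * (1/2) ^ n" using part by blast
  have "hilbert_schmidt ((-1) *\<^sub>R ((\<Sum>i<0. K i) - suminf K))" using part hs_scaleR(1) by blast
  then show "hilbert_schmidt (suminf K)" by simp
qed

context wiener_basis begin

text \<open>
  The sum of a rapidly converging series of smooth variables is in the Sobolev space. The hypothesis bounds all terms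
  pointwise by \<open>r(\<omega>) / 2\<^sup>n\<close> with one random variable \<open>r\<close> in \<open>L\<^sup>p\<close>, off a null set on which the sum is defined to be 0.
\<close>

lemma sobolev_series:
  assumes sg: "\<And>n. smooth_grad_H \<iota> (u n) (K n)" and p: "1 \<le> p"
    and R: "(\<Sum>n. \<integral>\<^sup>+\<omega>. ennreal ((2 ^ n * (norm (u n \<omega>) + hs_norm (K n \<omega>))) powr p) \<partial>\<mu>) < \<infinity>"
  obtains w where "w \<in> sobolev_H_1 \<mu> \<iota> p"
    "AE \<omega> in \<mu>. (\<lambda>n. u n \<omega>) sums w \<omega> \<and> summable (\<lambda>n. norm (u n \<omega>))"
proof -
  note [measurable] = smooth_grad_H_measurable[OF sg]
  have hsK: "hilbert_schmidt (K n \<omega>)" for n \<omega> by (rule smooth_grad_H_hs[OF sg])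
  have [measurable]: "(\<lambda>\<omega>. hs_norm (K n \<omega>)) \<in> borel_measurable \<mu>" for n
    by (rule borel_measurable_hs_norm[OF smooth_grad_H_measurable(2)[OF sg] hsK])
  define x where "x n \<omega> = norm (u n \<omega>) + hs_norm (K n \<omega>)" for n \<omega>
  have [measurable]: "x n \<in> borel_measurable \<mu>" for n unfolding x_def by measurable
  have x0: "0 \<le> x n \<omega>" for n \<omega> unfolding x_def using hs_norm_nonneg[OF hsK] by simp
  define S where "S \<omega> = (\<Sum>n. ennreal ((2 ^ n * x n \<omega>) powr p))" for \<omega>
  have [measurable]: "S \<in> borel_measurable \<mu>" unfolding S_def by measurable
  have "(\<integral>\<^sup>+\<omega>. S \<omega> \<partial>\<mu>) = (\<Sum>n. \<integral>\<^sup>+\<omega>. ennreal ((2 ^ n * x n \<omega>) powr p) \<partial>\<mu>)"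
    unfolding S_def by (rule nn_integral_suminf) measurable
  then have Sfin: "(\<integral>\<^sup>+\<omega>. S \<omega> \<partial>\<mu>) < \<infinity>" using R by (simp add: x_def)
  \<comment> \<open>where \<open>S\<close> is finite, its root \<open>r\<close> of order \<open>p\<close> dominates all terms\<close>
  define good where "good = {\<omega>. S \<omega> < \<infinity>}"
  have "{\<omega> \<in> space \<mu>. S \<omega> < \<infinity>} \<in> sets \<mu>" by measurable
  then have [measurable]: "good \<in> sets \<mu>" unfolding good_def space_\<mu> by simp
  have "AE \<omega> in \<mu>. S \<omega> \<noteq> \<infinity>" by (rule nn_integral_PInf_AE) (measurable, use Sfin in simp)
  then have AEgood: "AE \<omega> in \<mu>. \<omega> \<in> good" by eventually_elim (simp add: good_def less_top)
  define r where "r \<omega> = enn2real (S \<omega>) powr (1 / p)" for \<omega>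
  have xr: "x n \<omega> \<le> r \<omega> * (1/2) ^ n" if "\<omega> \<in> good" for n \<omega>
  proof -
    have "sum (\<lambda>n. ennreal ((2 ^ n * x n \<omega>) powr p)) {n} \<le> S \<omega>"
      unfolding S_def by (rule sum_le_suminf) (rule summableI, rule finite.intros(2)[OF finite.intros(1)], rule zero_le)
    then have le: "ennreal ((2 ^ n * x n \<omega>) powr p) \<le> S \<omega>" by (simp only: sum.insert[OF finite.emptyI] empty_iff not_False_eq_True sum.empty add_0_right)
    have "S \<omega> < top" using that by (simp add: good_def)
    from enn2real_mono[OF le this] have "(2 ^ n * x n \<omega>) powr p \<le> enn2real (S \<omega>)"
      by (simp only: enn2real_ennreal powr_ge_zero)
    then have "((2 ^ n * x n \<omega>) powr p) powr (1 / p) \<le> r \<omega>" unfolding r_def using p by (intro powr_mono2) auto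
    then have "2 ^ n * x n \<omega> \<le> r \<omega>" using p x0[of n \<omega>] by (simp add: powr_powr)
    then show ?thesis by (simp add: field_simps)
  qed
  define w where "w \<omega> = (if \<omega> \<in> good then \<Sum>n. u n \<omega> else 0)" for \<omega>
  define Kw where "Kw \<omega> = (if \<omega> \<in> good then \<Sum>n. K n \<omega> else 0)" for \<omega>
  have ub: "norm (u n \<omega>) \<le> r \<omega> * (1/2) ^ n" if "\<omega> \<in> good" for n \<omega>
    using xr[OF that, of n] hs_norm_nonneg[OF hsK[of n \<omega>]] unfolding x_def by linarith
  have Kb: "hs_norm (K n \<omega>) \<le> r \<omega> * (1/2) ^ n" if "\<omega> \<in> good" for n \<omega>
    using xr[OF that, of n] norm_ge_zero[of "u n \<omega>"] unfolding x_def by linarith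
  have u_sums: "(\<lambda>n. u n \<omega>) sums w \<omega>" if "\<omega> \<in> good" for \<omega>
    using summable_sums[OF summable_norm_cancel[OF geometric_tail(1)[of "\<lambda>n. u n \<omega>", OF ub[OF that]]]] that by (simp add: w_def)
  have K_sums: "(\<lambda>n. K n \<omega>) sums Kw \<omega>" if "\<omega> \<in> good" for \<omega>
  proof -
    have "norm (K n \<omega>) \<le> r \<omega> * (1/2) ^ n" for n using norm_le_hs_norm[OF hsK] Kb[OF that] order_trans by blast
    from summable_sums[OF summable_norm_cancel[OF geometric_tail(1)[OF this]]] that show ?thesis by (simp add: Kw_def)
  qed
  have null: "Lp_null \<mu> p Z" if Z: "\<And>n \<omega>. \<omega> \<in> good \<Longrightarrow> \<bar>Z n \<omega>\<bar> \<le> 2 * r \<omega> * (1/2) ^ n" for Z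
    unfolding Lp_null_def
  proof (rule tendsto_sandwich[OF always_eventually always_eventually tendsto_const])
    show "\<forall>n. (\<integral>\<^sup>+\<omega>. ennreal (\<bar>Z n \<omega>\<bar> powr p) \<partial>\<mu>) \<le> ennreal (2 powr p * (1/2) ^ n) * (\<integral>\<^sup>+\<omega>. S \<omega> \<partial>\<mu>)"
    proof
      fix n
      have "AE \<omega> in \<mu>. ennreal (\<bar>Z n \<omega>\<bar> powr p) \<le> ennreal (2 powr p * (1/2) ^ n) * S \<omega>"
        using AEgood
      proof eventually_elim
        case (elim \<omega>)
        have r0: "0 \<le> r \<omega>" by (simp add: r_def)
        have "\<bar>Z n \<omega>\<bar> powr p \<le> (2 * r \<omega> * (1/2) ^ n) powr p" using Z[OF elim] p by (intro powr_mono2) auto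
        also have "\<dots> = 2 powr p * r \<omega> powr p * ((1/2) ^ n) powr p" using r0 by (simp add: powr_mult)
        also have "\<dots> \<le> 2 powr p * r \<omega> powr p * (1/2) ^ n"
          using powr_mono'[of 1 p "(1/2) ^ n :: real"] p by (intro mult_left_mono) (simp_all add: power_le_one)
        also have "\<dots> = 2 powr p * (1/2) ^ n * enn2real (S \<omega>)"
          unfolding r_def using p by (simp add: powr_powr)
        finally have "\<bar>Z n \<omega>\<bar> powr p \<le> 2 powr p * (1/2) ^ n * enn2real (S \<omega>)" .
        then have "ennreal (\<bar>Z n \<omega>\<bar> powr p) \<le> ennreal (2 powr p * (1/2) ^ n * enn2real (S \<omega>))" by (rule ennreal_leI)
        also have "\<dots> = ennreal (2 powr p * (1/2) ^ n) * S \<omega>"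
          using elim by (subst ennreal_mult) (auto simp: good_def)
        finally show ?case .
      qed
      then have "(\<integral>\<^sup>+\<omega>. ennreal (\<bar>Z n \<omega>\<bar> powr p) \<partial>\<mu>) \<le> (\<integral>\<^sup>+\<omega>. ennreal (2 powr p * (1/2) ^ n) * S \<omega> \<partial>\<mu>)" by (rule nn_integral_mono_AE)
      also have "\<dots> = ennreal (2 powr p * (1/2) ^ n) * (\<integral>\<^sup>+\<omega>. S \<omega> \<partial>\<mu>)" by (rule nn_integral_cmult) measurable
      finally show "(\<integral>\<^sup>+\<omega>. ennreal (\<bar>Z n \<omega>\<bar> powr p) \<partial>\<mu>) \<le> ennreal (2 powr p * (1/2) ^ n) * (\<integral>\<^sup>+\<omega>. S \<omega> \<partial>\<mu>)" .
    qed
    have "(\<lambda>n. 2 powr p * (1/2::real) ^ n) \<longlonglongrightarrow> 2 powr p * 0" by (intro tendsto_mult tendsto_const LIMSEQ_power_zero) simp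
    then have "(\<lambda>n. ennreal (2 powr p * (1/2) ^ n)) \<longlonglongrightarrow> ennreal 0" by (intro tendsto_ennrealI) simp
    then have "(\<lambda>n. (\<integral>\<^sup>+\<omega>. S \<omega> \<partial>\<mu>) * ennreal (2 powr p * (1/2) ^ n)) \<longlonglongrightarrow> (\<integral>\<^sup>+\<omega>. S \<omega> \<partial>\<mu>) * ennreal 0"
      using Sfin by (intro ennreal_tendsto_cmult) simp_all
    then show "(\<lambda>n. ennreal (2 powr p * (1/2) ^ n) * (\<integral>\<^sup>+\<omega>. S \<omega> \<partial>\<mu>)) \<longlonglongrightarrow> 0" by (simp add: mult.commute)
  qed simp
  have wm: "w \<in> borel_measurable \<mu>"
  proof (rule borel_measurable_LIMSEQ_metric)
    show "(\<lambda>\<omega>. if \<omega> \<in> good then \<Sum>i<n. u i \<omega> else 0) \<in> borel_measurable \<mu>" for n by measurable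
    show "(\<lambda>n. if \<omega> \<in> good then \<Sum>i<n. u i \<omega> else 0) \<longlonglongrightarrow> w \<omega>" for \<omega>
      using u_sums[of \<omega>] by (cases "\<omega> \<in> good") (simp_all add: sums_def w_def)
  qed
  have hsKw: "hilbert_schmidt (Kw \<omega>)" for \<omega>
  proof (cases "\<omega> \<in> good")
    case True
    then show ?thesis unfolding Kw_def using hs_geometric_tail(1)[of "\<lambda>n. K n \<omega>", OF hsK Kb[OF True]] by simp
  qed (simp add: Kw_def hs_zero)
  have Kwm: "(\<lambda>\<omega>. Kw \<omega> y) \<in> borel_measurable \<mu>" for y
  proof (rule borel_measurable_LIMSEQ_metric)
    show "(\<lambda>\<omega>. if \<omega> \<in> good then \<Sum>i<n. K i \<omega> y else 0) \<in> borel_measurable \<mu>" for n by measurable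
    fix \<omega>
    show "(\<lambda>n. if \<omega> \<in> good then \<Sum>i<n. K i \<omega> y else 0) \<longlonglongrightarrow> Kw \<omega> y"
    proof (cases "\<omega> \<in> good")
      case True
      have "(\<lambda>n. (\<Sum>i<n. K i \<omega>) y) \<longlonglongrightarrow> Kw \<omega> y"
        by (intro tendsto_intros K_sums[OF True, unfolded sums_def])
      then show ?thesis using True by (simp add: blinfun.sum_left)
    qed (simp add: Kw_def)
  qed
  have "w \<in> sobolev_H_1 \<mu> \<iota> p"
    unfolding sobolev_H_1_def Lp_conv_def Lp_conv_HS_def
  proof (intro CollectI conjI wm exI allI)
    show "smooth_grad_H \<iota> (\<lambda>\<omega>. \<Sum>i<n. u i \<omega>) (\<lambda>\<omega>. \<Sum>i<n. K i \<omega>)" for n by (rule smooth_grad_H_sum[OF sg])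
    show "Lp_null \<mu> p (\<lambda>n \<omega>. norm ((\<Sum>i<n. u i \<omega>) - w \<omega>))"
      by (rule null) (use geometric_tail(2)[OF ub] in \<open>simp add: w_def\<close>)
    show "hilbert_schmidt (Kw \<omega>)" for \<omega> by (rule hsKw)
    show "(\<lambda>\<omega>. Kw \<omega> y) \<in> borel_measurable \<mu>" for y by (rule Kwm)
    show "Lp_null \<mu> p (\<lambda>n \<omega>. hs_norm ((\<Sum>i<n. K i \<omega>) - Kw \<omega>))"
    proof (rule null)
      fix n \<omega> assume g: "\<omega> \<in> good"
      have "hilbert_schmidt ((\<Sum>i<n. K i \<omega>) - Kw \<omega>)" using hs_diff(1)[OF _ hsKw] hs_sum[of "{..<n}" "\<lambda>i. K i \<omega>"] hsK by simp
      from hs_norm_nonneg[OF this] hs_geometric_tail(2)[of "\<lambda>n. K n \<omega>", OF hsK Kb[OF g], of n] g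
      show "\<bar>hs_norm ((\<Sum>i<n. K i \<omega>) - Kw \<omega>)\<bar> \<le> 2 * r \<omega> * (1/2) ^ n" by (simp add: Kw_def)
    qed
  qed
  moreover have "AE \<omega> in \<mu>. (\<lambda>n. u n \<omega>) sums w \<omega> \<and> summable (\<lambda>n. norm (u n \<omega>))"
    using AEgood by eventually_elim (use u_sums geometric_tail(1)[OF ub] in blast)
  ultimately show thesis by (rule that)
qed

text \<open>
  This is the closed graph theorem for the pairing with \<open>a\<close>, by condensation of singularities. If the pairings were not
  Cauchy in \<open>L\<^sup>1\<close>, there would be differences, arbitrarily small in the Sobolev norm, whose pairings exceed \<open>c\<close>. Multiplied by
  \<open>2\<^sup>k\<close> they can still be chosen so small that every subseries converges in the Sobolev space and
  has an integrable pairing. By \<open>bounded_subseries\<close> the pairings of the single terms would be bounded, but they exceed \<open>2\<^sup>k c\<close>.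
\<close>

lemma weak_pairing_Cauchy:
  fixes a :: "'w \<Rightarrow> 'h"
  assumes am[measurable]: "a \<in> borel_measurable \<mu>"
    and aint: "\<And>w. w \<in> sobolev_H_1 \<mu> \<iota> p \<Longrightarrow> integrable \<mu> (\<lambda>\<omega>. a \<omega> \<bullet> w \<omega>)" and p: "1 \<le> p"
    and sg: "\<And>n. smooth_grad_H \<iota> (u n) (K n)" and u'm[measurable]: "u' \<in> borel_measurable \<mu>"
    and uc: "Lp_conv \<mu> p u u'" and Kc: "Lp_conv_HS \<mu> p K K'" and c: "0 < c"
  shows "\<exists>N. \<forall>n\<ge>N. \<forall>m\<ge>N. (\<integral>\<^sup>+\<omega>. ennreal \<bar>a \<omega> \<bullet> (u n \<omega> - u m \<omega>)\<bar> \<partial>\<mu>) \<le> ennreal c"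
proof (rule ccontr)
  assume neg: "\<not> ?thesis"
  note [measurable] = smooth_grad_H_measurable[OF sg]
  have hsK: "hilbert_schmidt (K n \<omega>)" for n \<omega> by (rule smooth_grad_H_hs[OF sg])
  have hsK': "hilbert_schmidt (K' \<omega>)" and [measurable]: "(\<lambda>\<omega>. K' \<omega> x) \<in> borel_measurable \<mu>" for \<omega> x
    using Kc unfolding Lp_conv_HS_def by auto
  have hsd: "hilbert_schmidt (K n \<omega> - K' \<omega>)" for n \<omega> by (rule hs_diff(1)[OF hsK hsK'])
  have [measurable]: "(\<lambda>\<omega>. hs_norm (K n \<omega> - K' \<omega>)) \<in> borel_measurable \<mu>" for n
    by (rule borel_measurable_hs_norm[OF _ hsd]) (unfold blinfun.diff_left, measurable)
  have [measurable]: "(\<lambda>\<omega>. hs_norm (K n \<omega> - K m \<omega>)) \<in> borel_measurable \<mu>" for n m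
    by (rule borel_measurable_hs_norm[OF _ hs_diff(1)[OF hsK hsK]]) (unfold blinfun.diff_left, measurable)
  define y where "y n \<omega> = norm (u n \<omega> - u' \<omega>) + hs_norm (K n \<omega> - K' \<omega>)" for n \<omega>
  have [measurable]: "y n \<in> borel_measurable \<mu>" for n unfolding y_def by measurable
  have y0: "0 \<le> y n \<omega>" for n \<omega> unfolding y_def using hs_norm_nonneg[OF hsd] by simp
  define E where "E n = (\<integral>\<^sup>+\<omega>. ennreal (y n \<omega> powr p) \<partial>\<mu>)" for n
  have E0: "E \<longlonglongrightarrow> 0"
  proof (rule tendsto_sandwich[OF always_eventually always_eventually tendsto_const])
    show "\<forall>n. E n \<le> ennreal (2 powr p) * ((\<integral>\<^sup>+\<omega>. ennreal (\<bar>norm (u n \<omega> - u' \<omega>)\<bar> powr p) \<partial>\<mu>)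
        + (\<integral>\<^sup>+\<omega>. ennreal (\<bar>hs_norm (K n \<omega> - K' \<omega>)\<bar> powr p) \<partial>\<mu>))"
    proof
      fix n
      have "E n \<le> (\<integral>\<^sup>+\<omega>. ennreal (2 powr p) * (ennreal (\<bar>norm (u n \<omega> - u' \<omega>)\<bar> powr p) + ennreal (\<bar>hs_norm (K n \<omega> - K' \<omega>)\<bar> powr p)) \<partial>\<mu>)"
        unfolding E_def y_def using powr_add_le[of "norm (u n _ - u' _)" "hs_norm (K n _ - K' _)" p] hs_norm_nonneg[OF hsd] p
        by (intro nn_integral_mono) (simp flip: ennreal_mult ennreal_plus)
      also have "\<dots> = ennreal (2 powr p) * ((\<integral>\<^sup>+\<omega>. ennreal (\<bar>norm (u n \<omega> - u' \<omega>)\<bar> powr p) \<partial>\<mu>)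
        + (\<integral>\<^sup>+\<omega>. ennreal (\<bar>hs_norm (K n \<omega> - K' \<omega>)\<bar> powr p) \<partial>\<mu>))"
        by (subst nn_integral_cmult, measurable, subst nn_integral_add, measurable)
      finally show "E n \<le> \<dots>" .
    qed
    have "(\<lambda>n. ennreal (2 powr p) * ((\<integral>\<^sup>+\<omega>. ennreal (\<bar>norm (u n \<omega> - u' \<omega>)\<bar> powr p) \<partial>\<mu>)
        + (\<integral>\<^sup>+\<omega>. ennreal (\<bar>hs_norm (K n \<omega> - K' \<omega>)\<bar> powr p) \<partial>\<mu>))) \<longlonglongrightarrow> ennreal (2 powr p) * (0 + 0)"
      using uc Kc unfolding Lp_conv_def Lp_conv_HS_def Lp_null_def
      by (intro ennreal_tendsto_cmult tendsto_add) auto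
    then show "(\<lambda>n. ennreal (2 powr p) * ((\<integral>\<^sup>+\<omega>. ennreal (\<bar>norm (u n \<omega> - u' \<omega>)\<bar> powr p) \<partial>\<mu>)
        + (\<integral>\<^sup>+\<omega>. ennreal (\<bar>hs_norm (K n \<omega> - K' \<omega>)\<bar> powr p) \<partial>\<mu>))) \<longlonglongrightarrow> 0" by simp
  qed simp
  \<comment> \<open>\<open>2\<^sup>k\<close> enters twice, from the factor of the terms and from the hypothesis of \<open>sobolev_series\<close>; \<open>2 powr p\<close> and 2 are from
    splitting a difference at the limit\<close>
  define \<epsilon> where "\<epsilon> k = (1/2) ^ k / (((2 ^ k * 2 ^ k) powr p) * (2 powr p) * 2)" for k :: nat
  have \<epsilon>: "0 < \<epsilon> k" for k by (simp add: \<epsilon>_def)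
  have "\<exists>n m. E n \<le> ennreal (\<epsilon> k) \<and> E m \<le> ennreal (\<epsilon> k) \<and>
      ennreal c < (\<integral>\<^sup>+\<omega>. ennreal \<bar>a \<omega> \<bullet> (u n \<omega> - u m \<omega>)\<bar> \<partial>\<mu>)" for k
  proof -
    have "eventually (\<lambda>n. E n < ennreal (\<epsilon> k)) sequentially" using E0 by (rule order_tendstoD) (simp add: \<epsilon>)
    then obtain N where N: "\<And>n. n \<ge> N \<Longrightarrow> E n < ennreal (\<epsilon> k)" by (auto simp: eventually_sequentially)
    from neg obtain n m where "n \<ge> N" "m \<ge> N" "ennreal c < (\<integral>\<^sup>+\<omega>. ennreal \<bar>a \<omega> \<bullet> (u n \<omega> - u m \<omega>)\<bar> \<partial>\<mu>)"
      unfolding not_ex not_all not_imp not_le by blast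
    then show ?thesis using N[of n] N[of m] by (intro exI[of _ n] exI[of _ m]) (simp add: less_imp_le)
  qed
  then have "\<forall>k. \<exists>nm. E (fst nm) \<le> ennreal (\<epsilon> k) \<and> E (snd nm) \<le> ennreal (\<epsilon> k) \<and>
      ennreal c < (\<integral>\<^sup>+\<omega>. ennreal \<bar>a \<omega> \<bullet> (u (fst nm) \<omega> - u (snd nm) \<omega>)\<bar> \<partial>\<mu>)" by (metis fst_conv snd_conv)
  from choice[OF this] obtain nm where nm: "\<And>k. E (fst (nm k)) \<le> ennreal (\<epsilon> k)" "\<And>k. E (snd (nm k)) \<le> ennreal (\<epsilon> k)"
      "\<And>k. ennreal c < (\<integral>\<^sup>+\<omega>. ennreal \<bar>a \<omega> \<bullet> (u (fst (nm k)) \<omega> - u (snd (nm k)) \<omega>)\<bar> \<partial>\<mu>)" by blast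
  define U where "U k \<omega> = (2 ^ k) *\<^sub>R (u (fst (nm k)) \<omega> - u (snd (nm k)) \<omega>)" for k \<omega>
  define L where "L k \<omega> = (2 ^ k) *\<^sub>R (K (fst (nm k)) \<omega> - K (snd (nm k)) \<omega>)" for k \<omega>
  have sgU: "smooth_grad_H \<iota> (U k) (L k)" for k
    unfolding U_def[abs_def] L_def[abs_def] by (intro smooth_grad_H_scale smooth_grad_H_diff sg)
  note [measurable] = smooth_grad_H_measurable(1)[OF sgU]
  have bound: "(\<integral>\<^sup>+\<omega>. ennreal ((2 ^ k * (norm (U k \<omega>) + hs_norm (L k \<omega>))) powr p) \<partial>\<mu>) \<le> ennreal ((1/2) ^ k)" for k
  proof -
    let ?n = "fst (nm k)" and ?m = "snd (nm k)"
    define C where "C = (2 ^ k * 2 ^ k) powr p * (2 powr p)"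
    have C: "0 < C" by (simp add: C_def)
    have pt: "(2 ^ k * (norm (U k \<omega>) + hs_norm (L k \<omega>))) powr p \<le> C * (y ?n \<omega> powr p + y ?m \<omega> powr p)" for \<omega>
    proof -
      have "norm (U k \<omega>) \<le> 2 ^ k * (norm (u ?n \<omega> - u' \<omega>) + norm (u ?m \<omega> - u' \<omega>))"
        using norm_triangle_ineq4[of "u ?n \<omega> - u' \<omega>" "u ?m \<omega> - u' \<omega>"] by (simp add: U_def)
      moreover have "hs_norm (L k \<omega>) \<le> 2 ^ k * (hs_norm (K ?n \<omega> - K' \<omega>) + hs_norm (K ?m \<omega> - K' \<omega>))"
      proof -
        have "hs_norm (L k \<omega>) \<le> \<bar>2 ^ k\<bar> * hs_norm (K ?n \<omega> - K ?m \<omega>)"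
          unfolding L_def by (rule hs_scaleR(2)[OF hs_diff(1)[OF hsK hsK]])
        also have "hs_norm (K ?n \<omega> - K ?m \<omega>) \<le> hs_norm (K ?n \<omega> - K' \<omega>) + hs_norm (K ?m \<omega> - K' \<omega>)"
          using hs_diff(2)[OF hsd[of ?n \<omega>] hsd[of ?m \<omega>]] by simp
        finally show ?thesis by (simp add: mult_left_mono)
      qed
      ultimately have "norm (U k \<omega>) + hs_norm (L k \<omega>) \<le> 2 ^ k * (y ?n \<omega> + y ?m \<omega>)"
        unfolding y_def by (simp add: algebra_simps)
      then have "2 ^ k * (norm (U k \<omega>) + hs_norm (L k \<omega>)) \<le> (2 ^ k * 2 ^ k) * (y ?n \<omega> + y ?m \<omega>)"
        by (simp add: mult.assoc)
      moreover have "0 \<le> 2 ^ k * (norm (U k \<omega>) + hs_norm (L k \<omega>))"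
        using hs_norm_nonneg[OF smooth_grad_H_hs[OF sgU]] by simp
      ultimately have "(2 ^ k * (norm (U k \<omega>) + hs_norm (L k \<omega>))) powr p \<le> ((2 ^ k * 2 ^ k) * (y ?n \<omega> + y ?m \<omega>)) powr p"
        using p by (intro powr_mono2) auto
      also have "\<dots> = (2 ^ k * 2 ^ k) powr p * (y ?n \<omega> + y ?m \<omega>) powr p" by (rule powr_mult)
      also have "\<dots> \<le> (2 ^ k * 2 ^ k) powr p * (2 powr p * (y ?n \<omega> powr p + y ?m \<omega> powr p))"
        using p by (intro mult_left_mono powr_add_le y0) auto
      finally show ?thesis by (simp add: C_def mult.assoc)
    qed
    have "(\<integral>\<^sup>+\<omega>. ennreal ((2 ^ k * (norm (U k \<omega>) + hs_norm (L k \<omega>))) powr p) \<partial>\<mu>)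
      \<le> (\<integral>\<^sup>+\<omega>. ennreal C * (ennreal (y ?n \<omega> powr p) + ennreal (y ?m \<omega> powr p)) \<partial>\<mu>)"
      using pt C by (intro nn_integral_mono) (simp flip: ennreal_mult ennreal_plus)
    also have "\<dots> = ennreal C * (E ?n + E ?m)"
      unfolding E_def by (simp add: nn_integral_cmult nn_integral_add)
    also have "\<dots> \<le> ennreal C * (ennreal (\<epsilon> k) + ennreal (\<epsilon> k))" by (intro mult_left_mono add_mono nm) simp
    also have "\<dots> = ennreal (C * (\<epsilon> k + \<epsilon> k))" using C \<epsilon>[of k] by (simp add: ennreal_mult less_imp_le flip: ennreal_plus)
    also have "C * (\<epsilon> k + \<epsilon> k) = (1/2) ^ k" using C unfolding \<epsilon>_def C_def[symmetric] by (simp add: field_simps)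
    finally show ?thesis .
  qed
  have geo: "(\<Sum>k. ennreal ((1/2) ^ k)) < \<infinity>"
    by (subst suminf_ennreal2) (auto intro: summable_geometric)
  have series: "\<exists>w. w \<in> sobolev_H_1 \<mu> \<iota> p \<and> (AE \<omega> in \<mu>. (\<lambda>k. if k \<in> J then U k \<omega> else 0) sums w \<omega> \<and> summable (\<lambda>k. norm (if k \<in> J then U k \<omega> else 0)))" for J
  proof (rule sobolev_series[where u = "\<lambda>k \<omega>. if k \<in> J then U k \<omega> else 0" and K = "\<lambda>k \<omega>. if k \<in> J then L k \<omega> else 0"])
    show "smooth_grad_H \<iota> (\<lambda>\<omega>. if k \<in> J then U k \<omega> else 0) (\<lambda>\<omega>. if k \<in> J then L k \<omega> else 0)" for k
      by (cases "k \<in> J") (simp_all add: sgU smooth_grad_H_zero)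
    have "(\<integral>\<^sup>+\<omega>. ennreal ((2 ^ k * (norm (if k \<in> J then U k \<omega> else 0) + hs_norm (if k \<in> J then L k \<omega> else 0))) powr p) \<partial>\<mu>) \<le> ennreal ((1/2) ^ k)" for k
      using bound[of k] p by (cases "k \<in> J") (simp_all add: hs_zero)
    then have "(\<Sum>k. \<integral>\<^sup>+\<omega>. ennreal ((2 ^ k * (norm (if k \<in> J then U k \<omega> else 0) + hs_norm (if k \<in> J then L k \<omega> else 0))) powr p) \<partial>\<mu>) \<le> (\<Sum>k. ennreal ((1/2) ^ k))"
      by (intro suminf_le summableI)
    then show "(\<Sum>k. \<integral>\<^sup>+\<omega>. ennreal ((2 ^ k * (norm (if k \<in> J then U k \<omega> else 0) + hs_norm (if k \<in> J then L k \<omega> else 0))) powr p) \<partial>\<mu>) < \<infinity>"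
      using geo by (rule order.strict_trans1)
  qed (use p in blast)+
  define v where "v k \<omega> = a \<omega> \<bullet> U k \<omega>" for k \<omega>
  have [measurable]: "v k \<in> borel_measurable \<mu>" for k unfolding v_def by measurable
  have "\<exists>C::nat. \<exists>N. \<forall>k\<ge>N. (\<integral>\<^sup>+\<omega>. ennreal \<bar>v k \<omega>\<bar> \<partial>\<mu>) \<le> of_nat C"
  proof (rule bounded_subseries)
    from series[of UNIV] obtain w where "AE \<omega> in \<mu>. summable (\<lambda>k. norm (U k \<omega>))" by auto
    then show "AE \<omega> in \<mu>. summable (\<lambda>k. \<bar>v k \<omega>\<bar>)"
    proof eventually_elim
      case (elim \<omega>)
      have "\<bar>v k \<omega>\<bar> \<le> norm (a \<omega>) * norm (U k \<omega>)" for k unfolding v_def by (rule Cauchy_Schwarz_ineq2)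
      then show ?case by (intro summable_comparison_test'[OF summable_mult[OF elim, of "norm (a \<omega>)"]]) simp
    qed
    fix J
    from series[of J] obtain w where w: "w \<in> sobolev_H_1 \<mu> \<iota> p" "AE \<omega> in \<mu>. (\<lambda>k. if k \<in> J then U k \<omega> else 0) sums w \<omega>" by auto
    have "AE \<omega> in \<mu>. ennreal \<bar>subseries v J \<omega>\<bar> = ennreal (norm (a \<omega> \<bullet> w \<omega>))"
      using w(2)
    proof eventually_elim
      case (elim \<omega>)
      from bounded_linear.sums[OF bounded_linear_inner_right elim, of "a \<omega>"]
      have "(\<lambda>k. a \<omega> \<bullet> (if k \<in> J then U k \<omega> else 0)) sums (a \<omega> \<bullet> w \<omega>)" .
      moreover have "a \<omega> \<bullet> (if k \<in> J then U k \<omega> else 0) = (if k \<in> J then v k \<omega> else 0)" for k by (simp add: v_def)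
      ultimately have "subseries v J \<omega> = a \<omega> \<bullet> w \<omega>" unfolding subseries_def by (simp add: sums_iff)
      then show ?case by simp
    qed
    then have "(\<integral>\<^sup>+\<omega>. ennreal \<bar>subseries v J \<omega>\<bar> \<partial>\<mu>) = (\<integral>\<^sup>+\<omega>. ennreal (norm (a \<omega> \<bullet> w \<omega>)) \<partial>\<mu>)" by (rule nn_integral_cong_AE)
    also have "\<dots> < \<infinity>" using aint[OF w(1)] unfolding integrable_iff_bounded by blast
    finally show "(\<integral>\<^sup>+\<omega>. ennreal \<bar>subseries v J \<omega>\<bar> \<partial>\<mu>) < \<infinity>" .
  qed measurable
  then obtain C :: nat and N where CN: "\<And>k. k \<ge> N \<Longrightarrow> (\<integral>\<^sup>+\<omega>. ennreal \<bar>v k \<omega>\<bar> \<partial>\<mu>) \<le> of_nat C" by blast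
  obtain k0 where k0: "real C / c < 2 ^ k0" using real_arch_pow[of 2 "real C / c"] by auto
  define k where "k = max N k0"
  have "real C < 2 ^ k * c"
  proof -
    have "(2::real) ^ k0 \<le> 2 ^ k" by (rule power_increasing) (simp_all add: k_def)
    with k0 have "real C / c < 2 ^ k" by linarith
    then show ?thesis using c by (simp add: field_simps)
  qed
  then have "ennreal (real C) < ennreal (2 ^ k * c)" using c by (intro ennreal_lessI) auto
  also have "\<dots> = ennreal (2 ^ k) * ennreal c" using c by (simp add: ennreal_mult)
  also have "\<dots> \<le> ennreal (2 ^ k) * (\<integral>\<^sup>+\<omega>. ennreal \<bar>a \<omega> \<bullet> (u (fst (nm k)) \<omega> - u (snd (nm k)) \<omega>)\<bar> \<partial>\<mu>)"
    using nm(3)[of k] by (intro mult_left_mono) auto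
  also have "\<dots> = (\<integral>\<^sup>+\<omega>. ennreal (2 ^ k) * ennreal \<bar>a \<omega> \<bullet> (u (fst (nm k)) \<omega> - u (snd (nm k)) \<omega>)\<bar> \<partial>\<mu>)"
    by (rule nn_integral_cmult[symmetric]) measurable
  also have "\<dots> = (\<integral>\<^sup>+\<omega>. ennreal \<bar>v k \<omega>\<bar> \<partial>\<mu>)"
    by (intro nn_integral_cong) (simp add: v_def U_def abs_mult flip: ennreal_mult)
  also have "\<dots> \<le> of_nat C" by (rule CN) (simp add: k_def)
  finally show False by (simp add: ennreal_of_nat_eq_real_of_nat)
qed

text \<open>
  The limit of the Cauchy sequence is identified along an almost surely convergent subsequence, by Fatou's lemma.
\<close>

lemma weak_pairing_LIMSEQ:
  fixes a :: "'w \<Rightarrow> 'h"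
  assumes am[measurable]: "a \<in> borel_measurable \<mu>"
    and aint: "\<And>w. w \<in> sobolev_H_1 \<mu> \<iota> p \<Longrightarrow> integrable \<mu> (\<lambda>\<omega>. a \<omega> \<bullet> w \<omega>)" and p: "1 \<le> p"
    and sg: "\<And>n. smooth_grad_H \<iota> (u n) (K n)" and u'm[measurable]: "u' \<in> borel_measurable \<mu>"
    and uc: "Lp_conv \<mu> p u u'" and Kc: "Lp_conv_HS \<mu> p K K'"
  shows "(\<lambda>n. \<integral>\<^sup>+\<omega>. ennreal \<bar>a \<omega> \<bullet> u n \<omega> - a \<omega> \<bullet> u' \<omega>\<bar> \<partial>\<mu>) \<longlonglongrightarrow> 0"
proof (rule ennreal_tendsto_zeroI)
  fix c :: real assume c: "0 < c"
  note [measurable] = smooth_grad_H_measurable(1)[OF sg]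
  obtain N where N: "\<And>n m. n \<ge> N \<Longrightarrow> m \<ge> N \<Longrightarrow> (\<integral>\<^sup>+\<omega>. ennreal \<bar>a \<omega> \<bullet> (u n \<omega> - u m \<omega>)\<bar> \<partial>\<mu>) \<le> ennreal c"
    using weak_pairing_Cauchy[OF assms c] by blast
  have "(\<lambda>n. \<integral>\<^sup>+\<omega>. ennreal (norm (u n \<omega> - u' \<omega>)) \<partial>\<mu>) \<longlonglongrightarrow> 0" by (rule Lp_conv_L1[OF uc p]) measurable
  then obtain r :: "nat \<Rightarrow> nat" where r: "strict_mono r" "AE \<omega> in \<mu>. (\<lambda>n. u (r n) \<omega> - u' \<omega>) \<longlonglongrightarrow> 0"
    using nn_L1_AE_subseq[of "\<lambda>n \<omega>. u n \<omega> - u' \<omega>" \<mu>] by (auto intro: that)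
  have "(\<integral>\<^sup>+\<omega>. ennreal \<bar>a \<omega> \<bullet> u n \<omega> - a \<omega> \<bullet> u' \<omega>\<bar> \<partial>\<mu>) \<le> ennreal c" if n: "n \<ge> N" for n
  proof -
    have "AE \<omega> in \<mu>. ennreal \<bar>a \<omega> \<bullet> u n \<omega> - a \<omega> \<bullet> u' \<omega>\<bar> = liminf (\<lambda>m. ennreal \<bar>a \<omega> \<bullet> (u n \<omega> - u (r m) \<omega>)\<bar>)"
      using r(2)
    proof eventually_elim
      case (elim \<omega>)
      then have "(\<lambda>m. u (r m) \<omega>) \<longlonglongrightarrow> u' \<omega>" by (rule LIM_zero_cancel)
      then have "(\<lambda>m. ennreal \<bar>a \<omega> \<bullet> (u n \<omega> - u (r m) \<omega>)\<bar>) \<longlonglongrightarrow> ennreal \<bar>a \<omega> \<bullet> (u n \<omega> - u' \<omega>)\<bar>"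
        by (intro tendsto_ennrealI tendsto_rabs tendsto_inner tendsto_diff tendsto_const)
      from lim_imp_Liminf[OF _ this] show ?case by (simp add: inner_diff_right)
    qed
    then have "(\<integral>\<^sup>+\<omega>. ennreal \<bar>a \<omega> \<bullet> u n \<omega> - a \<omega> \<bullet> u' \<omega>\<bar> \<partial>\<mu>) = (\<integral>\<^sup>+\<omega>. liminf (\<lambda>m. ennreal \<bar>a \<omega> \<bullet> (u n \<omega> - u (r m) \<omega>)\<bar>) \<partial>\<mu>)"
      by (rule nn_integral_cong_AE)
    also have "\<dots> \<le> liminf (\<lambda>m. \<integral>\<^sup>+\<omega>. ennreal \<bar>a \<omega> \<bullet> (u n \<omega> - u (r m) \<omega>)\<bar> \<partial>\<mu>)" by (rule nn_integral_liminf) measurable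
    also have "\<dots> \<le> liminf (\<lambda>m. ennreal c)"
    proof (rule Liminf_mono)
      have "r m \<ge> N" if "m \<ge> N" for m using seq_suble[OF r(1), of m] that by simp
      then show "\<forall>\<^sub>F m in sequentially. (\<integral>\<^sup>+\<omega>. ennreal \<bar>a \<omega> \<bullet> (u n \<omega> - u (r m) \<omega>)\<bar> \<partial>\<mu>) \<le> ennreal c"
        unfolding eventually_sequentially using N[OF n] by blast
    qed
    also have "\<dots> = ennreal c" by (simp add: Liminf_const)
    finally show ?thesis .
  qed
  then show "\<forall>\<^sub>F n in sequentially. (\<integral>\<^sup>+\<omega>. ennreal \<bar>a \<omega> \<bullet> u n \<omega> - a \<omega> \<bullet> u' \<omega>\<bar> \<partial>\<mu>) \<le> ennreal c"
    unfolding eventually_sequentially by blast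
qed

end

section \<open>Difference quotients of stationary processes\<close>

text \<open>
  The derivative need not be continuous or integrable; where it is not integrable, the right-hand side is infinite.
\<close>

lemma increment_le_nn_integral:
  fixes x y :: "real \<Rightarrow> real"
  assumes d: "\<And>s. (x has_real_derivative y s) (at s)" and y[measurable]: "y \<in> borel_measurable borel" and ab: "a \<le> b"
  shows "ennreal \<bar>x b - x a\<bar> \<le> (\<integral>\<^sup>+s. ennreal \<bar>y s\<bar> * indicator {a..b} s \<partial>lborel)"
proof (cases "(\<integral>\<^sup>+s. ennreal \<bar>y s\<bar> * indicator {a..b} s \<partial>lborel) < \<infinity>")
  case True
  have eq: "ennreal \<bar>y s\<bar> * indicator {a..b} s = ennreal (norm (indicator {a..b} s *\<^sub>R y s))" for s
    by (simp split: split_indicator)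
  have int: "integrable lborel (\<lambda>s. indicator {a..b} s *\<^sub>R y s)"
    by (rule integrableI_bounded) (measurable, use True in \<open>simp only: eq\<close>)
  have "(y has_integral (x b - x a)) {a..b}"
    by (rule fundamental_theorem_of_calculus[OF ab])
      (use d in \<open>auto simp: has_real_derivative_iff_has_vector_derivative intro: has_vector_derivative_at_within\<close>)
  then have "integral {a..b} y = x b - x a" by (rule integral_unique)
  moreover have "set_integrable lborel {a..b} y" using int by (simp add: set_integrable_def)
  ultimately have "(\<integral>s. indicator {a..b} s *\<^sub>R y s \<partial>lborel) = x b - x a"
    using set_borel_integral_eq_integral(2)[of "{a..b}" y] by (simp add: set_lebesgue_integral_def)
  then show ?thesis using integral_norm_bound_ennreal[OF int] unfolding eq by simp
next
  case False
  then have "(\<integral>\<^sup>+s. ennreal \<bar>y s\<bar> * indicator {a..b} s \<partial>lborel) = \<infinity>"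
    by (simp add: not_less top_unique)
  then show ?thesis by simp
qed

text \<open>
  Time is rounded down to a grid of mesh \<open>1/(n + 1)\<close>; a process with countably many times is jointly measurable.
\<close>

lemma continuous_process_measurable:
  fixes X :: "real \<Rightarrow> 'a \<Rightarrow> real"
  assumes m: "\<And>s. X s \<in> borel_measurable M" and c: "\<And>\<omega>. \<omega> \<in> space M \<Longrightarrow> continuous_on UNIV (\<lambda>s. X s \<omega>)"
  shows "(\<lambda>z. X (fst z) (snd z)) \<in> borel_measurable (borel \<Otimes>\<^sub>M M)"
proof (rule borel_measurable_LIMSEQ_real)
  define grid where "grid n s = real_of_int \<lfloor>real (Suc n) * s\<rfloor> / real (Suc n)" for n s
  show "(\<lambda>z. X (grid n (fst z)) (snd z)) \<in> borel_measurable (borel \<Otimes>\<^sub>M M)" for n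
  proof -
    have "(\<lambda>z. X (real_of_int \<lfloor>real (Suc n) * fst z\<rfloor> / real (Suc n)) (snd z)) \<in> borel_measurable (borel \<Otimes>\<^sub>M M)"
    proof (rule measurable_compose_countable[where f = "\<lambda>k z. X (real_of_int k / real (Suc n)) (snd z)" and g = "\<lambda>z. \<lfloor>real (Suc n) * fst z\<rfloor>"])
      show "(\<lambda>z. X (real_of_int k / real (Suc n)) (snd z)) \<in> borel_measurable (borel \<Otimes>\<^sub>M M)" for k :: int
        by (rule measurable_compose[OF measurable_snd m])
      show "(\<lambda>z. \<lfloor>real (Suc n) * fst z\<rfloor>) \<in> borel \<Otimes>\<^sub>M M \<rightarrow>\<^sub>M count_space UNIV"
        by measurable
    qed
    then show ?thesis by (simp add: grid_def)
  qed
  fix z :: "real \<times> 'a" assume z: "z \<in> space (borel \<Otimes>\<^sub>M M)"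
  have g: "(\<lambda>n. grid n (fst z)) \<longlonglongrightarrow> fst z"
  proof (rule LIM_zero_cancel, rule Lim_null_comparison[OF _ LIMSEQ_inverse_real_of_nat], rule always_eventually, rule allI)
    fix n
    have "\<bar>real_of_int \<lfloor>real (Suc n) * fst z\<rfloor> - real (Suc n) * fst z\<bar> \<le> 1" by linarith
    then have "\<bar>real_of_int \<lfloor>real (Suc n) * fst z\<rfloor> - real (Suc n) * fst z\<bar> / real (Suc n) \<le> 1 / real (Suc n)"
      by (intro divide_right_mono) auto
    moreover have "grid n (fst z) - fst z = (real_of_int \<lfloor>real (Suc n) * fst z\<rfloor> - real (Suc n) * fst z) / real (Suc n)"
      by (simp add: grid_def diff_divide_distrib del: of_nat_Suc)
    ultimately show "norm (grid n (fst z) - fst z) \<le> inverse (real (Suc n))"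
      by (simp add: abs_divide inverse_eq_divide del: of_nat_Suc)
  qed
  have "isCont (\<lambda>s. X s (snd z)) (fst z)"
    using c[of "snd z"] z by (auto simp: continuous_on_eq_continuous_at space_pair_measure)
  then show "(\<lambda>n. X (grid n (fst z)) (snd z)) \<longlonglongrightarrow> X (fst z) (snd z)" by (rule isCont_tendsto_compose[OF _ g])
qed

lemma (in prob_space) truncated_mean_small:
  fixes Y :: "'a \<Rightarrow> real"
  assumes Y: "integrable M Y" and r: "0 < r"
  obtains C where "0 \<le> C" "(\<integral>\<^sup>+\<omega>. ennreal (max 0 (\<bar>Y \<omega>\<bar> - C)) \<partial>M) \<le> ennreal r"
proof -
  have [measurable]: "Y \<in> borel_measurable M" using Y by auto
  have "(\<lambda>n. \<integral>\<^sup>+\<omega>. ennreal (max 0 (\<bar>Y \<omega>\<bar> - real n)) \<partial>M) \<longlonglongrightarrow> (\<integral>\<^sup>+\<omega>. 0 \<partial>M)"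
  proof (rule nn_integral_dominated_convergence[where w = "\<lambda>\<omega>. ennreal \<bar>Y \<omega>\<bar>"])
    show "(\<integral>\<^sup>+\<omega>. ennreal \<bar>Y \<omega>\<bar> \<partial>M) < \<infinity>" using Y unfolding integrable_iff_bounded by simp
    show "AE \<omega> in M. (\<lambda>n. ennreal (max 0 (\<bar>Y \<omega>\<bar> - real n))) \<longlonglongrightarrow> 0"
    proof (rule AE_I2)
      fix \<omega>
      obtain N :: nat where N: "\<bar>Y \<omega>\<bar> \<le> real N" using real_arch_simple by blast
      show "(\<lambda>n. ennreal (max 0 (\<bar>Y \<omega>\<bar> - real n))) \<longlonglongrightarrow> 0"
      proof (rule tendsto_eventually)
        show "eventually (\<lambda>n. ennreal (max 0 (\<bar>Y \<omega>\<bar> - real n)) = 0) sequentially"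
          unfolding eventually_sequentially
        proof (intro exI[of _ N] allI impI)
          fix n assume "N \<le> n"
          then have "real N \<le> real n" by simp
          then have "max 0 (\<bar>Y \<omega>\<bar> - real n) = 0" using N by linarith
          then show "ennreal (max 0 (\<bar>Y \<omega>\<bar> - real n)) = 0" by simp
        qed
      qed
    qed
    show "AE \<omega> in M. ennreal (max 0 (\<bar>Y \<omega>\<bar> - real n)) \<le> ennreal \<bar>Y \<omega>\<bar>" for n
      by (intro AE_I2 ennreal_leI) simp
  qed measurable
  then have "(\<lambda>n. \<integral>\<^sup>+\<omega>. ennreal (max 0 (\<bar>Y \<omega>\<bar> - real n)) \<partial>M) \<longlonglongrightarrow> 0" by simp
  from order_tendstoD(2)[OF this, of "ennreal r"] r obtain n where "(\<integral>\<^sup>+\<omega>. ennreal (max 0 (\<bar>Y \<omega>\<bar> - real n)) \<partial>M) < ennreal r"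
    by (auto simp: eventually_sequentially)
  then show thesis by (intro that[of "real n"]) auto
qed

text \<open>
  Almost everywhere convergence holds by assumption; the point is uniform integrability. The difference quotient is bounded by the
  average of \<open>|Y s|\<close> over a short interval, hence by a constant \<open>C\<close> plus the average of the excess of \<open>|Y s|\<close> over \<open>C\<close>. The mean of this
  average does not depend on the interval, as the \<open>Y s\<close> are identically distributed, and it
  is small for large \<open>C\<close>.
\<close>

lemma (in prob_space) difference_quotient_L1_surely:
  fixes X Y :: "real \<Rightarrow> 'a \<Rightarrow> real"
  assumes Xm: "\<And>s. X s \<in> borel_measurable M"
    and der: "\<And>\<omega> s. \<omega> \<in> space M \<Longrightarrow> ((\<lambda>s. X s \<omega>) has_real_derivative Y s \<omega>) (at s)"
    and Ym: "\<And>s. Y s \<in> borel_measurable M"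
    and law: "\<And>s. distr M borel (Y s) = distr M borel (Y 0)"
    and int: "integrable M (Y 0)"
    and \<epsilon>: "\<epsilon> \<longlonglongrightarrow> 0" "\<And>n. \<epsilon> n \<noteq> (0 :: real)"
  shows "(\<lambda>n. \<integral>\<^sup>+\<omega>. ennreal \<bar>(X (t + \<epsilon> n) \<omega> - X t \<omega>) / \<epsilon> n - Y t \<omega>\<bar> \<partial>M) \<longlonglongrightarrow> 0"
proof (rule ennreal_tendsto_zeroI)
  fix r :: real assume r: "0 < r"
  note [measurable] = Xm Ym
  have Xj: "(\<lambda>z. X (fst z) (snd z)) \<in> borel_measurable (borel \<Otimes>\<^sub>M M)"
    by (rule continuous_process_measurable[OF Xm]) (use der in \<open>meson DERIV_isCont continuous_at_imp_continuous_on\<close>)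
  have Yj[measurable]: "(\<lambda>z. Y (fst z) (snd z)) \<in> borel_measurable (borel \<Otimes>\<^sub>M M)"
  proof (rule borel_measurable_LIMSEQ_real)
    show "(\<lambda>z. (X (fst z + inverse (real (Suc n))) (snd z) - X (fst z) (snd z)) / inverse (real (Suc n))) \<in> borel_measurable (borel \<Otimes>\<^sub>M M)" for n
    proof -
      have "(\<lambda>z. (fst z + inverse (real (Suc n)), snd z)) \<in> borel \<Otimes>\<^sub>M M \<rightarrow>\<^sub>M borel \<Otimes>\<^sub>M M" by measurable
      from measurable_compose[OF this Xj]
      have "(\<lambda>z. X (fst z + inverse (real (Suc n))) (snd z)) \<in> borel_measurable (borel \<Otimes>\<^sub>M M)" by simp
      then show ?thesis using Xj by (intro borel_measurable_divide borel_measurable_diff borel_measurable_const)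
    qed
    fix z :: "real \<times> 'a" assume "z \<in> space (borel \<Otimes>\<^sub>M M)"
    then have "((\<lambda>s. X s (snd z)) has_real_derivative Y (fst z) (snd z)) (at (fst z))"
      by (intro der) (auto simp: space_pair_measure)
    then have "((\<lambda>h. (X (fst z + h) (snd z) - X (fst z) (snd z)) / h) \<longlongrightarrow> Y (fst z) (snd z)) (at 0)" by (simp add: DERIV_def)
    then show "(\<lambda>n. (X (fst z + inverse (real (Suc n))) (snd z) - X (fst z) (snd z)) / inverse (real (Suc n))) \<longlonglongrightarrow> Y (fst z) (snd z)"
      by (rule filterlim_compose) (unfold filterlim_at, simp del: of_nat_Suc add: LIMSEQ_inverse_real_of_nat)
  qed
  have Ypath: "(\<lambda>s. Y s \<omega>) \<in> borel_measurable borel" if "\<omega> \<in> space M" for \<omega>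
    using measurable_compose[OF measurable_Pair2'[OF that, of borel] Yj] by simp
  obtain C where C: "0 \<le> C" "(\<integral>\<^sup>+\<omega>. ennreal (max 0 (\<bar>Y 0 \<omega>\<bar> - C)) \<partial>M) \<le> ennreal (r / 2)"
    using truncated_mean_small[OF int, of "r / 2"] r by auto
  have C': "(\<integral>\<^sup>+\<omega>. ennreal (max 0 (\<bar>Y s \<omega>\<bar> - C)) \<partial>M) \<le> ennreal (r / 2)" for s
  proof -
    have "(\<integral>\<^sup>+\<omega>. ennreal (max 0 (\<bar>Y s \<omega>\<bar> - C)) \<partial>M) = (\<integral>\<^sup>+y. ennreal (max 0 (\<bar>y\<bar> - C)) \<partial>distr M borel (Y s))" for s
      by (subst nn_integral_distr) auto
    then show ?thesis using C(2) law[of s] by simp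
  qed
  define I where "I n = {min t (t + \<epsilon> n)..max t (t + \<epsilon> n)}" for n
  define R where "R n \<omega> = (\<integral>\<^sup>+s. ennreal (max 0 (\<bar>Y s \<omega>\<bar> - C)) * indicator (I n) s \<partial>lborel)" for n \<omega>
  have Im[measurable]: "I n \<in> sets borel" for n by (simp add: I_def)
  have Ilen: "emeasure lborel (I n) = ennreal \<bar>\<epsilon> n\<bar>" for n
    unfolding I_def by (simp add: max_def min_def)
  have lM: "pair_sigma_finite lborel M" ..
  have jm: "(\<lambda>z. ennreal (max 0 (\<bar>Y (fst z) (snd z)\<bar> - C)) * indicator (I n) (fst z)) \<in> borel_measurable (lborel \<Otimes>\<^sub>M M)" for n
  proof -
    have "sets (lborel \<Otimes>\<^sub>M M) = sets (borel \<Otimes>\<^sub>M M)" by (rule sets_pair_measure_cong) auto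
    then show ?thesis unfolding measurable_cong_sets[OF \<open>sets (lborel \<Otimes>\<^sub>M M) = _\<close> refl] by measurable
  qed
  have Rm[measurable]: "R n \<in> borel_measurable M" for n
  proof -
    have "(\<lambda>z :: 'a \<times> real. ennreal (max 0 (\<bar>Y (snd z) (fst z)\<bar> - C)) * indicator (I n) (snd z)) \<in> borel_measurable (M \<Otimes>\<^sub>M lborel)"
      using measurable_pair_swap[OF jm[of n]] by (simp add: case_prod_beta)
    from lborel.borel_measurable_nn_integral_fst[OF this] show ?thesis unfolding R_def[abs_def] by simp
  qed
  have ER: "(\<integral>\<^sup>+\<omega>. R n \<omega> \<partial>M) \<le> ennreal (r / 2) * ennreal \<bar>\<epsilon> n\<bar>" for n
  proof -
    have "(\<integral>\<^sup>+\<omega>. R n \<omega> \<partial>M) = (\<integral>\<^sup>+s. (\<integral>\<^sup>+\<omega>. ennreal (max 0 (\<bar>Y s \<omega>\<bar> - C)) * indicator (I n) s \<partial>M) \<partial>lborel)"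
      unfolding R_def using pair_sigma_finite.Fubini[OF lM jm[of n]] by simp
    also have "\<dots> \<le> (\<integral>\<^sup>+s. ennreal (r / 2) * indicator (I n) s \<partial>lborel)"
    proof (rule nn_integral_mono)
      fix s
      have "(\<integral>\<^sup>+\<omega>. ennreal (max 0 (\<bar>Y s \<omega>\<bar> - C)) * indicator (I n) s \<partial>M) = (\<integral>\<^sup>+\<omega>. ennreal (max 0 (\<bar>Y s \<omega>\<bar> - C)) \<partial>M) * indicator (I n) s"
        by (rule nn_integral_multc) measurable
      then show "(\<integral>\<^sup>+\<omega>. ennreal (max 0 (\<bar>Y s \<omega>\<bar> - C)) * indicator (I n) s \<partial>M) \<le> ennreal (r / 2) * indicator (I n) s"
        using C'[of s] by (simp add: mult_right_mono)
    qed
    also have "\<dots> = ennreal (r / 2) * ennreal \<bar>\<epsilon> n\<bar>" by (simp add: nn_integral_cmult_indicator Ilen)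
    finally show ?thesis .
  qed
  define A where "A \<omega> = C + \<bar>Y t \<omega>\<bar>" for \<omega>
  define Z where "Z n \<omega> = \<bar>(X (t + \<epsilon> n) \<omega> - X t \<omega>) / \<epsilon> n - Y t \<omega>\<bar>" for n \<omega>
  have [measurable]: "A \<in> borel_measurable M" "Z n \<in> borel_measurable M" for n
    unfolding A_def[abs_def] Z_def[abs_def] by measurable
  \<comment> \<open>what \<open>Z\<close> has in excess of \<open>A\<close> is covered by \<open>R\<close>; the minimum is dominated\<close>
  have Zle: "ennreal (Z n \<omega>) \<le> ennreal (min (Z n \<omega>) (A \<omega>)) + ennreal (1 / \<bar>\<epsilon> n\<bar>) * R n \<omega>" if \<omega>: "\<omega> \<in> space M" for n \<omega>
  proof (cases "Z n \<omega> \<le> A \<omega>")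
    case False
    note [measurable] = Ypath[OF \<omega>]
    let ?a = "min t (t + \<epsilon> n)" and ?b = "max t (t + \<epsilon> n)"
    have "ennreal \<bar>X (t + \<epsilon> n) \<omega> - X t \<omega>\<bar> = ennreal \<bar>X ?b \<omega> - X ?a \<omega>\<bar>"
      by (auto simp: max_def min_def abs_minus_commute)
    also have "\<dots> \<le> (\<integral>\<^sup>+s. ennreal \<bar>Y s \<omega>\<bar> * indicator (I n) s \<partial>lborel)"
      unfolding I_def by (rule increment_le_nn_integral[OF der[OF \<omega>] Ypath[OF \<omega>]]) simp
    also have "\<dots> \<le> (\<integral>\<^sup>+s. ennreal C * indicator (I n) s + ennreal (max 0 (\<bar>Y s \<omega>\<bar> - C)) * indicator (I n) s \<partial>lborel)"
    proof (rule nn_integral_mono)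
      fix s
      have "ennreal \<bar>Y s \<omega>\<bar> \<le> ennreal (C + max 0 (\<bar>Y s \<omega>\<bar> - C))" by (rule ennreal_leI) simp
      also have "\<dots> = ennreal C + ennreal (max 0 (\<bar>Y s \<omega>\<bar> - C))" by (rule ennreal_plus) (use C(1) in simp_all)
      finally show "ennreal \<bar>Y s \<omega>\<bar> * indicator (I n) s
        \<le> ennreal C * indicator (I n) s + ennreal (max 0 (\<bar>Y s \<omega>\<bar> - C)) * indicator (I n) s"
        by (simp split: split_indicator)
    qed
    also have "\<dots> = ennreal C * ennreal \<bar>\<epsilon> n\<bar> + R n \<omega>"
      unfolding R_def by (subst nn_integral_add) (auto simp: nn_integral_cmult_indicator Ilen)
    finally have inc: "ennreal \<bar>X (t + \<epsilon> n) \<omega> - X t \<omega>\<bar> \<le> ennreal C * ennreal \<bar>\<epsilon> n\<bar> + R n \<omega>" .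
    have \<epsilon>0: "0 < \<bar>\<epsilon> n\<bar>" using \<epsilon>(2)[of n] by simp
    have "Z n \<omega> \<le> 1 / \<bar>\<epsilon> n\<bar> * \<bar>X (t + \<epsilon> n) \<omega> - X t \<omega>\<bar> + \<bar>Y t \<omega>\<bar>"
      unfolding Z_def by (rule order_trans[OF abs_triangle_ineq4]) (simp add: abs_divide)
    then have "ennreal (Z n \<omega>) \<le> ennreal (1 / \<bar>\<epsilon> n\<bar> * \<bar>X (t + \<epsilon> n) \<omega> - X t \<omega>\<bar> + \<bar>Y t \<omega>\<bar>)" by (rule ennreal_leI)
    also have "\<dots> = ennreal (1 / \<bar>\<epsilon> n\<bar>) * ennreal \<bar>X (t + \<epsilon> n) \<omega> - X t \<omega>\<bar> + ennreal \<bar>Y t \<omega>\<bar>"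
      by (simp add: ennreal_mult'' flip: ennreal_plus ennreal_mult)
    also have "\<dots> \<le> ennreal (1 / \<bar>\<epsilon> n\<bar>) * (ennreal C * ennreal \<bar>\<epsilon> n\<bar> + R n \<omega>) + ennreal \<bar>Y t \<omega>\<bar>"
      by (intro add_right_mono mult_left_mono inc) simp
    also have "\<dots> = ennreal C + ennreal \<bar>Y t \<omega>\<bar> + ennreal (1 / \<bar>\<epsilon> n\<bar>) * R n \<omega>"
    proof -
      have "ennreal (1 / \<bar>\<epsilon> n\<bar>) * (ennreal C * ennreal \<bar>\<epsilon> n\<bar>) = ennreal C"
        using C(1) \<epsilon>0 by (simp flip: ennreal_mult)
      then show ?thesis unfolding distrib_left by (simp only: add_ac)
    qed
    also have "ennreal C + ennreal \<bar>Y t \<omega>\<bar> = ennreal (A \<omega>)" unfolding A_def using C(1) by simp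
    finally show ?thesis using False by (simp add: min_def)
  qed (simp add: min_def)
  have lim: "(\<lambda>n. \<integral>\<^sup>+\<omega>. ennreal (min (Z n \<omega>) (A \<omega>)) \<partial>M) \<longlonglongrightarrow> (\<integral>\<^sup>+\<omega>. 0 \<partial>M)"
  proof (rule nn_integral_dominated_convergence[where w = "\<lambda>\<omega>. ennreal (A \<omega>)"])
    have "integrable M (Y t)"
    proof -
      have "integrable (distr M borel (Y 0)) (\<lambda>y. y)" using int by (simp add: integrable_distr_eq)
      then have "integrable (distr M borel (Y t)) (\<lambda>y. y)" unfolding law[of t] .
      then show ?thesis by (simp add: integrable_distr_eq)
    qed
    then have "integrable M A" unfolding A_def by simp
    then show "(\<integral>\<^sup>+\<omega>. ennreal (A \<omega>) \<partial>M) < \<infinity>" using C(1) by (subst nn_integral_eq_integral) (auto simp: A_def)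
    show "AE \<omega> in M. (\<lambda>n. ennreal (min (Z n \<omega>) (A \<omega>))) \<longlonglongrightarrow> 0"
    proof (rule AE_I2)
      fix \<omega> assume \<omega>: "\<omega> \<in> space M"
      have "((\<lambda>h. (X (t + h) \<omega> - X t \<omega>) / h) \<longlongrightarrow> Y t \<omega>) (at 0)" using der[OF \<omega>, of t] by (simp add: DERIV_def)
      moreover have "filterlim \<epsilon> (at 0) sequentially" using \<epsilon> by (simp add: filterlim_at)
      ultimately have "(\<lambda>n. (X (t + \<epsilon> n) \<omega> - X t \<omega>) / \<epsilon> n) \<longlonglongrightarrow> Y t \<omega>" by (rule filterlim_compose)
      then have "(\<lambda>n. Z n \<omega>) \<longlonglongrightarrow> 0" unfolding Z_def by (intro tendsto_rabs_zero LIM_zero)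
      moreover have "0 \<le> A \<omega>" using C(1) by (simp add: A_def)
      ultimately have "(\<lambda>n. min (Z n \<omega>) (A \<omega>)) \<longlonglongrightarrow> 0" using tendsto_min[of "\<lambda>n. Z n \<omega>" 0 sequentially "\<lambda>_. A \<omega>" "A \<omega>"] by (simp add: min_def)
      then have "(\<lambda>n. ennreal (min (Z n \<omega>) (A \<omega>))) \<longlonglongrightarrow> ennreal 0" by (rule tendsto_ennrealI)
      then show "(\<lambda>n. ennreal (min (Z n \<omega>) (A \<omega>))) \<longlonglongrightarrow> 0" by simp
    qed
    show "AE \<omega> in M. ennreal (min (Z n \<omega>) (A \<omega>)) \<le> ennreal (A \<omega>)" for n by (intro AE_I2 ennreal_leI) simp
  qed measurable
  have "eventually (\<lambda>n. (\<integral>\<^sup>+\<omega>. ennreal (min (Z n \<omega>) (A \<omega>)) \<partial>M) < ennreal (r / 2)) sequentially"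
    by (rule order_tendstoD(2)[OF lim]) (use r in \<open>simp add: ennreal_less_zero_iff\<close>)
  then show "eventually (\<lambda>n. (\<integral>\<^sup>+\<omega>. ennreal \<bar>(X (t + \<epsilon> n) \<omega> - X t \<omega>) / \<epsilon> n - Y t \<omega>\<bar> \<partial>M) \<le> ennreal r) sequentially"
  proof eventually_elim
    case (elim n)
    have \<epsilon>0: "0 < \<bar>\<epsilon> n\<bar>" using \<epsilon>(2)[of n] by simp
    have "(\<integral>\<^sup>+\<omega>. ennreal (Z n \<omega>) \<partial>M) \<le> (\<integral>\<^sup>+\<omega>. ennreal (min (Z n \<omega>) (A \<omega>)) + ennreal (1 / \<bar>\<epsilon> n\<bar>) * R n \<omega> \<partial>M)"
      by (rule nn_integral_mono) (rule Zle)
    also have "\<dots> = (\<integral>\<^sup>+\<omega>. ennreal (min (Z n \<omega>) (A \<omega>)) \<partial>M) + ennreal (1 / \<bar>\<epsilon> n\<bar>) * (\<integral>\<^sup>+\<omega>. R n \<omega> \<partial>M)"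
      by (simp add: nn_integral_add nn_integral_cmult)
    also have "\<dots> \<le> ennreal (r / 2) + ennreal (1 / \<bar>\<epsilon> n\<bar>) * (ennreal (r / 2) * ennreal \<bar>\<epsilon> n\<bar>)"
      using elim by (intro add_mono mult_left_mono ER) auto
    also have "\<dots> = ennreal (r / 2 + 1 / \<bar>\<epsilon> n\<bar> * (r / 2 * \<bar>\<epsilon> n\<bar>))"
      using r \<epsilon>0 by (simp only: ennreal_mult[symmetric] ennreal_plus[symmetric] abs_ge_zero divide_nonneg_nonneg mult_nonneg_nonneg less_imp_le zero_le_numeral zero_le_one)
    also have "r / 2 + 1 / \<bar>\<epsilon> n\<bar> * (r / 2 * \<bar>\<epsilon> n\<bar>) = r" using \<epsilon>0 by simp
    finally show ?case unfolding Z_def .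
  qed
qed

text \<open>
  Setting the process to 0 on a null set makes the derivative exist everywhere.
\<close>

lemma (in prob_space) difference_quotient_L1:
  fixes X Y :: "real \<Rightarrow> 'a \<Rightarrow> real"
  assumes Xm[measurable]: "\<And>s. X s \<in> borel_measurable M"
    and der: "AE \<omega> in M. \<forall>s. ((\<lambda>s. X s \<omega>) has_real_derivative Y s \<omega>) (at s)"
    and Ym[measurable]: "\<And>s. Y s \<in> borel_measurable M"
    and law: "\<And>s. distr M borel (Y s) = distr M borel (Y 0)"
    and int: "integrable M (Y 0)"
    and \<epsilon>: "\<epsilon> \<longlonglongrightarrow> 0" "\<And>n. \<epsilon> n \<noteq> (0 :: real)"
  shows "(\<lambda>n. \<integral>\<^sup>+\<omega>. ennreal \<bar>(X (t + \<epsilon> n) \<omega> - X t \<omega>) / \<epsilon> n - Y t \<omega>\<bar> \<partial>M) \<longlonglongrightarrow> 0"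
proof -
  obtain N where N: "{\<omega> \<in> space M. \<not> (\<forall>s. ((\<lambda>s. X s \<omega>) has_real_derivative Y s \<omega>) (at s))} \<subseteq> N"
    "emeasure M N = 0" and Ns[measurable]: "N \<in> sets M" using AE_E[OF der] by blast
  have AEN: "AE \<omega> in M. \<omega> \<notin> N" by (rule AE_not_in) (use N(2) Ns in \<open>simp add: null_sets_def\<close>)
  define X' where "X' s \<omega> = (if \<omega> \<in> N then 0 else X s \<omega>)" for s \<omega>
  define Y' where "Y' s \<omega> = (if \<omega> \<in> N then 0 else Y s \<omega>)" for s \<omega>
  have X'm: "X' s \<in> borel_measurable M" and Y'm: "Y' s \<in> borel_measurable M" for s
    unfolding X'_def[abs_def] Y'_def[abs_def] by measurable
  have Y'_eq: "AE \<omega> in M. Y' s \<omega> = Y s \<omega>" for s using AEN by eventually_elim (simp add: Y'_def)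
  have "(\<lambda>n. \<integral>\<^sup>+\<omega>. ennreal \<bar>(X' (t + \<epsilon> n) \<omega> - X' t \<omega>) / \<epsilon> n - Y' t \<omega>\<bar> \<partial>M) \<longlonglongrightarrow> 0"
  proof (rule difference_quotient_L1_surely[OF X'm _ Y'm _ _ \<epsilon>])
    show "((\<lambda>s. X' s \<omega>) has_real_derivative Y' s \<omega>) (at s)" if "\<omega> \<in> space M" for \<omega> s
      using N(1) that by (cases "\<omega> \<in> N") (auto simp: X'_def Y'_def)
    have "distr M borel (Y' s) = distr M borel (Y s)" for s
      by (rule distr_cong_AE[OF refl refl Y'_eq Y'm Ym])
    then show "distr M borel (Y' s) = distr M borel (Y' 0)" for s using law by simp
    show "integrable M (Y' 0)" using integrable_cong_AE[OF Y'm Ym Y'_eq] int by simp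
  qed
  moreover have "(\<integral>\<^sup>+\<omega>. ennreal \<bar>(X' (t + \<epsilon> n) \<omega> - X' t \<omega>) / \<epsilon> n - Y' t \<omega>\<bar> \<partial>M)
     = (\<integral>\<^sup>+\<omega>. ennreal \<bar>(X (t + \<epsilon> n) \<omega> - X t \<omega>) / \<epsilon> n - Y t \<omega>\<bar> \<partial>M)" for n
    by (rule nn_integral_cong_AE) (use AEN in eventually_elim, simp add: X'_def Y'_def)
  ultimately show ?thesis by simp
qed

context wiener_basis begin

lemma smooth_functional_measurable: "smooth_functional F \<Longrightarrow> F \<in> borel_measurable \<mu>"
  unfolding smooth_functional_def cylinder_def
  using cylinder_continuous borel_measurable_continuous by blast

lemma stationary_product:
  assumes st: "stationary_process \<mu> T" and F: "smooth_functional F0" "smooth_functional F1"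
  shows "(\<integral>\<omega>. F0 (T s \<omega>) * F1 (T t \<omega>) \<partial>\<mu>) = (\<integral>\<omega>. F0 (T (s + \<tau>) \<omega>) * F1 (T (t + \<tau>) \<omega>) \<partial>\<mu>)"
proof -
  define F where "F i = (if i = 0 then F0 else F1)" for i :: nat
  define r where "r i = (if i = 0 then s else t)" for i :: nat
  have Fs: "smooth_functional (F i)" for i using F by (simp add: F_def)
  have Tm: "T s \<in> measurable \<mu> \<mu>" for s using st unfolding stationary_process_def by blast
  have eq: "distr \<mu> (Pi\<^sub>M {..<2} (\<lambda>_. borel)) (\<lambda>\<omega>. \<lambda>i\<in>{..<2}. F i (T (r i) \<omega>)) =
        distr \<mu> (Pi\<^sub>M {..<2} (\<lambda>_. borel)) (\<lambda>\<omega>. \<lambda>i\<in>{..<2::nat}. F i (T (r i + \<tau>) \<omega>))"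
    using st Fs unfolding stationary_process_def by blast
  have m: "(\<lambda>\<omega>. \<lambda>i\<in>{..<2::nat}. F i (T (r' i) \<omega>)) \<in> measurable \<mu> (Pi\<^sub>M {..<2} (\<lambda>_. borel))" for r'
    by (intro measurable_restrict measurable_compose[OF Tm smooth_functional_measurable[OF Fs]])
  have pm: "(\<lambda>x. x 0 * x 1 :: real) \<in> borel_measurable (Pi\<^sub>M {..<2::nat} (\<lambda>_. borel))"
    by (intro borel_measurable_times measurable_component_singleton) auto
  have "(\<integral>\<omega>. F0 (T s \<omega>) * F1 (T t \<omega>) \<partial>\<mu>) = (\<integral>x. x 0 * x 1 \<partial>distr \<mu> (Pi\<^sub>M {..<2} (\<lambda>_. borel)) (\<lambda>\<omega>. \<lambda>i\<in>{..<2}. F i (T (r i) \<omega>)))"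
    unfolding integral_distr[OF m pm] by (simp add: F_def r_def)
  also have "\<dots> = (\<integral>\<omega>. F0 (T (s + \<tau>) \<omega>) * F1 (T (t + \<tau>) \<omega>) \<partial>\<mu>)"
    unfolding eq integral_distr[OF m pm] by (simp add: F_def r_def)
  finally show ?thesis .
qed

lemma sobolev_H_1E:
  assumes "u \<in> sobolev_H_1 \<mu> \<iota> p"
  obtains u' K' K where "u \<in> borel_measurable \<mu>" "\<And>n. smooth_grad_H \<iota> (u' n) (K' n)"
    "Lp_conv \<mu> p u' u" "Lp_conv_HS \<mu> p K' K"
proof -
  from assms have m: "u \<in> borel_measurable \<mu>"
    and ex: "\<exists>K u' K'. (\<forall>n. smooth_grad_H \<iota> (u' n) (K' n)) \<and> Lp_conv \<mu> p u' u \<and> Lp_conv_HS \<mu> p K' K"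
    by (simp_all add: sobolev_H_1_def)
  from ex show thesis by (elim exE conjE) (rule that[OF m], auto)
qed

lemma sobolev_H_1_integrable:
  assumes u: "u \<in> sobolev_H_1 \<mu> \<iota> p" and p: "1 \<le> p"
  shows "integrable \<mu> u"
proof -
  obtain u' K' K where um[measurable]: "u \<in> borel_measurable \<mu>" and sg: "\<And>n. smooth_grad_H \<iota> (u' n) (K' n)" and conv: "Lp_conv \<mu> p u' u"
    and "Lp_conv_HS \<mu> p K' K"
    by (rule sobolev_H_1E[OF u]) (rule that)
  have int: "integrable \<mu> (u' n)" for n
  proof -
    obtain m F G h where FG: "\<forall>j<m::nat. smooth_grad \<iota> (F j) (G j)" and u': "u' n = (\<lambda>\<omega>. \<Sum>j<m. F j \<omega> *\<^sub>R h j)"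
      using sg[of n] unfolding smooth_grad_H_def by blast
    show ?thesis unfolding u'
    proof (rule Bochner_Integration.integrable_sum, rule integrable_scaleR_left)
      fix j assume "j \<in> {..<m}"
      then have sgj: "smooth_grad \<iota> (F j) (G j)" using FG by simp
      obtain C where C: "\<And>\<omega>. \<bar>F j \<omega>\<bar> \<le> C" "\<And>\<omega>. norm (G j \<omega>) \<le> C" using smooth_grad_bounded[OF sgj] by blast
      have "AE \<omega> in \<mu>. norm (F j \<omega>) \<le> C" by (rule AE_I2) (simp add: C(1))
      then show "integrable \<mu> (F j)" by (rule integrable_const_bound) (rule smooth_grad_measurable(1)[OF sgj])
    qed
  qed
  have "(\<lambda>n. \<integral>\<^sup>+\<omega>. ennreal (norm (u' n \<omega> - u \<omega>)) \<partial>\<mu>) \<longlonglongrightarrow> 0"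
    by (rule Lp_conv_L1[OF conv p]) (rule smooth_grad_H_measurable(1)[OF sg], rule um)
  from integrable_L1_limit[OF int um this] show ?thesis .
qed

lemma const_in_sobolev_H_1: "(\<lambda>_. h) \<in> sobolev_H_1 \<mu> \<iota> p"
proof -
  have "Lp_conv \<mu> p (\<lambda>_ _. h) (\<lambda>_. h)" by (simp add: Lp_conv_def Lp_null_def)
  moreover have "Lp_conv_HS \<mu> p (\<lambda>_ _. 0 :: 'h \<Rightarrow>\<^sub>L 'h) (\<lambda>_. 0)"
    by (simp add: Lp_conv_HS_def Lp_null_def hs_zero)
  moreover have "\<forall>n. smooth_grad_H \<iota> ((\<lambda>(_::nat) _. h) n) ((\<lambda>_ _. 0) n)" by (simp add: smooth_grad_H_const)
  ultimately have "\<exists>K u' K'. (\<forall>n. smooth_grad_H \<iota> (u' n) (K' n)) \<and> Lp_conv \<mu> p u' (\<lambda>_. h) \<and> Lp_conv_HS \<mu> p K' K"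
    by (intro exI conjI)
  then show ?thesis unfolding sobolev_H_1_def by simp
qed

text \<open>
  Expanding the argument in the basis reduces the claim to the variables \<open>A e\<^sub>i\<close>.
\<close>

lemma random_operator_measurable:
  fixes A :: "'w \<Rightarrow> 'h \<Rightarrow>\<^sub>L 'h"
  assumes A[measurable]: "\<And>h. (\<lambda>\<omega>. A \<omega> h) \<in> borel_measurable \<mu>" and g[measurable]: "g \<in> borel_measurable \<mu>"
  shows "(\<lambda>\<omega>. A \<omega> (g \<omega>)) \<in> borel_measurable \<mu>"
proof (rule borel_measurable_LIMSEQ_metric)
  show "(\<lambda>n. A \<omega> (proj n (g \<omega>))) \<longlonglongrightarrow> A \<omega> (g \<omega>)" for \<omega> by (intro tendsto_intros proj_LIMSEQ)
  show "(\<lambda>\<omega>. A \<omega> (proj n (g \<omega>))) \<in> borel_measurable \<mu>" for n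
    unfolding proj_def blinfun.sum_right blinfun.scaleR_right by measurable
qed

lemma sin_quotient_LIMSEQ:
  "(\<lambda>k. sin (inverse (real (Suc k)) * x) / inverse (real (Suc k))) \<longlonglongrightarrow> x"
proof -
  have "((\<lambda>h. sin (h * x)) has_real_derivative cos (0 * x) * (1 * x)) (at 0)"
    by (intro DERIV_fun_sin DERIV_cmult_right DERIV_ident)
  then have "((\<lambda>h. sin (h * x) / h) \<longlongrightarrow> x) (at 0)" by (simp add: DERIV_def)
  then show ?thesis
    by (rule filterlim_compose) (unfold filterlim_at, simp del: of_nat_Suc add: LIMSEQ_inverse_real_of_nat)
qed

text \<open>
  The truncation \<open>sin (s f) / s\<close> is bounded by \<open>|f|\<close> and converges to \<open>f\<close> as \<open>s\<close> tends to 0, so for bounded \<open>f\<close> it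
  can be removed by dominated convergence.
\<close>

lemma bounded_duality:
  fixes f d ag :: "'w \<Rightarrow> real" and a :: "'w \<Rightarrow> 'h"
  assumes div: "has_divergence \<mu> \<iota> a d" and sg: "\<And>n. smooth_grad \<iota> (F n) (G n)"
    and F: "AE \<omega> in \<mu>. (\<lambda>n. F n \<omega>) \<longlonglongrightarrow> f \<omega>" and f[measurable]: "f \<in> borel_measurable \<mu>"
    and ag: "integrable \<mu> ag" "(\<lambda>n. \<integral>\<^sup>+\<omega>. ennreal \<bar>a \<omega> \<bullet> G n \<omega> - ag \<omega>\<bar> \<partial>\<mu>) \<longlonglongrightarrow> 0"
    and \<psi>: "smooth_grad \<iota> \<psi> g" and bd: "\<And>\<omega>. \<bar>f \<omega>\<bar> \<le> C0"
  shows "(\<integral>\<omega>. \<psi> \<omega> * ag \<omega> \<partial>\<mu>) + (\<integral>\<omega>. f \<omega> * (a \<omega> \<bullet> g \<omega>) \<partial>\<mu>) = (\<integral>\<omega>. f \<omega> * \<psi> \<omega> * d \<omega> \<partial>\<mu>)"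
proof -
  have ia: "integrable \<mu> a" and id: "integrable \<mu> d" using div unfolding has_divergence_def by auto
  note [measurable] = borel_measurable_integrable[OF ia] borel_measurable_integrable[OF id] borel_measurable_integrable[OF ag(1)]
    smooth_grad_measurable[OF \<psi>]
  obtain C where C: "\<And>\<omega>. \<bar>\<psi> \<omega>\<bar> \<le> C" "\<And>\<omega>. norm (g \<omega>) \<le> C" using smooth_grad_bounded[OF \<psi>] by blast
  have C0: "0 \<le> C" "0 \<le> C0" using C(1)[of 0] bd[of 0] by auto
  define s where "s k = inverse (real (Suc k))" for k
  have s: "0 < s k" for k by (simp add: s_def)
  have sl: "s \<longlonglongrightarrow> 0" unfolding s_def by (rule LIMSEQ_inverse_real_of_nat)
  define h where "h k \<omega> = sin (s k * f \<omega>) / s k" for k \<omega>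
  have [measurable]: "h k \<in> borel_measurable \<mu>" for k unfolding h_def[abs_def] by measurable
  have hl: "(\<lambda>k. h k \<omega>) \<longlonglongrightarrow> f \<omega>" for \<omega> unfolding h_def s_def by (rule sin_quotient_LIMSEQ)
  have hb: "\<bar>h k \<omega>\<bar> \<le> C0" for k \<omega>
  proof -
    have "\<bar>sin (s k * f \<omega>)\<bar> \<le> s k * \<bar>f \<omega>\<bar>" using abs_sin_x_le_abs_x[of "s k * f \<omega>"] s[of k] by (simp add: abs_mult)
    then have "\<bar>h k \<omega>\<bar> \<le> \<bar>f \<omega>\<bar>" unfolding h_def using s[of k] by (simp add: abs_divide divide_le_eq mult.commute)
    then show ?thesis using bd[of \<omega>] by simp
  qed
  have dual: "(\<integral>\<omega>. \<psi> \<omega> * cos (s k * f \<omega>) * ag \<omega> \<partial>\<mu>) + (\<integral>\<omega>. h k \<omega> * (a \<omega> \<bullet> g \<omega>) \<partial>\<mu>) = (\<integral>\<omega>. h k \<omega> * \<psi> \<omega> * d \<omega> \<partial>\<mu>)" for k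
  proof -
    have "(\<integral>\<omega>. s k * (\<psi> \<omega> * cos (s k * f \<omega>) * ag \<omega>) \<partial>\<mu>) + (\<integral>\<omega>. s k * (h k \<omega> * (a \<omega> \<bullet> g \<omega>)) \<partial>\<mu>)
       = (\<integral>\<omega>. s k * (h k \<omega> * \<psi> \<omega> * d \<omega>) \<partial>\<mu>)"
      using truncated_duality[OF div sg F f ag \<psi>, of "s k" 0] s[of k] by (simp add: h_def mult_ac)
    then have "s k * ((\<integral>\<omega>. \<psi> \<omega> * cos (s k * f \<omega>) * ag \<omega> \<partial>\<mu>) + (\<integral>\<omega>. h k \<omega> * (a \<omega> \<bullet> g \<omega>) \<partial>\<mu>)) = s k * (\<integral>\<omega>. h k \<omega> * \<psi> \<omega> * d \<omega> \<partial>\<mu>)"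
      by (simp only: integral_mult_right_zero distrib_left)
    then show ?thesis using s[of k] by simp
  qed
  have 1: "(\<lambda>k. \<integral>\<omega>. \<psi> \<omega> * cos (s k * f \<omega>) * ag \<omega> \<partial>\<mu>) \<longlonglongrightarrow> (\<integral>\<omega>. \<psi> \<omega> * ag \<omega> \<partial>\<mu>)"
  proof (rule integral_dominated_convergence)
    show "integrable \<mu> (\<lambda>\<omega>. C * \<bar>ag \<omega>\<bar>)" using ag(1) by auto
    show "AE \<omega> in \<mu>. (\<lambda>k. \<psi> \<omega> * cos (s k * f \<omega>) * ag \<omega>) \<longlonglongrightarrow> \<psi> \<omega> * ag \<omega>"
    proof (rule AE_I2)
      fix \<omega>
      have "(\<lambda>k. \<psi> \<omega> * cos (s k * f \<omega>) * ag \<omega>) \<longlonglongrightarrow> \<psi> \<omega> * cos (0 * f \<omega>) * ag \<omega>" by (intro tendsto_intros sl)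
      then show "(\<lambda>k. \<psi> \<omega> * cos (s k * f \<omega>) * ag \<omega>) \<longlonglongrightarrow> \<psi> \<omega> * ag \<omega>" by simp
    qed
    have "\<bar>\<psi> \<omega>\<bar> * \<bar>cos r\<bar> \<le> C" for r \<omega>
      using mult_mono[OF C(1)[of \<omega>] abs_cos_le_one[of r]] C0 by simp
    then show "AE \<omega> in \<mu>. norm (\<psi> \<omega> * cos (s k * f \<omega>) * ag \<omega>) \<le> C * \<bar>ag \<omega>\<bar>" for k
      by (auto simp: abs_mult intro!: mult_right_mono)
  qed measurable
  have 2: "(\<lambda>k. \<integral>\<omega>. h k \<omega> * (a \<omega> \<bullet> g \<omega>) \<partial>\<mu>) \<longlonglongrightarrow> (\<integral>\<omega>. f \<omega> * (a \<omega> \<bullet> g \<omega>) \<partial>\<mu>)"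
  proof (rule integral_dominated_convergence)
    show "integrable \<mu> (\<lambda>\<omega>. C0 * (C * norm (a \<omega>)))" using ia by auto
    show "AE \<omega> in \<mu>. (\<lambda>k. h k \<omega> * (a \<omega> \<bullet> g \<omega>)) \<longlonglongrightarrow> f \<omega> * (a \<omega> \<bullet> g \<omega>)"
      by (intro AE_I2 tendsto_intros hl)
    have "\<bar>a \<omega> \<bullet> g \<omega>\<bar> \<le> C * norm (a \<omega>)" for \<omega>
      using order_trans[OF Cauchy_Schwarz_ineq2 mult_left_mono[OF C(2) norm_ge_zero]] by (simp add: mult.commute)
    then have "\<bar>h k \<omega>\<bar> * \<bar>a \<omega> \<bullet> g \<omega>\<bar> \<le> C0 * (C * norm (a \<omega>))" for k \<omega>
      using hb C0 by (intro mult_mono) auto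
    then show "AE \<omega> in \<mu>. norm (h k \<omega> * (a \<omega> \<bullet> g \<omega>)) \<le> C0 * (C * norm (a \<omega>))" for k
      by (intro AE_I2) (simp add: abs_mult)
  qed measurable
  have 3: "(\<lambda>k. \<integral>\<omega>. h k \<omega> * \<psi> \<omega> * d \<omega> \<partial>\<mu>) \<longlonglongrightarrow> (\<integral>\<omega>. f \<omega> * \<psi> \<omega> * d \<omega> \<partial>\<mu>)"
  proof (rule integral_dominated_convergence)
    show "integrable \<mu> (\<lambda>\<omega>. C0 * C * \<bar>d \<omega>\<bar>)" using id by auto
    show "AE \<omega> in \<mu>. (\<lambda>k. h k \<omega> * \<psi> \<omega> * d \<omega>) \<longlonglongrightarrow> f \<omega> * \<psi> \<omega> * d \<omega>"
      by (intro AE_I2 tendsto_intros hl)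
    have "\<bar>h k \<omega>\<bar> * \<bar>\<psi> \<omega>\<bar> \<le> C0 * C" for k \<omega> using hb C C0 by (intro mult_mono) auto
    then show "AE \<omega> in \<mu>. norm (h k \<omega> * \<psi> \<omega> * d \<omega>) \<le> C0 * C * \<bar>d \<omega>\<bar>" for k
      by (intro AE_I2) (simp add: abs_mult mult_right_mono)
  qed measurable
  show ?thesis using LIMSEQ_unique[OF _ 3] tendsto_add[OF 1 2] unfolding dual by blast
qed

end

section \<open>The transport equation\<close>

context wiener_basis begin

text \<open>
  The derivative along the flow of the functional \<open>\<phi>(l\<^sub>0, l\<^sub>1, \<dots>)\<close> at the starting point: the pairing of its
  differential with the vector field \<open>B\<close>.
\<close>

definition flow_rate :: "('w \<Rightarrow> 'w) \<Rightarrow> nat \<Rightarrow> (nat \<Rightarrow> 'w \<Rightarrow>\<^sub>L real) \<Rightarrow> ((nat \<Rightarrow> real) \<Rightarrow> real) \<Rightarrow> 'w \<Rightarrow> real" where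
  "flow_rate B n l \<phi> \<omega> = (\<Sum>j<n. pd j \<phi> (\<lambda>i. l i \<omega>) * l j (B \<omega>))"

lemma integrable_bounded_scaleR:
  fixes v :: "'w \<Rightarrow> 'b::{banach, second_countable_topology}"
  assumes v: "integrable \<mu> v" and c[measurable]: "c \<in> borel_measurable \<mu>" and b: "\<And>\<omega>. \<bar>c \<omega>\<bar> \<le> C"
  shows "integrable \<mu> (\<lambda>\<omega>. c \<omega> *\<^sub>R v \<omega>)"
proof (rule Bochner_Integration.integrable_bound[OF integrable_scaleR_right[OF v, of C]])
  note [measurable] = borel_measurable_integrable[OF v]
  show "(\<lambda>\<omega>. c \<omega> *\<^sub>R v \<omega>) \<in> borel_measurable \<mu>" by measurable
  have "\<bar>c \<omega>\<bar> \<le> \<bar>C\<bar>" for \<omega> using b[of \<omega>] by linarith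
  then show "AE \<omega> in \<mu>. norm (c \<omega> *\<^sub>R v \<omega>) \<le> norm (C *\<^sub>R v \<omega>)" by (intro AE_I2) (simp add: mult_right_mono)
qed

lemma integrable_bounded_mult:
  fixes v :: "'w \<Rightarrow> real"
  assumes "integrable \<mu> v" "c \<in> borel_measurable \<mu>" "\<And>\<omega>. \<bar>c \<omega>\<bar> \<le> C"
  shows "integrable \<mu> (\<lambda>\<omega>. c \<omega> * v \<omega>)"
  using integrable_bounded_scaleR[OF assms] by simp

lemma cylinder_measurable: "Cb_infinity n \<phi> \<Longrightarrow> (\<lambda>\<omega>. \<phi> (\<lambda>j. blinfun_apply (l j) \<omega>)) \<in> borel_measurable \<mu>"
  by (rule borel_measurable_continuous[OF cylinder_continuous])

lemma flow_rate_integrable: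
  fixes l :: "nat \<Rightarrow> 'w \<Rightarrow>\<^sub>L real"
  assumes \<phi>: "Cb_infinity n \<phi>" and B: "integrable \<mu> B"
  shows "integrable \<mu> (flow_rate B n l \<phi>)"
  unfolding flow_rate_def[abs_def]
proof (rule Bochner_Integration.integrable_sum)
  fix j assume "j \<in> {..<n}"
  then have pd: "Cb_infinity n (pd j \<phi>)" using Cb_pd[OF \<phi>] by simp
  obtain C where C: "\<forall>x. \<bar>pd j \<phi> x\<bar> \<le> C" using Cb_bound[OF pd] by blast
  show "integrable \<mu> (\<lambda>\<omega>. pd j \<phi> (\<lambda>i. l i \<omega>) * l j (B \<omega>))"
  proof (rule integrable_bounded_mult[where C = C])
    show "integrable \<mu> (\<lambda>\<omega>. l j (B \<omega>))" by (rule integrable_bounded_linear[OF blinfun.bounded_linear_right B])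
    show "(\<lambda>\<omega>. pd j \<phi> (\<lambda>i. l i \<omega>)) \<in> borel_measurable \<mu>" by (rule cylinder_measurable[OF pd])
  qed (use C in simp)
qed

lemma flow_rate_derivative:
  fixes l :: "nat \<Rightarrow> 'w \<Rightarrow>\<^sub>L real"
  assumes \<phi>: "Cb_infinity n \<phi>" and T: "((\<lambda>s. T s \<omega>) has_vector_derivative B (T t \<omega>)) (at t)"
  shows "((\<lambda>s. \<phi> (\<lambda>j. l j (T s \<omega>))) has_real_derivative flow_rate B n l \<phi> (T t \<omega>)) (at t)"
proof -
  have "((\<lambda>s. l j (T s \<omega>)) has_real_derivative l j (B (T t \<omega>))) (at t)" for j
    using bounded_linear.has_vector_derivative[OF blinfun.bounded_linear_right T, of "l j"]
    by (simp add: has_real_derivative_iff_has_vector_derivative)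
  from Cb_chain_rule[OF \<phi>, of "\<lambda>s j. l j (T s \<omega>)", OF this] show ?thesis by (simp add: flow_rate_def)
qed

lemma flow_quotient_L1:
  fixes l :: "nat \<Rightarrow> 'w \<Rightarrow>\<^sub>L real"
  assumes \<phi>: "Cb_infinity n \<phi>" and B: "integrable \<mu> B" and st: "stationary_process \<mu> T"
    and ode: "AE \<omega> in \<mu>. \<forall>t. ((\<lambda>s. T s \<omega>) has_vector_derivative B (T t \<omega>)) (at t)"
    and \<epsilon>: "\<epsilon> \<longlonglongrightarrow> 0" "\<And>k. \<epsilon> k \<noteq> (0 :: real)"
  shows "(\<lambda>k. \<integral>\<^sup>+\<omega>. ennreal \<bar>(\<phi> (\<lambda>j. l j (T (t + \<epsilon> k) \<omega>)) - \<phi> (\<lambda>j. l j (T t \<omega>))) / \<epsilon> k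
      - flow_rate B n l \<phi> (T t \<omega>)\<bar> \<partial>\<mu>) \<longlonglongrightarrow> 0"
proof (rule difference_quotient_L1[where X = "\<lambda>s \<omega>. \<phi> (\<lambda>j. l j (T s \<omega>))" and Y = "\<lambda>s \<omega>. flow_rate B n l \<phi> (T s \<omega>)", OF _ _ _ _ _ \<epsilon>])
  have Tm: "T s \<in> measurable \<mu> \<mu>" and Td: "distr \<mu> \<mu> (T s) = \<mu>" and T0: "T 0 \<omega> = \<omega>" for s \<omega>
    using st unfolding stationary_process_def by auto
  have rm: "flow_rate B n l \<phi> \<in> borel_measurable \<mu>" by (rule borel_measurable_integrable[OF flow_rate_integrable[OF \<phi> B]])
  show "(\<lambda>\<omega>. \<phi> (\<lambda>j. l j (T s \<omega>))) \<in> borel_measurable \<mu>" for s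
    by (rule measurable_compose[OF Tm cylinder_measurable[OF \<phi>]])
  show "(\<lambda>\<omega>. flow_rate B n l \<phi> (T s \<omega>)) \<in> borel_measurable \<mu>" for s by (rule measurable_compose[OF Tm rm])
  have "distr \<mu> borel (\<lambda>\<omega>. flow_rate B n l \<phi> (T s \<omega>)) = distr \<mu> borel (flow_rate B n l \<phi>)" for s
    using distr_distr[OF rm Tm[of s]] unfolding Td by (simp add: comp_def)
  then show "distr \<mu> borel (\<lambda>\<omega>. flow_rate B n l \<phi> (T s \<omega>)) = distr \<mu> borel (\<lambda>\<omega>. flow_rate B n l \<phi> (T 0 \<omega>))" for s by simp
  show "integrable \<mu> (\<lambda>\<omega>. flow_rate B n l \<phi> (T 0 \<omega>))" unfolding T0 by (rule flow_rate_integrable[OF \<phi> B])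
  show "AE \<omega> in \<mu>. \<forall>s. ((\<lambda>s. \<phi> (\<lambda>j. l j (T s \<omega>))) has_real_derivative flow_rate B n l \<phi> (T s \<omega>)) (at s)"
    using ode by eventually_elim (blast intro: flow_rate_derivative[OF \<phi>])
qed

text \<open>
  Stationarity transfers a time shift by \<open>\<epsilon>\<close> of one factor into a shift by \<open>- \<epsilon>\<close> of the other one.
\<close>

lemma flow_antisymmetry:
  fixes k l :: "nat \<Rightarrow> 'w \<Rightarrow>\<^sub>L real"
  assumes \<phi>: "Cb_infinity n \<phi>" and \<psi>: "Cb_infinity m \<psi>" and B: "integrable \<mu> B" and st: "stationary_process \<mu> T"
    and ode: "AE \<omega> in \<mu>. \<forall>t. ((\<lambda>s. T s \<omega>) has_vector_derivative B (T t \<omega>)) (at t)"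
  shows "(\<integral>\<omega>. \<psi> (\<lambda>j. k j \<omega>) * flow_rate B n l \<phi> (T t \<omega>) \<partial>\<mu>) = - (\<integral>\<omega>. \<phi> (\<lambda>j. l j (T t \<omega>)) * flow_rate B m k \<psi> \<omega> \<partial>\<mu>)"
proof -
  have Tm: "T s \<in> measurable \<mu> \<mu>" and Td: "distr \<mu> \<mu> (T s) = \<mu>" and T0: "T 0 \<omega> = \<omega>" for s \<omega>
    using st unfolding stationary_process_def by auto
  define F where "F \<omega> = \<phi> (\<lambda>j. l j \<omega>)" for \<omega>
  define P where "P \<omega> = \<psi> (\<lambda>j. k j \<omega>)" for \<omega>
  have Ps: "smooth_functional P" and Fs: "smooth_functional F"
    unfolding smooth_functional_def cylinder_def P_def[abs_def] F_def[abs_def] using \<phi> \<psi> by blast+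
  have Pm: "P \<in> borel_measurable \<mu>" and Fm: "F \<in> borel_measurable \<mu>"
    using Ps Fs smooth_functional_measurable by auto
  obtain C where C: "\<forall>x. \<bar>\<phi> x\<bar> \<le> C" using Cb_bound[OF \<phi>] by blast
  obtain D where D: "\<forall>x. \<bar>\<psi> x\<bar> \<le> D" using Cb_bound[OF \<psi>] by blast
  have C0: "0 \<le> C" "0 \<le> D" using C D by (meson abs_ge_zero order_trans)+
  define \<epsilon> where "\<epsilon> i = inverse (real (Suc i))" for i
  have \<epsilon>0: "\<epsilon> i \<noteq> 0" for i by (simp add: \<epsilon>_def)
  have \<epsilon>l: "\<epsilon> \<longlonglongrightarrow> 0" unfolding \<epsilon>_def by (rule LIMSEQ_inverse_real_of_nat)
  \<comment> \<open>difference quotients that converge in \<open>L\<^sup>1\<close> may be tested against a bounded \<open>V\<close>; used once for either factor\<close>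
  have main: "(\<lambda>i. \<integral>\<omega>. V \<omega> * ((U (T (r + \<delta> i) \<omega>) - U (T r \<omega>)) / \<delta> i) \<partial>\<mu>) \<longlonglongrightarrow> (\<integral>\<omega>. V \<omega> * c (T r \<omega>) \<partial>\<mu>)"
    if Um: "U \<in> borel_measurable \<mu>" and Ub: "\<And>\<omega>. \<bar>U \<omega>\<bar> \<le> K" and cint: "integrable \<mu> c" and Vm: "V \<in> borel_measurable \<mu>" and Vb: "\<And>\<omega>. \<bar>V \<omega>\<bar> \<le> L"
      and lim: "(\<lambda>i. \<integral>\<^sup>+\<omega>. ennreal \<bar>(U (T (r + \<delta> i) \<omega>) - U (T r \<omega>)) / \<delta> i - c (T r \<omega>)\<bar> \<partial>\<mu>) \<longlonglongrightarrow> 0"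
    for U V c :: "'w \<Rightarrow> real" and K L r and \<delta> :: "nat \<Rightarrow> real"
  proof -
    note [measurable] = Vm measurable_compose[OF Tm Um] measurable_compose[OF Tm borel_measurable_integrable[OF cint]]
    have cT: "integrable \<mu> (\<lambda>\<omega>. c (T r \<omega>))"
      using cint integrable_distr_eq[OF Tm[of r] borel_measurable_integrable[OF cint]] unfolding Td by simp
    have L0: "0 \<le> L" using Vb[of 0] by simp
    have iU: "integrable \<mu> (\<lambda>\<omega>. U (T s \<omega>))" for s
      by (rule integrable_const_bound[of _ K]) (use Ub in auto)
    have "(\<lambda>i. \<integral>\<omega>. V \<omega> * ((U (T (r + \<delta> i) \<omega>) - U (T r \<omega>)) / \<delta> i - c (T r \<omega>)) \<partial>\<mu>) \<longlonglongrightarrow> 0"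
    proof (rule nn_L1_integral_LIMSEQ_zero[OF _ lim, of _ L])
      show "(\<lambda>\<omega>. (U (T (r + \<delta> i) \<omega>) - U (T r \<omega>)) / \<delta> i - c (T r \<omega>)) \<in> borel_measurable \<mu>" for i by measurable
      show "\<bar>V \<omega> * ((U (T (r + \<delta> i) \<omega>) - U (T r \<omega>)) / \<delta> i - c (T r \<omega>))\<bar> \<le> L * \<bar>(U (T (r + \<delta> i) \<omega>) - U (T r \<omega>)) / \<delta> i - c (T r \<omega>)\<bar>" for i \<omega>
        unfolding abs_mult by (rule mult_right_mono[OF Vb]) simp
    qed (rule L0)
    moreover have "(\<integral>\<omega>. V \<omega> * ((U (T (r + \<delta> i) \<omega>) - U (T r \<omega>)) / \<delta> i - c (T r \<omega>)) \<partial>\<mu>)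
      = (\<integral>\<omega>. V \<omega> * ((U (T (r + \<delta> i) \<omega>) - U (T r \<omega>)) / \<delta> i) \<partial>\<mu>) - (\<integral>\<omega>. V \<omega> * c (T r \<omega>) \<partial>\<mu>)" for i
      unfolding right_diff_distrib[of _ "_ / _"]
      by (rule Bochner_Integration.integral_diff)
        (intro integrable_bounded_mult[OF _ Vm Vb] cT integrable_divide Bochner_Integration.integrable_diff iU)+
    ultimately show ?thesis by (simp add: LIM_zero_cancel)
  qed
  have L1: "(\<lambda>i. \<integral>\<omega>. P \<omega> * ((F (T (t + \<epsilon> i) \<omega>) - F (T t \<omega>)) / \<epsilon> i) \<partial>\<mu>) \<longlonglongrightarrow> (\<integral>\<omega>. P \<omega> * flow_rate B n l \<phi> (T t \<omega>) \<partial>\<mu>)"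
    by (rule main[OF Fm _ flow_rate_integrable[OF \<phi> B] Pm, of C D])
      (use C D flow_quotient_L1[OF \<phi> B st ode \<epsilon>l \<epsilon>0, of l t] in \<open>simp_all add: F_def P_def\<close>)
  have n0: "- \<epsilon> i \<noteq> 0" for i using \<epsilon>0 by simp
  have nl: "(\<lambda>i. - \<epsilon> i) \<longlonglongrightarrow> 0" using tendsto_minus[OF \<epsilon>l] by simp
  have FTm: "(\<lambda>\<omega>. F (T t \<omega>)) \<in> borel_measurable \<mu>" by (rule measurable_compose[OF Tm Fm])
  have L2: "(\<lambda>i. \<integral>\<omega>. F (T t \<omega>) * ((P (T (0 + - \<epsilon> i) \<omega>) - P (T 0 \<omega>)) / (- \<epsilon> i)) \<partial>\<mu>) \<longlonglongrightarrow> (\<integral>\<omega>. F (T t \<omega>) * flow_rate B m k \<psi> (T 0 \<omega>) \<partial>\<mu>)"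
    by (rule main[OF Pm _ flow_rate_integrable[OF \<psi> B] FTm, of D C])
      (use C D flow_quotient_L1[OF \<psi> B st ode nl n0, of k 0] in \<open>simp_all add: F_def P_def\<close>)
  have swap: "(\<integral>\<omega>. P \<omega> * ((F (T (t + \<epsilon> i) \<omega>) - F (T t \<omega>)) / \<epsilon> i) \<partial>\<mu>) = - (\<integral>\<omega>. F (T t \<omega>) * ((P (T (0 + - \<epsilon> i) \<omega>) - P (T 0 \<omega>)) / (- \<epsilon> i)) \<partial>\<mu>)" for i
  proof -
    have int: "integrable \<mu> (\<lambda>\<omega>. P (T r \<omega>) * F (T s \<omega>))" for r s
    proof (rule integrable_const_bound[of _ "D * C"])
      show "AE \<omega> in \<mu>. norm (P (T r \<omega>) * F (T s \<omega>)) \<le> D * C"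
        by (intro AE_I2) (simp add: abs_mult, intro mult_mono, simp_all add: P_def F_def C D C0)
      show "(\<lambda>\<omega>. P (T r \<omega>) * F (T s \<omega>)) \<in> borel_measurable \<mu>"
        by (intro borel_measurable_times measurable_compose[OF Tm] Pm Fm)
    qed
    have "(\<integral>\<omega>. P (T 0 \<omega>) * F (T (t + \<epsilon> i) \<omega>) \<partial>\<mu>) = (\<integral>\<omega>. P (T (0 + - \<epsilon> i) \<omega>) * F (T (t + \<epsilon> i + - \<epsilon> i) \<omega>) \<partial>\<mu>)"
      by (rule stationary_product[OF st Ps Fs])
    then have shift: "(\<integral>\<omega>. P (T 0 \<omega>) * F (T (t + \<epsilon> i) \<omega>) \<partial>\<mu>) = (\<integral>\<omega>. P (T (- \<epsilon> i) \<omega>) * F (T t \<omega>) \<partial>\<mu>)" by simp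
    have "(\<integral>\<omega>. P \<omega> * ((F (T (t + \<epsilon> i) \<omega>) - F (T t \<omega>)) / \<epsilon> i) \<partial>\<mu>)
      = (\<integral>\<omega>. (P (T 0 \<omega>) * F (T (t + \<epsilon> i) \<omega>) - P (T 0 \<omega>) * F (T t \<omega>)) / \<epsilon> i \<partial>\<mu>)"
      by (simp add: T0 right_diff_distrib)
    also have "\<dots> = ((\<integral>\<omega>. P (T (- \<epsilon> i) \<omega>) * F (T t \<omega>) \<partial>\<mu>) - (\<integral>\<omega>. P (T 0 \<omega>) * F (T t \<omega>) \<partial>\<mu>)) / \<epsilon> i"
      unfolding integral_divide_zero Bochner_Integration.integral_diff[OF int int] shift ..
    also have "\<dots> = (\<integral>\<omega>. (P (T (- \<epsilon> i) \<omega>) * F (T t \<omega>) - P (T 0 \<omega>) * F (T t \<omega>)) / \<epsilon> i \<partial>\<mu>)"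
      unfolding integral_divide_zero Bochner_Integration.integral_diff[OF int int] ..
    also have "\<dots> = (\<integral>\<omega>. - (F (T t \<omega>) * ((P (T (0 + - \<epsilon> i) \<omega>) - P (T 0 \<omega>)) / (- \<epsilon> i))) \<partial>\<mu>)"
      by (intro Bochner_Integration.integral_cong refl) (simp add: right_diff_distrib mult.commute)
    also have "\<dots> = - (\<integral>\<omega>. F (T t \<omega>) * ((P (T (0 + - \<epsilon> i) \<omega>) - P (T 0 \<omega>)) / (- \<epsilon> i)) \<partial>\<mu>)" by (rule Bochner_Integration.integral_minus)
    finally show ?thesis .
  qed
  have "(\<lambda>i. \<integral>\<omega>. P \<omega> * ((F (T (t + \<epsilon> i) \<omega>) - F (T t \<omega>)) / \<epsilon> i) \<partial>\<mu>) \<longlonglongrightarrow> - (\<integral>\<omega>. F (T t \<omega>) * flow_rate B m k \<psi> (T 0 \<omega>) \<partial>\<mu>)"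
    using tendsto_minus[OF L2] by (simp only: swap)
  from LIMSEQ_unique[OF L1 this] show ?thesis by (simp add: P_def F_def T0)
qed

lemma antisymmetric_sum_zero:
  fixes c q :: "nat \<Rightarrow> nat \<Rightarrow> real"
  assumes "\<And>i j. i < n \<Longrightarrow> j < n \<Longrightarrow> c i j = c j i" "\<And>i j. q i j = - q j i"
  shows "(\<Sum>j<n. \<Sum>i<n. c i j * q i j) = 0"
proof -
  have "(\<Sum>j<n. \<Sum>i<n. c i j * q i j) = (\<Sum>i<n. \<Sum>j<n. c i j * q i j)" by (rule sum.swap)
  also have "\<dots> = (\<Sum>i<n. \<Sum>j<n. - (c j i * q j i))"
  proof (intro sum.cong refl)
    fix i j assume "i \<in> {..<n}" "j \<in> {..<n}"
    then show "c i j * q i j = - (c j i * q j i)" using assms(1)[of i j] assms(2)[of i j] by simp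
  qed
  also have "\<dots> = - (\<Sum>j<n. \<Sum>i<n. c i j * q i j)" by (simp add: sum_negf)
  finally show ?thesis by simp
qed

lemma integral_double_sum:
  fixes F :: "nat \<Rightarrow> nat \<Rightarrow> 'a \<Rightarrow> real"
  assumes "\<And>j i. j < n \<Longrightarrow> integrable M (F j i)"
  shows "(\<integral>\<omega>. (\<Sum>j<n. \<Sum>i<N. c j i * F j i \<omega>) \<partial>M) = (\<Sum>j<n. \<Sum>i<N. c j i * (\<integral>\<omega>. F j i \<omega> \<partial>M))"
proof -
  have int: "integrable M (\<lambda>\<omega>. c j i * F j i \<omega>)" if "j < n" for j i by (rule integrable_mult_right) (rule assms[OF that])
  have "(\<integral>\<omega>. (\<Sum>j<n. \<Sum>i<N. c j i * F j i \<omega>) \<partial>M) = (\<Sum>j<n. (\<integral>\<omega>. (\<Sum>i<N. c j i * F j i \<omega>) \<partial>M))"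
    by (rule Bochner_Integration.integral_sum) (rule Bochner_Integration.integrable_sum, rule int, simp)
  also have "\<dots> = (\<Sum>j<n. \<Sum>i<N. (\<integral>\<omega>. c j i * F j i \<omega> \<partial>M))"
    by (rule sum.cong[OF refl], rule Bochner_Integration.integral_sum) (rule int, simp)
  finally show ?thesis by (simp only: integral_mult_right_zero)
qed

text \<open>
  The vector field is replaced by the partial sums of its series, and the duality is applied to every
  term with \<open>\<psi> = \<partial>\<^sub>j\<phi>\<close>. Of the two resulting sums, \<open>X\<close> converges to the pairing with \<open>A H\<close>, and \<open>Y\<close>
  to the contraction of the symmetric Hessian of \<open>\<phi>\<close> with the skew form \<open>(A l\<^sub>i, l\<^sub>j)\<close>, which is 0.
  Skewness also provides integrable majorants, because it moves \<open>A\<close> away from the projections.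
\<close>

lemma drift_pairing:
  fixes A :: "'w \<Rightarrow> 'h \<Rightarrow>\<^sub>L 'h" and f :: "'w \<Rightarrow> real" and H :: "'w \<Rightarrow> 'h"
    and l :: "nat \<Rightarrow> 'w \<Rightarrow>\<^sub>L real"
  assumes skew: "AE \<omega> in \<mu>. skew_symmetric (A \<omega>)"
    and Aint: "\<And>h. integrable \<mu> (\<lambda>\<omega>. A \<omega> h)" and AH: "integrable \<mu> (\<lambda>\<omega>. A \<omega> (H \<omega>))"
    and Hm[measurable]: "H \<in> borel_measurable \<mu>"
    and dint: "\<And>i. integrable \<mu> (d i)" and B: "integrable \<mu> B"
    and series: "(\<lambda>N. \<integral>\<^sup>+\<omega>. ennreal \<bar>norm ((\<Sum>i<N. d i \<omega> *\<^sub>R \<iota> (e i)) - B \<omega>)\<bar> \<partial>\<mu>) \<longlonglongrightarrow> 0"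
    and fm[measurable]: "f \<in> borel_measurable \<mu>" and fb: "\<And>\<omega>. \<bar>f \<omega>\<bar> \<le> C0"
    and dual: "\<And>i \<psi> g. smooth_grad \<iota> \<psi> g \<Longrightarrow>
      (\<integral>\<omega>. \<psi> \<omega> * (A \<omega> (e i) \<bullet> H \<omega>) \<partial>\<mu>) + (\<integral>\<omega>. f \<omega> * (A \<omega> (e i) \<bullet> g \<omega>) \<partial>\<mu>) = (\<integral>\<omega>. f \<omega> * \<psi> \<omega> * d i \<omega> \<partial>\<mu>)"
    and \<phi>: "Cb_infinity n \<phi>"
  shows "(\<integral>\<omega>. f \<omega> * flow_rate B n l \<phi> \<omega> \<partial>\<mu>)
    = - (\<integral>\<omega>. A \<omega> (H \<omega>) \<bullet> (\<Sum>j<n. pd j \<phi> (\<lambda>i. l i \<omega>) *\<^sub>R dual_embed \<iota> (l j)) \<partial>\<mu>)"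
proof -
  define k where "k j = dual_embed \<iota> (l j)" for j
  define \<psi> where "\<psi> j \<omega> = pd j \<phi> (\<lambda>i. l i \<omega>)" for j \<omega>
  define h where "h i j \<omega> = pd i (pd j \<phi>) (\<lambda>i. l i \<omega>)" for i j \<omega>
  define g where "g j \<omega> = (\<Sum>i<n. h i j \<omega> *\<^sub>R k i)" for j \<omega>
  have sg: "smooth_grad \<iota> (\<psi> j) (g j)" if "j < n" for j
    by (rule smooth_gradI[OF Cb_gen[OF Cb_pd[OF \<phi> that]]]) (simp_all add: \<psi>_def g_def h_def k_def)
  have \<psi>m[measurable]: "\<psi> j \<in> borel_measurable \<mu>" if "j < n" for j by (rule smooth_grad_measurable(1)[OF sg[OF that]])
  have gm: "g j \<in> borel_measurable \<mu>" if "j < n" for j by (rule smooth_grad_measurable(2)[OF sg[OF that]])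
  have "\<forall>j\<in>{..<n}. \<exists>C. \<forall>x. \<bar>pd j \<phi> x\<bar> \<le> C" using Cb_bound[OF Cb_pd[OF \<phi>]] by simp
  from bchoice[OF this] obtain C where C: "\<And>j \<omega>. j < n \<Longrightarrow> \<bar>\<psi> j \<omega>\<bar> \<le> C j" by (auto simp: \<psi>_def)
  have C_nn: "0 \<le> C j" if "j < n" for j using C[OF that, of 0] by linarith
  have C00: "0 \<le> C0" using fb[of 0] by linarith
  have AeH: "AE \<omega> in \<mu>. A \<omega> (e i) \<bullet> H \<omega> = - (e i \<bullet> A \<omega> (H \<omega>))" for i
    using skew by eventually_elim (simp add: skew_symmetric_def)
  note Am[measurable] = borel_measurable_integrable[OF Aint]
  have AeH_int: "integrable \<mu> (\<lambda>\<omega>. A \<omega> (e i) \<bullet> H \<omega>)" for i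
  proof -
    have "integrable \<mu> (\<lambda>\<omega>. - (e i \<bullet> A \<omega> (H \<omega>)))" using AH by (intro integrable_minus integrable_inner_right) simp
    then show ?thesis by (rule integrable_cong_AE_imp) (measurable, use AeH[of i] in eventually_elim, simp)
  qed
  have Aeg_int: "integrable \<mu> (\<lambda>\<omega>. A \<omega> y \<bullet> g j \<omega>)" if j: "j < n" for y j
  proof -
    obtain D where D: "\<And>\<omega>. \<bar>\<psi> j \<omega>\<bar> \<le> D" "\<And>\<omega>. norm (g j \<omega>) \<le> D" using smooth_grad_bounded[OF sg[OF j]] by blast
    note [measurable] = gm[OF j]
    show ?thesis
    proof (rule Bochner_Integration.integrable_bound[OF integrable_mult_right[OF integrable_norm[OF Aint[of y]], of D]])
      show "AE \<omega> in \<mu>. norm (A \<omega> y \<bullet> g j \<omega>) \<le> norm (D * norm (A \<omega> y))"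
      proof (rule AE_I2)
        fix \<omega>
        have "\<bar>A \<omega> y \<bullet> g j \<omega>\<bar> \<le> norm (A \<omega> y) * norm (g j \<omega>)" by (rule Cauchy_Schwarz_ineq2)
        also have "\<dots> \<le> norm (A \<omega> y) * D" by (rule mult_left_mono[OF D(2)]) simp
        finally show "norm (A \<omega> y \<bullet> g j \<omega>) \<le> norm (D * norm (A \<omega> y))" by (simp add: mult.commute)
      qed
    qed measurable
  qed
  define S where "S N \<omega> = (\<Sum>i<N. d i \<omega> *\<^sub>R \<iota> (e i))" for N \<omega>
  have Sint: "integrable \<mu> (S N)" for N unfolding S_def[abs_def] using dint by (intro Bochner_Integration.integrable_sum integrable_scaleR_left)
  have lS: "l j (S N \<omega>) = (\<Sum>i<N. (k j \<bullet> e i) * d i \<omega>)" for j N \<omega>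
    by (simp add: S_def blinfun.sum_right blinfun.scaleR_right k_def inner_dual_embed mult.commute)
  have f\<psi>d: "integrable \<mu> (\<lambda>\<omega>. f \<omega> * \<psi> j \<omega> * u \<omega>)" if j: "j < n" and u: "integrable \<mu> u" for j u
  proof (rule integrable_bounded_mult[OF u, where C = "C0 * C j"])
    show "(\<lambda>\<omega>. f \<omega> * \<psi> j \<omega>) \<in> borel_measurable \<mu>" using \<psi>m[OF j] by measurable
    show "\<bar>f \<omega> * \<psi> j \<omega>\<bar> \<le> C0 * C j" for \<omega> unfolding abs_mult by (intro mult_mono fb C[OF j] C00) simp
  qed
  define X where "X N \<omega> = (\<Sum>j<n. \<psi> j \<omega> * (proj N (k j) \<bullet> A \<omega> (H \<omega>)))" for N \<omega>
  define Y where "Y N \<omega> = (\<Sum>j<n. A \<omega> (proj N (k j)) \<bullet> g j \<omega>)" for N \<omega>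
  have partial: "(\<integral>\<omega>. f \<omega> * (\<Sum>j<n. \<psi> j \<omega> * l j (S N \<omega>)) \<partial>\<mu>) = - (\<integral>\<omega>. X N \<omega> \<partial>\<mu>) + (\<integral>\<omega>. f \<omega> * Y N \<omega> \<partial>\<mu>)" for N
  proof -
    have "f \<omega> * (\<Sum>j<n. \<psi> j \<omega> * l j (S N \<omega>)) = (\<Sum>j<n. \<Sum>i<N. (k j \<bullet> e i) * (f \<omega> * \<psi> j \<omega> * d i \<omega>))" for \<omega>
      unfolding lS sum_distrib_left by (intro sum.cong refl) (simp only: mult_ac)
    then have "(\<integral>\<omega>. f \<omega> * (\<Sum>j<n. \<psi> j \<omega> * l j (S N \<omega>)) \<partial>\<mu>)
        = (\<integral>\<omega>. (\<Sum>j<n. \<Sum>i<N. (k j \<bullet> e i) * (f \<omega> * \<psi> j \<omega> * d i \<omega>)) \<partial>\<mu>)" by (simp only:)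
    also have "\<dots> = (\<Sum>j<n. \<Sum>i<N. (k j \<bullet> e i) * (\<integral>\<omega>. f \<omega> * \<psi> j \<omega> * d i \<omega> \<partial>\<mu>))"
      by (rule integral_double_sum) (rule f\<psi>d[OF _ dint])
    also have "\<dots> = (\<Sum>j<n. \<Sum>i<N. (k j \<bullet> e i) * (\<integral>\<omega>. \<psi> j \<omega> * (A \<omega> (e i) \<bullet> H \<omega>) \<partial>\<mu>))
        + (\<Sum>j<n. \<Sum>i<N. (k j \<bullet> e i) * (\<integral>\<omega>. f \<omega> * (A \<omega> (e i) \<bullet> g j \<omega>) \<partial>\<mu>))"
      unfolding sum.distrib[symmetric] distrib_left[symmetric]
      by (intro sum.cong refl arg_cong2[where f = "(*)"]) (rule dual[OF sg, symmetric], simp)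
    also have "(\<Sum>j<n. \<Sum>i<N. (k j \<bullet> e i) * (\<integral>\<omega>. \<psi> j \<omega> * (A \<omega> (e i) \<bullet> H \<omega>) \<partial>\<mu>))
        = (\<integral>\<omega>. (\<Sum>j<n. \<Sum>i<N. (k j \<bullet> e i) * (\<psi> j \<omega> * (A \<omega> (e i) \<bullet> H \<omega>))) \<partial>\<mu>)"
      by (rule integral_double_sum[symmetric]) (rule integrable_bounded_mult[OF AeH_int \<psi>m C])
    also have "\<dots> = (\<integral>\<omega>. - X N \<omega> \<partial>\<mu>)"
    proof (rule integral_cong_AE)
      show "(\<lambda>\<omega>. \<Sum>j<n. \<Sum>i<N. (k j \<bullet> e i) * (\<psi> j \<omega> * (A \<omega> (e i) \<bullet> H \<omega>))) \<in> borel_measurable \<mu>"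
        using \<psi>m by (intro borel_measurable_sum borel_measurable_times borel_measurable_const borel_measurable_inner Hm Am) simp
      show "(\<lambda>\<omega>. - X N \<omega>) \<in> borel_measurable \<mu>" unfolding X_def
        using \<psi>m by (intro borel_measurable_uminus borel_measurable_sum borel_measurable_times borel_measurable_const borel_measurable_inner borel_measurable_integrable[OF AH]) simp
      show "AE \<omega> in \<mu>. (\<Sum>j<n. \<Sum>i<N. (k j \<bullet> e i) * (\<psi> j \<omega> * (A \<omega> (e i) \<bullet> H \<omega>))) = - X N \<omega>"
        using skew
      proof eventually_elim
        case (elim \<omega>)
        have "A \<omega> (e i) \<bullet> H \<omega> = - (A \<omega> (H \<omega>) \<bullet> e i)" for i
          using elim inner_commute[of "e i" "A \<omega> (H \<omega>)"] by (simp add: skew_symmetric_def)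
        then show ?case unfolding X_def inner_proj sum_distrib_left sum_negf[symmetric]
          by (intro sum.cong refl) (simp add: mult_ac)
      qed
    qed
    also have "(\<Sum>j<n. \<Sum>i<N. (k j \<bullet> e i) * (\<integral>\<omega>. f \<omega> * (A \<omega> (e i) \<bullet> g j \<omega>) \<partial>\<mu>))
        = (\<integral>\<omega>. (\<Sum>j<n. \<Sum>i<N. (k j \<bullet> e i) * (f \<omega> * (A \<omega> (e i) \<bullet> g j \<omega>))) \<partial>\<mu>)"
      by (rule integral_double_sum[symmetric]) (rule integrable_bounded_mult[OF Aeg_int fm fb])
    also have "(\<integral>\<omega>. (\<Sum>j<n. \<Sum>i<N. (k j \<bullet> e i) * (f \<omega> * (A \<omega> (e i) \<bullet> g j \<omega>))) \<partial>\<mu>) = (\<integral>\<omega>. f \<omega> * Y N \<omega> \<partial>\<mu>)"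
    proof (rule Bochner_Integration.integral_cong[OF refl])
      fix \<omega>
      show "(\<Sum>j<n. \<Sum>i<N. (k j \<bullet> e i) * (f \<omega> * (A \<omega> (e i) \<bullet> g j \<omega>))) = f \<omega> * Y N \<omega>"
        unfolding Y_def proj_def blinfun.sum_right blinfun.scaleR_right inner_sum_left sum_distrib_left inner_scaleR_left
        by (intro sum.cong refl) (simp only: mult_ac)
    qed
    finally show ?thesis by (simp only: Bochner_Integration.integral_minus)
  qed
  have left: "(\<lambda>N. \<integral>\<omega>. f \<omega> * (\<Sum>j<n. \<psi> j \<omega> * l j (S N \<omega>)) \<partial>\<mu>) \<longlonglongrightarrow> (\<integral>\<omega>. f \<omega> * flow_rate B n l \<phi> \<omega> \<partial>\<mu>)"
  proof -
    have "(\<lambda>N. \<integral>\<omega>. f \<omega> * (\<Sum>j<n. \<psi> j \<omega> * l j (S N \<omega> - B \<omega>)) \<partial>\<mu>) \<longlonglongrightarrow> 0"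
    proof (rule nn_L1_integral_LIMSEQ_zero[where Z = "\<lambda>N \<omega>. norm (S N \<omega> - B \<omega>)" and C = "C0 * (\<Sum>j<n. C j * norm (l j))"])
      show "(\<lambda>\<omega>. norm (S N \<omega> - B \<omega>)) \<in> borel_measurable \<mu>" for N
        by (intro borel_measurable_norm borel_measurable_diff borel_measurable_integrable[OF Sint] borel_measurable_integrable[OF B]
            measurable_compose[OF _ borel_measurable_norm])
      show "(\<lambda>N. \<integral>\<^sup>+\<omega>. ennreal \<bar>norm (S N \<omega> - B \<omega>)\<bar> \<partial>\<mu>) \<longlonglongrightarrow> 0" unfolding S_def by (rule series)
      show "0 \<le> C0 * (\<Sum>j<n. C j * norm (l j))" using C_nn by (intro mult_nonneg_nonneg C00 sum_nonneg) auto
      fix N \<omega>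
      have "\<bar>\<Sum>j<n. \<psi> j \<omega> * l j (S N \<omega> - B \<omega>)\<bar> \<le> (\<Sum>j<n. \<bar>\<psi> j \<omega> * l j (S N \<omega> - B \<omega>)\<bar>)" by (rule sum_abs)
      also have "\<dots> \<le> (\<Sum>j<n. C j * (norm (l j) * norm (S N \<omega> - B \<omega>)))"
        unfolding abs_mult
      proof (intro sum_mono mult_mono)
        fix j assume j: "j \<in> {..<n}"
        show "\<bar>\<psi> j \<omega>\<bar> \<le> C j" "0 \<le> C j" using C[of j \<omega>] C_nn[of j] j by auto
        show "\<bar>l j (S N \<omega> - B \<omega>)\<bar> \<le> norm (l j) * norm (S N \<omega> - B \<omega>)" using norm_blinfun[of "l j" "S N \<omega> - B \<omega>"] by simp
      qed simp
      also have "\<dots> = (\<Sum>j<n. C j * norm (l j)) * norm (S N \<omega> - B \<omega>)" by (simp add: sum_distrib_right mult.assoc)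
      finally have "\<bar>f \<omega>\<bar> * \<bar>\<Sum>j<n. \<psi> j \<omega> * l j (S N \<omega> - B \<omega>)\<bar> \<le> C0 * ((\<Sum>j<n. C j * norm (l j)) * norm (S N \<omega> - B \<omega>))"
        by (intro mult_mono fb C00) auto
      then show "\<bar>f \<omega> * (\<Sum>j<n. \<psi> j \<omega> * l j (S N \<omega> - B \<omega>))\<bar> \<le> C0 * (\<Sum>j<n. C j * norm (l j)) * \<bar>norm (S N \<omega> - B \<omega>)\<bar>"
        by (simp add: abs_mult mult.assoc)
    qed
    moreover have "(\<integral>\<omega>. f \<omega> * (\<Sum>j<n. \<psi> j \<omega> * l j (S N \<omega> - B \<omega>)) \<partial>\<mu>)
      = (\<integral>\<omega>. f \<omega> * (\<Sum>j<n. \<psi> j \<omega> * l j (S N \<omega>)) \<partial>\<mu>) - (\<integral>\<omega>. f \<omega> * flow_rate B n l \<phi> \<omega> \<partial>\<mu>)" for N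
    proof -
      have i1: "integrable \<mu> (\<lambda>\<omega>. f \<omega> * (\<Sum>j<n. \<psi> j \<omega> * l j (S N \<omega>)))"
        by (intro integrable_bounded_mult[OF _ fm fb] Bochner_Integration.integrable_sum
            integrable_bounded_mult[OF integrable_bounded_linear[OF blinfun.bounded_linear_right Sint] \<psi>m C]) auto
      have i2: "integrable \<mu> (\<lambda>\<omega>. f \<omega> * flow_rate B n l \<phi> \<omega>)" by (rule integrable_bounded_mult[OF flow_rate_integrable[OF \<phi> B] fm fb])
      show ?thesis unfolding Bochner_Integration.integral_diff[OF i1 i2, symmetric]
        by (intro Bochner_Integration.integral_cong refl)
          (simp add: flow_rate_def \<psi>_def blinfun.diff_right right_diff_distrib sum_subtractf)
    qed
    ultimately show ?thesis by (simp add: LIM_zero_cancel)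
  qed
  have X: "(\<lambda>N. \<integral>\<omega>. X N \<omega> \<partial>\<mu>) \<longlonglongrightarrow> (\<integral>\<omega>. (\<Sum>j<n. \<psi> j \<omega> * (k j \<bullet> A \<omega> (H \<omega>))) \<partial>\<mu>)"
  proof (rule integral_dominated_convergence[where w = "\<lambda>\<omega>. (\<Sum>j<n. C j * norm (k j)) * norm (A \<omega> (H \<omega>))"])
    show "(\<lambda>\<omega>. \<Sum>j<n. \<psi> j \<omega> * (k j \<bullet> A \<omega> (H \<omega>))) \<in> borel_measurable \<mu>" "X N \<in> borel_measurable \<mu>" for N
      unfolding X_def[abs_def] using \<psi>m
      by (intro borel_measurable_sum borel_measurable_times borel_measurable_const borel_measurable_inner borel_measurable_integrable[OF AH], simp)+
    show "integrable \<mu> (\<lambda>\<omega>. (\<Sum>j<n. C j * norm (k j)) * norm (A \<omega> (H \<omega>)))" using AH by (intro integrable_mult_right integrable_norm)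
    show "AE \<omega> in \<mu>. (\<lambda>N. X N \<omega>) \<longlonglongrightarrow> (\<Sum>j<n. \<psi> j \<omega> * (k j \<bullet> A \<omega> (H \<omega>)))"
      unfolding X_def by (intro AE_I2 tendsto_intros proj_LIMSEQ)
    show "AE \<omega> in \<mu>. norm (X N \<omega>) \<le> (\<Sum>j<n. C j * norm (k j)) * norm (A \<omega> (H \<omega>))" for N
    proof (rule AE_I2)
      fix \<omega>
      have "\<bar>X N \<omega>\<bar> \<le> (\<Sum>j<n. \<bar>\<psi> j \<omega> * (proj N (k j) \<bullet> A \<omega> (H \<omega>))\<bar>)" unfolding X_def by (rule sum_abs)
      also have "\<dots> \<le> (\<Sum>j<n. C j * (norm (k j) * norm (A \<omega> (H \<omega>))))"
        unfolding abs_mult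
      proof (intro sum_mono mult_mono)
        fix j assume j: "j \<in> {..<n}"
        show "\<bar>\<psi> j \<omega>\<bar> \<le> C j" "0 \<le> C j" using C[of j \<omega>] C_nn[of j] j by auto
        show "\<bar>proj N (k j) \<bullet> A \<omega> (H \<omega>)\<bar> \<le> norm (k j) * norm (A \<omega> (H \<omega>))"
          by (rule order_trans[OF Cauchy_Schwarz_ineq2 mult_right_mono[OF norm_proj_le norm_ge_zero]])
      qed simp
      finally show "norm (X N \<omega>) \<le> (\<Sum>j<n. C j * norm (k j)) * norm (A \<omega> (H \<omega>))" by (simp add: sum_distrib_right mult.assoc)
    qed
  qed
  have Ag: "integrable \<mu> (\<lambda>\<omega>. A \<omega> (g j \<omega>))" if j: "j < n" for j
    unfolding g_def blinfun.sum_right blinfun.scaleR_right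
  proof (rule Bochner_Integration.integrable_sum)
    fix i assume "i \<in> {..<n}"
    then have hC: "Cb_infinity n (pd i (pd j \<phi>))" using Cb_pd[OF Cb_pd[OF \<phi> j]] by simp
    obtain D where D: "\<forall>x. \<bar>pd i (pd j \<phi>) x\<bar> \<le> D" using Cb_bound[OF hC] by blast
    show "integrable \<mu> (\<lambda>\<omega>. h i j \<omega> *\<^sub>R A \<omega> (k i))"
      unfolding h_def by (rule integrable_bounded_scaleR[OF Aint cylinder_measurable[OF hC], of _ D]) (use D in simp)
  qed
  have Y: "(\<lambda>N. \<integral>\<omega>. f \<omega> * Y N \<omega> \<partial>\<mu>) \<longlonglongrightarrow> (\<integral>\<omega>. 0 \<partial>\<mu>)"
  proof (rule integral_dominated_convergence[where w = "\<lambda>\<omega>. C0 * (\<Sum>j<n. norm (k j) * norm (A \<omega> (g j \<omega>)))"])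
    show "(\<lambda>\<omega>. f \<omega> * Y N \<omega>) \<in> borel_measurable \<mu>" for N
      unfolding Y_def using gm by (intro borel_measurable_times fm borel_measurable_sum borel_measurable_inner Am) simp
    show "integrable \<mu> (\<lambda>\<omega>. C0 * (\<Sum>j<n. norm (k j) * norm (A \<omega> (g j \<omega>))))"
      using Ag by (intro integrable_mult_right Bochner_Integration.integrable_sum integrable_norm) simp
    have YA: "AE \<omega> in \<mu>. \<forall>N. Y N \<omega> = - (\<Sum>j<n. proj N (k j) \<bullet> A \<omega> (g j \<omega>))"
      using skew by eventually_elim (simp add: Y_def skew_symmetric_def sum_negf)
    show "AE \<omega> in \<mu>. (\<lambda>N. f \<omega> * Y N \<omega>) \<longlonglongrightarrow> 0"
      using YA skew
    proof eventually_elim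
      case (elim \<omega>)
      have q: "k j \<bullet> A \<omega> (k i) = - (k i \<bullet> A \<omega> (k j))" for i j
        using elim(2) inner_commute[of "A \<omega> (k j)" "k i"] unfolding skew_symmetric_def by (simp only: minus_minus)
      have "(\<Sum>j<n. k j \<bullet> A \<omega> (g j \<omega>)) = (\<Sum>j<n. \<Sum>i<n. h i j \<omega> * (k j \<bullet> A \<omega> (k i)))"
        by (simp add: g_def blinfun.sum_right blinfun.scaleR_right inner_sum_right)
      also have "\<dots> = 0"
      proof (rule antisymmetric_sum_zero)
        show "h i j \<omega> = h j i \<omega>" if "i < n" "j < n" for i j unfolding h_def pd_commute[OF \<phi> that] ..
        show "k j \<bullet> A \<omega> (k i) = - (k i \<bullet> A \<omega> (k j))" for i j by (rule q)
      qed
      finally have z: "(\<Sum>j<n. k j \<bullet> A \<omega> (g j \<omega>)) = 0" .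
      have "(\<lambda>N. f \<omega> * (- (\<Sum>j<n. proj N (k j) \<bullet> A \<omega> (g j \<omega>)))) \<longlonglongrightarrow> f \<omega> * (- (\<Sum>j<n. k j \<bullet> A \<omega> (g j \<omega>)))"
        by (intro tendsto_intros proj_LIMSEQ)
      then show ?case using elim(1) z by simp
    qed
    show "AE \<omega> in \<mu>. norm (f \<omega> * Y N \<omega>) \<le> C0 * (\<Sum>j<n. norm (k j) * norm (A \<omega> (g j \<omega>)))" for N
      using YA
    proof eventually_elim
      case (elim \<omega>)
      have "\<bar>Y N \<omega>\<bar> \<le> (\<Sum>j<n. \<bar>proj N (k j) \<bullet> A \<omega> (g j \<omega>)\<bar>)" using elim by (simp add: sum_abs)
      also have "\<dots> \<le> (\<Sum>j<n. norm (k j) * norm (A \<omega> (g j \<omega>)))"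
        by (intro sum_mono order_trans[OF Cauchy_Schwarz_ineq2 mult_right_mono[OF norm_proj_le norm_ge_zero]])
      finally show ?case unfolding real_norm_def abs_mult by (intro mult_mono fb C00) auto
    qed
  qed simp
  have "(\<lambda>N. \<integral>\<omega>. f \<omega> * (\<Sum>j<n. \<psi> j \<omega> * l j (S N \<omega>)) \<partial>\<mu>) \<longlonglongrightarrow> - (\<integral>\<omega>. (\<Sum>j<n. \<psi> j \<omega> * (k j \<bullet> A \<omega> (H \<omega>))) \<partial>\<mu>) + 0"
    unfolding partial using tendsto_add[OF tendsto_minus[OF X] Y] by simp
  from LIMSEQ_unique[OF left this]
  show ?thesis by (simp add: \<psi>_def k_def inner_sum_right inner_commute)
qed

lemma smooth_grad_integrable:
  assumes "smooth_grad \<iota> F G"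
  shows "integrable \<mu> F" "integrable \<mu> G"
proof -
  obtain C where C: "\<And>\<omega>. \<bar>F \<omega>\<bar> \<le> C" "\<And>\<omega>. norm (G \<omega>) \<le> C" using smooth_grad_bounded[OF assms] by blast
  show "integrable \<mu> F"
    by (rule integrable_const_bound[of _ C, OF _ smooth_grad_measurable(1)[OF assms]]) (simp add: C)
  show "integrable \<mu> G"
    by (rule integrable_const_bound[of _ C, OF _ smooth_grad_measurable(2)[OF assms]]) (simp add: C)
qed

lemma Lp_AE_subseq:
  fixes F :: "nat \<Rightarrow> 'w \<Rightarrow> real"
  assumes "Lp_conv \<mu> p F f" "1 \<le> p" and m: "\<And>n. F n \<in> borel_measurable \<mu>" "f \<in> borel_measurable \<mu>"
  shows "\<exists>r :: nat \<Rightarrow> nat. strict_mono r \<and> (AE \<omega> in \<mu>. (\<lambda>n. F (r n) \<omega>) \<longlonglongrightarrow> f \<omega>)"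
proof -
  have L: "(\<lambda>n. \<integral>\<^sup>+\<omega>. ennreal (norm (F n \<omega> - f \<omega>)) \<partial>\<mu>) \<longlonglongrightarrow> 0" by (rule Lp_conv_L1[OF assms])
  have M: "(\<lambda>\<omega>. F n \<omega> - f \<omega>) \<in> borel_measurable \<mu>" for n by (intro borel_measurable_diff m)
  obtain r :: "nat \<Rightarrow> nat" where "strict_mono r" and "AE \<omega> in \<mu>. (\<lambda>n. F (r n) \<omega> - f \<omega>) \<longlonglongrightarrow> 0"
    using nn_L1_AE_subseq[of "\<lambda>n \<omega>. F n \<omega> - f \<omega>" \<mu>, OF M L] by blast
  then show ?thesis by (intro exI[of _ r] conjI) (auto elim: eventually_mono LIM_zero_cancel)
qed

text \<open>
  The integrability of \<open>(A e\<^sub>i, u) = - (e\<^sub>i, A u)\<close> for all \<open>u\<close> in the Sobolev space makes the pairing of \<open>A e\<^sub>i\<close> with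
  the approximating gradients converge in \<open>L\<^sup>1\<close>. The function \<open>H\<close> is the limit of gradients whose own derivatives
  converge as well.
\<close>

lemma sobolev_gradient_duality:
  fixes A :: "'w \<Rightarrow> 'h \<Rightarrow>\<^sub>L 'h"
  assumes p: "1 \<le> p" and Am: "\<And>h. (\<lambda>\<omega>. A \<omega> h) \<in> borel_measurable \<mu>" and skew: "AE \<omega> in \<mu>. skew_symmetric (A \<omega>)"
    and AS: "\<And>u. u \<in> sobolev_H_1 \<mu> \<iota> p \<Longrightarrow> (\<lambda>\<omega>. A \<omega> (u \<omega>)) \<in> sobolev_H_1 \<mu> \<iota> p"
    and d: "\<And>i. has_divergence \<mu> \<iota> (\<lambda>\<omega>. A \<omega> (e i)) (d i)"
    and f2: "f \<in> sobolev_2 \<mu> \<iota> p" and fb: "\<And>\<omega>. \<bar>f \<omega>\<bar> \<le> C0" and G: "malliavin_grad \<mu> \<iota> p f G"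
  shows "\<exists>H \<in> sobolev_H_1 \<mu> \<iota> p. (AE \<omega> in \<mu>. G \<omega> = H \<omega>) \<and>
    (\<forall>i \<psi> g. smooth_grad \<iota> \<psi> g \<longrightarrow>
      (\<integral>\<omega>. \<psi> \<omega> * (A \<omega> (e i) \<bullet> H \<omega>) \<partial>\<mu>) + (\<integral>\<omega>. f \<omega> * (A \<omega> (e i) \<bullet> g \<omega>) \<partial>\<mu>) = (\<integral>\<omega>. f \<omega> * \<psi> \<omega> * d i \<omega> \<partial>\<mu>))"
proof -
  have fm: "f \<in> borel_measurable \<mu>" and ex: "\<exists>H K F' G' K'. H \<in> borel_measurable \<mu> \<and>
        (\<forall>n. smooth_grad \<iota> (F' n) (G' n) \<and> smooth_grad_H \<iota> (G' n) (K' n)) \<and>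
        Lp_conv \<mu> p F' f \<and> Lp_conv \<mu> p G' H \<and> Lp_conv_HS \<mu> p K' K"
    using f2 by (simp_all add: sobolev_2_def)
  from ex obtain H K F' G' K' where *: "H \<in> borel_measurable \<mu> \<and>
        (\<forall>n. smooth_grad \<iota> (F' n) (G' n) \<and> smooth_grad_H \<iota> (G' n) (K' n)) \<and>
        Lp_conv \<mu> p F' f \<and> Lp_conv \<mu> p G' H \<and> Lp_conv_HS \<mu> p K' K" by (elim exE)
  have Hm: "H \<in> borel_measurable \<mu>" and sg: "\<And>n. smooth_grad \<iota> (F' n) (G' n)" and sgH: "\<And>n. smooth_grad_H \<iota> (G' n) (K' n)"
    and Fc: "Lp_conv \<mu> p F' f" and Gc: "Lp_conv \<mu> p G' H" and Kc: "Lp_conv_HS \<mu> p K' K" using * by simp_all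
  have HS: "H \<in> sobolev_H_1 \<mu> \<iota> p"
  proof -
    have "\<exists>K u' K'. (\<forall>n. smooth_grad_H \<iota> (u' n) (K' n)) \<and> Lp_conv \<mu> p u' H \<and> Lp_conv_HS \<mu> p K' K"
      by (intro exI conjI) (rule allI, rule sgH, rule Gc, rule Kc)
    then show ?thesis unfolding sobolev_H_1_def using Hm by simp
  qed
  have Hint: "integrable \<mu> H" by (rule sobolev_H_1_integrable[OF HS p])
  from Lp_AE_subseq[OF Fc p smooth_grad_measurable(1)[OF sg] fm] obtain r
    where r: "strict_mono r" "AE \<omega> in \<mu>. (\<lambda>n. F' (r n) \<omega>) \<longlonglongrightarrow> f \<omega>" by blast
  have GL: "(\<lambda>n. \<integral>\<^sup>+\<omega>. ennreal (norm (G' n \<omega> - H \<omega>)) \<partial>\<mu>) \<longlonglongrightarrow> 0"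
    by (rule Lp_conv_L1[OF Gc p smooth_grad_measurable(2)[OF sg] Hm])
  have AEGH: "AE \<omega> in \<mu>. G \<omega> = H \<omega>"
  proof -
    from G have Gm: "G \<in> borel_measurable \<mu>" and ex: "\<exists>F1 G1. (\<forall>n. smooth_grad \<iota> (F1 n) (G1 n)) \<and> Lp_conv \<mu> p F1 f \<and> Lp_conv \<mu> p G1 G"
      by (simp_all add: malliavin_grad_def)
    from ex obtain F1 G1 where **: "(\<forall>n. smooth_grad \<iota> (F1 n) (G1 n)) \<and> Lp_conv \<mu> p F1 f \<and> Lp_conv \<mu> p G1 G" by (elim exE)
    have sg1: "\<And>n. smooth_grad \<iota> (F1 n) (G1 n)" and Fc1: "Lp_conv \<mu> p F1 f" and Gc1: "Lp_conv \<mu> p G1 G" using ** by simp_all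
    from Lp_AE_subseq[OF Fc1 p smooth_grad_measurable(1)[OF sg1] fm] obtain r1
      where r1: "strict_mono r1" "AE \<omega> in \<mu>. (\<lambda>n. F1 (r1 n) \<omega>) \<longlonglongrightarrow> f \<omega>" by blast
    have GL1: "(\<lambda>n. \<integral>\<^sup>+\<omega>. ennreal (norm (G1 n \<omega> - G \<omega>)) \<partial>\<mu>) \<longlonglongrightarrow> 0"
      by (rule Lp_conv_L1[OF Gc1 p smooth_grad_measurable(2)[OF sg1] Gm])
    have Gint: "integrable \<mu> G" by (rule integrable_L1_limit[OF smooth_grad_integrable(2)[OF sg1] Gm GL1])
    show ?thesis
      by (rule gradient_unique[OF fm, where F = "\<lambda>n. F1 (r1 n)" and G = "\<lambda>n. G1 (r1 n)" and F' = "\<lambda>n. F' (r n)" and G' = "\<lambda>n. G' (r n)"])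
        (rule sg1, rule r1(2), rule LIMSEQ_subseq_LIMSEQ[OF GL1 r1(1), unfolded comp_def], rule Gint,
         rule sg, rule r(2), rule LIMSEQ_subseq_LIMSEQ[OF GL r(1), unfolded comp_def], rule Hint)
  qed
  have dual: "(\<integral>\<omega>. \<psi> \<omega> * (A \<omega> (e i) \<bullet> H \<omega>) \<partial>\<mu>) + (\<integral>\<omega>. f \<omega> * (A \<omega> (e i) \<bullet> g \<omega>) \<partial>\<mu>) = (\<integral>\<omega>. f \<omega> * \<psi> \<omega> * d i \<omega> \<partial>\<mu>)"
    if \<psi>: "smooth_grad \<iota> \<psi> g" for i \<psi> g
  proof -
    have aint: "integrable \<mu> (\<lambda>\<omega>. A \<omega> (e i) \<bullet> w \<omega>)" if w: "w \<in> sobolev_H_1 \<mu> \<iota> p" for w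
    proof -
      have wm: "w \<in> borel_measurable \<mu>" using w by (simp add: sobolev_H_1_def)
      have "integrable \<mu> (\<lambda>\<omega>. - (e i \<bullet> A \<omega> (w \<omega>)))"
        using sobolev_H_1_integrable[OF AS[OF w] p] by (intro integrable_minus integrable_inner_right) simp
      then show ?thesis
        by (rule integrable_cong_AE_imp)
          (intro borel_measurable_inner Am wm, use skew in eventually_elim, simp add: skew_symmetric_def)
    qed
    have L: "(\<lambda>n. \<integral>\<^sup>+\<omega>. ennreal \<bar>A \<omega> (e i) \<bullet> G' n \<omega> - A \<omega> (e i) \<bullet> H \<omega>\<bar> \<partial>\<mu>) \<longlonglongrightarrow> 0"
      by (rule weak_pairing_LIMSEQ[OF Am aint p sgH Hm Gc Kc])
    show ?thesis
      by (rule bounded_duality[where F = "\<lambda>n. F' (r n)" and G = "\<lambda>n. G' (r n)", OF d sg r(2) fm aint[OF HS]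
          LIMSEQ_subseq_LIMSEQ[OF L r(1), unfolded comp_def] \<psi> fb])
  qed
  show ?thesis by (intro bexI[OF _ HS] conjI AEGH allI impI) (rule dual)
qed

end

theorem proposition6p6:
  fixes \<mu> :: "'w::{banach, second_countable_topology} measure"
    and \<iota> :: "'h::{real_inner, banach, second_countable_topology} \<Rightarrow>\<^sub>L 'w"
    and p :: real
    and A :: "'w \<Rightarrow> 'h \<Rightarrow>\<^sub>L 'h"
    and e :: "nat \<Rightarrow> 'h"
    and d :: "nat \<Rightarrow> 'w \<Rightarrow> real"
    and B :: "'w \<Rightarrow> 'w"
    and T :: "real \<Rightarrow> 'w \<Rightarrow> 'w"
    and f0 :: "'w \<Rightarrow> real"
    and f :: "real \<Rightarrow> 'w \<Rightarrow> real"
    and G :: "real \<Rightarrow> 'w \<Rightarrow> 'h"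
  assumes wiener: "abstract_wiener_space \<mu> \<iota>"
    and p: "p > 1"
    and A_measurable: "\<And>h. (\<lambda>\<omega>. A \<omega> h) \<in> borel_measurable \<mu>"
    and A_skew: "AE \<omega> in \<mu>. skew_symmetric (A \<omega>)"
    and A_sobolev: "\<And>u. u \<in> sobolev_H_1 \<mu> \<iota> p \<Longrightarrow> (\<lambda>\<omega>. A \<omega> (u \<omega>)) \<in> sobolev_H_1 \<mu> \<iota> p"
    and basis: "smooth_onb \<iota> e"
    and d: "\<And>i. has_divergence \<mu> \<iota> (\<lambda>\<omega>. A \<omega> (e i)) (d i)"
    and B_integrable: "integrable \<mu> B"
    and B_series: "Lp_conv \<mu> 1 (\<lambda>N \<omega>. \<Sum>i<N. d i \<omega> *\<^sub>R \<iota> (e i)) B"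
    and stationary: "stationary_process \<mu> T"
    and ode: "AE \<omega> in \<mu>. \<forall>t. ((\<lambda>s. T s \<omega>) has_vector_derivative B (T t \<omega>)) (at t)"
    and f0_smooth: "smooth_functional f0"
    and f_def: "\<And>t \<omega>. f t \<omega> = f0 (T t \<omega>)"
    and f_sobolev: "\<And>t. f t \<in> sobolev_2 \<mu> \<iota> p"
    and f_grad: "\<And>t. malliavin_grad \<mu> \<iota> p (f t) (G t)"
  shows "\<exists>D. (\<forall>t. has_divergence \<mu> \<iota> (\<lambda>\<omega>. A \<omega> (G t \<omega>)) (D t)) \<and>
             (AE \<omega> in \<mu>. \<forall>t. ((\<lambda>s. f s \<omega>) has_real_derivative D t \<omega>) (at t)) \<and>
             (\<forall>\<omega>. f 0 \<omega> = f0 \<omega>)"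
proof -
  interpret wiener_basis \<mu> e \<iota> by (rule wiener_basisI[OF wiener basis])
  have p1: "1 \<le> p" using p by simp
  have Tm: "T s \<in> measurable \<mu> \<mu>" and Td: "distr \<mu> \<mu> (T s) = \<mu>" and T0: "T 0 \<omega> = \<omega>" for s \<omega>
    using stationary unfolding stationary_process_def by auto
  from f0_smooth obtain n l \<phi> where "Cb_infinity n \<phi> \<and> f0 = cylinder l \<phi>"
    unfolding smooth_functional_def by (elim exE)
  then have \<phi>: "Cb_infinity n \<phi>" and f: "f t \<omega> = \<phi> (\<lambda>j. l j (T t \<omega>))" for t \<omega>
    by (simp_all add: f_def cylinder_def)
  obtain C0 where "\<forall>x. \<bar>\<phi> x\<bar> \<le> C0" using Cb_bound[OF \<phi>] by blast
  then have fb: "\<bar>f t \<omega>\<bar> \<le> C0" for t \<omega> by (simp add: f)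
  define D where "D t \<omega> = flow_rate B n l \<phi> (T t \<omega>)" for t \<omega>
  have rate_int: "integrable \<mu> (flow_rate B n l \<phi>)" by (rule flow_rate_integrable[OF \<phi> B_integrable])
  have D_int: "integrable \<mu> (D t)" for t
    using rate_int integrable_distr_eq[OF Tm[of t] borel_measurable_integrable[OF rate_int]] unfolding Td D_def[abs_def] by simp
  have Aint: "integrable \<mu> (\<lambda>\<omega>. A \<omega> h)" for h
    by (rule sobolev_H_1_integrable[OF A_sobolev[OF const_in_sobolev_H_1] p1])
  have dint: "integrable \<mu> (d i)" for i using d[of i] by (simp add: has_divergence_def)
  have series: "(\<lambda>N. \<integral>\<^sup>+\<omega>. ennreal \<bar>norm ((\<Sum>i<N. d i \<omega> *\<^sub>R \<iota> (e i)) - B \<omega>)\<bar> \<partial>\<mu>) \<longlonglongrightarrow> 0"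
    using B_series by (simp add: Lp_conv_def Lp_null_def)
  have div: "has_divergence \<mu> \<iota> (\<lambda>\<omega>. A \<omega> (G t \<omega>)) (D t)" for t
  proof -
    have "\<exists>H \<in> sobolev_H_1 \<mu> \<iota> p. (AE \<omega> in \<mu>. G t \<omega> = H \<omega>) \<and>
      (\<forall>i \<psi> g. smooth_grad \<iota> \<psi> g \<longrightarrow>
        (\<integral>\<omega>. \<psi> \<omega> * (A \<omega> (e i) \<bullet> H \<omega>) \<partial>\<mu>) + (\<integral>\<omega>. f t \<omega> * (A \<omega> (e i) \<bullet> g \<omega>) \<partial>\<mu>) = (\<integral>\<omega>. f t \<omega> * \<psi> \<omega> * d i \<omega> \<partial>\<mu>))"
      by (rule sobolev_gradient_duality[OF p1 A_measurable A_skew _ d f_sobolev fb f_grad]) (rule A_sobolev)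
    then obtain H where HS: "H \<in> sobolev_H_1 \<mu> \<iota> p" and GH: "AE \<omega> in \<mu>. G t \<omega> = H \<omega>"
      and dual: "\<forall>i \<psi> g. smooth_grad \<iota> \<psi> g \<longrightarrow>
        (\<integral>\<omega>. \<psi> \<omega> * (A \<omega> (e i) \<bullet> H \<omega>) \<partial>\<mu>) + (\<integral>\<omega>. f t \<omega> * (A \<omega> (e i) \<bullet> g \<omega>) \<partial>\<mu>) = (\<integral>\<omega>. f t \<omega> * \<psi> \<omega> * d i \<omega> \<partial>\<mu>)"
      by (elim bexE conjE)
    have Hm: "H \<in> borel_measurable \<mu>" using HS by (simp add: sobolev_H_1_def)
    have fm: "f t \<in> borel_measurable \<mu>" and Gm: "G t \<in> borel_measurable \<mu>" using f_grad[of t] by (simp_all add: malliavin_grad_def)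
    have AH: "integrable \<mu> (\<lambda>\<omega>. A \<omega> (H \<omega>))" by (rule sobolev_H_1_integrable[OF A_sobolev[OF HS] p1])
    have AGm: "(\<lambda>\<omega>. A \<omega> (G t \<omega>)) \<in> borel_measurable \<mu>" by (rule random_operator_measurable[OF A_measurable Gm])
    have AG: "integrable \<mu> (\<lambda>\<omega>. A \<omega> (G t \<omega>))"
      by (rule integrable_cong_AE_imp[OF AH AGm]) (use GH in eventually_elim, simp)
    have "(\<integral>\<omega>. A \<omega> (G t \<omega>) \<bullet> g \<omega> \<partial>\<mu>) = (\<integral>\<omega>. \<Phi> \<omega> * D t \<omega> \<partial>\<mu>)" if sg: "smooth_grad \<iota> \<Phi> g" for \<Phi> g
    proof -
      from sg obtain m k \<psi> where "Cb_infinity m \<psi> \<and> \<Phi> = cylinder k \<psi> \<and> g = (\<lambda>\<omega>. \<Sum>j<m. cylinder k (pd j \<psi>) \<omega> *\<^sub>R dual_embed \<iota> (k j))"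
        unfolding smooth_grad_def by (elim exE)
      then have \<psi>: "Cb_infinity m \<psi>" and \<Phi>: "\<Phi> = (\<lambda>\<omega>. \<psi> (\<lambda>j. k j \<omega>))"
        and g: "g = (\<lambda>\<omega>. \<Sum>j<m. pd j \<psi> (\<lambda>i. k i \<omega>) *\<^sub>R dual_embed \<iota> (k j))"
        by (simp_all add: cylinder_def fun_eq_iff)
      have gm: "g \<in> borel_measurable \<mu>" by (rule smooth_grad_measurable(2)[OF sg])
      have "(\<integral>\<omega>. A \<omega> (G t \<omega>) \<bullet> g \<omega> \<partial>\<mu>) = (\<integral>\<omega>. A \<omega> (H \<omega>) \<bullet> g \<omega> \<partial>\<mu>)"
        by (rule integral_cong_AE) (intro borel_measurable_inner AGm gm borel_measurable_integrable[OF AH],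
            intro borel_measurable_inner gm borel_measurable_integrable[OF AH], use GH in eventually_elim, simp)
      also have "\<dots> = - (\<integral>\<omega>. f t \<omega> * flow_rate B m k \<psi> \<omega> \<partial>\<mu>)"
        unfolding g using drift_pairing[OF A_skew Aint AH Hm dint B_integrable series fm fb dual[rule_format] \<psi>, of k] by simp
      also have "\<dots> = (\<integral>\<omega>. \<Phi> \<omega> * D t \<omega> \<partial>\<mu>)"
        unfolding \<Phi> D_def f by (rule flow_antisymmetry[OF \<phi> \<psi> B_integrable stationary ode, symmetric])
      finally show ?thesis .
    qed
    then show ?thesis unfolding has_divergence_def using AG D_int by blast
  qed
  moreover have "AE \<omega> in \<mu>. \<forall>t. ((\<lambda>s. f s \<omega>) has_real_derivative D t \<omega>) (at t)"
    using ode unfolding f D_def by eventually_elim (blast intro: flow_rate_derivative[OF \<phi>])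
  moreover have "f 0 \<omega> = f0 \<omega>" for \<omega> by (simp add: f_def T0)
  ultimately show ?thesis by blast
qed

end
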